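(* Assume that for every $n\in\mathbb{T}$ there exists $B_n<\infty$ such that $w_n(\mathbf{x}_n)\le B_n$ for all $\mathbf{x}_n\in\mathcal{S}_n$. Then for any $n\in\mathbb{T}$ and any $p\ge 1$ there exist constants $C_{1,n},C_{2,p}<\infty$ such that for any initial values $\mathbf{x}_{1:n}^{(0)}=(\mathbf{x}_1^{(0)},\ldots,\mathbf{x}_n^{(0)})\in\mathcal{S}_1\times\cdots\times\mathcal{S}_n$, any $f_n\in B(E_n)$ and any $i\in\mathbb{N}_0$, $$\mathbb{E}_{\mathbf{x}_{1:n}^{(0)}}\left[\left|\widehat{\pi}_n^{(i)}(f_n)-\pi_n(f_n)\right|^p\right]^{1/p}\le\frac{C_{1,n}C_{2,p}}{(i+1)^{1/2}}.$$
   Context: Targets. $P\ge 1$ is an integer and $\mathbb{T}=\{1,\ldots,P\}$. $(E,\mathcal{F})$ is a measurable space; $E_1=E$, $\mathcal{F}_1=\mathcal{F}$, $E_n=E_{n-1}\times E$, $\mathcal{F}_n=\mathcal{F}_{n-1}\times\mathcal{F}$; write $\mathbf{x}_n=(x_1,\ldots,x_n)\in E_n$. Each $\pi_n$ is a probability measure on $(E_n,\mathcal{F}_n)$ with density $\pi_n(\mathbf{x}_n)=\gamma_n(\mathbf{x}_n)/Z_n$ with respect to a $\sigma$-finite measure $d\mathbf{x}_n$, where $d\mathbf{x}_n=d\mathbf{x}_{n-1}\times dx_n$, $\gamma_n:E_n\to\mathbb{R}^+$ and $Z_n\in(0,\infty)$ is the normalizing constant. Let $\mathcal{S}_n=\{\mathbf{x}_n\in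 E_n:\pi_n(\mathbf{x}_n)>0\}$. Proposals and weights. $q_1$ is a probability density on $E$ with respect to $dx_1$; for $n\ge 2$, $q_n(\mathbf{x}_{n-1},x_n)$ is a probability density in $x_n$ with respect to $dx_n$ for each $\mathbf{x}_{n-1}\in E_{n-1}$. The weights are $w_1(\mathbf{x}_1)=\gamma_1(\mathbf{x}_1)/q_1(\mathbf{x}_1)$ and, for $n\ge2$, $w_n(\mathbf{x}_n)=\dfrac{\gamma_n(\mathbf{x}_n)}{\gamma_{n-1}(\mathbf{x}_{n-1})q_n(\mathbf{x}_{n-1},x_n)}$ (a ratio $a/0$ with $a>0$ is $+\infty$). For a measure $\mu$ on $E_{n-1}$, $(\mu\times q_n)(d\mathbf{x}_n)=\mu(d\mathbf{x}_{n-1})q_n(\mathbf{x}_{n-1},x_n)dx_n$. Algorithm (SIMCMC). Set $\mathbf{X}_n^{(0)}=\mathbf{x}_n^{(0)}\in\mathcal{S}_n$ for $n\in\mathbb{T}$. At each iteration $i\ge1$, process $n=1,2,\ldots,P$ in order: for $n=1$ sample $\mathbf{X}_1^{*(i)}\sim q_1$; for $n\ge2$ sample $\mathbf{X}_n^{*(i)}\sim\widehat{\pi}_{n-1}^{(i)}\times q_n$. With probability $1\wedge\frac{w_n(\mathbf{X}_n^{*(i)})}{w_n(\mathbf{X}_n^{(i-1)})}$ set $\mathbf{X}_n^{(i)}=\mathbf{X}_n^{*(i)}$, otherwise set $\mathbf{X}_n^{(i)}=\mathbf{X}_n^{(i-1)}$. All proposal and acceptance draws are made with fresh independent randomness given the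 past. Here $\widehat{\pi}_n^{(i)}=\frac{1}{i+1}\sum_{m=0}^{i}\delta_{\mathbf{X}_n^{(m)}}$ is the empirical measure. Notation. $\mathbb{E}_{\mathbf{x}_{1:n}^{(0)}}$ is expectation for the algorithm initialized at $\mathbf{x}_{1:n}^{(0)}$. $\mu(f)=\int f\,d\mu$. $\mathbb{N}_0=\mathbb{N}\cup\{0\}$. $B(E_n)$ is the set of (measurable) $f_n:E_n\to\mathbb{R}$ with $\sup_{\mathbf{x}_n\in E_n}|f_n(\mathbf{x}_n)|\le1$. Subscripts on constants indicate what they depend on: $C_{1,n}$ on $n$ and $C_{2,p}$ on $p$ (for the fixed model and proposals). *)

theory Defs
  imports "HOL-Probability.Probability"
begin

text \<open>
  A path \<open>(x\<^sub>1, \<dots>, x\<^sub>n)\<close> in \<open>E\<^sub>n\<close> is a function \<open>x\<close> that is extensional on \<open>{1..n}\<close>. So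
  \<open>x(n := y)\<close> appends \<open>y\<close> to a path of length \<open>n - 1\<close>, and \<open>restrict x {1..n - 1}\<close> drops the
  last coordinate of a path of length \<open>n\<close>. The type of densities on \<open>E\<^sub>n\<close> is the same for all \<open>n\<close>;
  their values outside \<open>E\<^sub>n\<close> never matter.
\<close>

definition paths :: "'a measure \<Rightarrow> nat \<Rightarrow> (nat \<Rightarrow> 'a) measure"
  where "paths E n = Pi\<^sub>M {1..n} (\<lambda>_. E)"

text \<open>
  \<open>E\<close> serves only as the measurable space. The measure \<open>ref n\<close> is the reference measure
  \<open>dx\<^sub>n\<close> of the \<open>n\<close>-th coordinate, and \<open>q1\<close>, \<open>q n\<close> (for \<open>n \<ge> 2\<close>) are the proposal densities.
\<close>

locale simcmc =
  fixes P :: nat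
    and E :: "'a measure"
    and ref :: "nat \<Rightarrow> 'a measure"
    and \<gamma> :: "nat \<Rightarrow> (nat \<Rightarrow> 'a) \<Rightarrow> real"
    and q1 :: "'a \<Rightarrow> real"
    and q :: "nat \<Rightarrow> (nat \<Rightarrow> 'a) \<Rightarrow> 'a \<Rightarrow> real"
  assumes P_ge_1: "1 \<le> P"
    and sets_ref: "n \<in> {1..P} \<Longrightarrow> sets (ref n) = sets E"
    and sigma_finite_ref: "n \<in> {1..P} \<Longrightarrow> sigma_finite_measure (ref n)"
    and gamma_nonneg: "n \<in> {1..P} \<Longrightarrow> x \<in> space (paths E n) \<Longrightarrow> 0 \<le> \<gamma> n x"
    and gamma_integrable: "n \<in> {1..P} \<Longrightarrow> integrable (Pi\<^sub>M {1..n} ref) (\<gamma> n)"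
    and gamma_integral_pos: "n \<in> {1..P} \<Longrightarrow> 0 < (LINT x|Pi\<^sub>M {1..n} ref. \<gamma> n x)"
    and q1_measurable: "q1 \<in> borel_measurable E"
    and q1_nonneg: "y \<in> space E \<Longrightarrow> 0 \<le> q1 y"
    and q1_density: "(\<integral>\<^sup>+y. ennreal (q1 y) \<partial>ref 1) = 1"
    and q_measurable:
      "n \<in> {2..P} \<Longrightarrow> (\<lambda>(x, y). q n x y) \<in> borel_measurable (paths E (n - 1) \<Otimes>\<^sub>M E)"
    and q_nonneg:
      "n \<in> {2..P} \<Longrightarrow> x \<in> space (paths E (n - 1)) \<Longrightarrow> y \<in> space E \<Longrightarrow> 0 \<le> q n x y"
    and q_density:
      "n \<in> {2..P} \<Longrightarrow> x \<in> space (paths E (n - 1)) \<Longrightarrow> (\<integral>\<^sup>+y. ennreal (q n x y) \<partial>ref n) = 1"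
begin

definition Z :: "nat \<Rightarrow> real"
  where "Z n = (LINT x|Pi\<^sub>M {1..n} ref. \<gamma> n x)"

definition target :: "nat \<Rightarrow> (nat \<Rightarrow> 'a) measure"
  where "target n = density (Pi\<^sub>M {1..n} ref) (\<lambda>x. ennreal (\<gamma> n x / Z n))"

definition supp :: "nat \<Rightarrow> (nat \<Rightarrow> 'a) set"
  where "supp n = {x \<in> space (paths E n). 0 < \<gamma> n x / Z n}"

text \<open>
  Division is that of \<^typ>\<open>ennreal\<close>: \<open>a / 0 = \<infinity>\<close> for \<open>a > 0\<close>. It also puts \<open>0 / 0 = 0\<close>, a value that
  concerns only paths outside \<open>supp n\<close> and so is not constrained by a bound on the weights on \<open>supp n\<close>.
\<close>

definition weight :: "nat \<Rightarrow> (nat \<Rightarrow> 'a) \<Rightarrow> ennreal"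
  where "weight n x =
    (if n = 1 then ennreal (\<gamma> 1 x) / ennreal (q1 (x 1))
     else ennreal (\<gamma> n x) /
       ennreal (\<gamma> (n - 1) (restrict x {1..n - 1}) * q n (restrict x {1..n - 1}) (x n)))"

text \<open>The measure \<open>\<mu> \<times> q\<^sub>n\<close> on \<open>E\<^sub>n\<close>, for \<open>\<mu>\<close> on \<open>E\<^sub>n\<^sub>-\<^sub>1\<close>.\<close>

definition extend :: "nat \<Rightarrow> (nat \<Rightarrow> 'a) measure \<Rightarrow> (nat \<Rightarrow> 'a) measure"
  where "extend n \<mu> =
    distr (density (\<mu> \<Otimes>\<^sub>M ref n) (\<lambda>(x, y). ennreal (q n x y))) (paths E n) (\<lambda>(x, y). x(n := y))"

text \<open>
  A history \<open>h\<close> records \<open>h (m, k) = X\<^sub>k\<^sup>(\<^sup>m\<^sup>)\<close> for the pairs \<open>(m, k)\<close> of iteration and level processed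
  so far. After level \<open>n\<close> of iteration \<open>i\<close> these are the pairs in \<open>processed i n\<close>.
\<close>

definition processed :: "nat \<Rightarrow> nat \<Rightarrow> (nat \<times> nat) set"
  where "processed i n = {..<i} \<times> {1..P} \<union> {i} \<times> {1..n}"

definition histories :: "nat \<Rightarrow> nat \<Rightarrow> (nat \<times> nat \<Rightarrow> nat \<Rightarrow> 'a) measure"
  where "histories i n = Pi\<^sub>M (processed i n) (\<lambda>(m, k). paths E k)"

text \<open>
  The empirical measure of \<open>X\<^sub>n\<^sup>(\<^sup>0\<^sup>), \<dots>, X\<^sub>n\<^sup>(\<^sup>i\<^sup>)\<close>, as the image of the uniform distribution on the
  indices \<open>0, \<dots>, i\<close>; see \<open>emeasure_empirical\<close> for it as the average of Dirac measures.
\<close>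

definition empirical :: "nat \<Rightarrow> nat \<Rightarrow> (nat \<times> nat \<Rightarrow> nat \<Rightarrow> 'a) \<Rightarrow> (nat \<Rightarrow> 'a) measure"
  where "empirical n i h = distr (uniform_count_measure {..i}) (paths E n) (\<lambda>m. h (m, n))"

definition proposal :: "nat \<Rightarrow> nat \<Rightarrow> (nat \<times> nat \<Rightarrow> nat \<Rightarrow> 'a) \<Rightarrow> (nat \<Rightarrow> 'a) measure"
  where "proposal i n h =
    (if n = 1 then distr (density (ref 1) (\<lambda>y. ennreal (q1 y))) (paths E 1) (\<lambda>y. \<lambda>k\<in>{1}. y)
     else extend n (empirical (n - 1) i h))"

definition accept_prob :: "nat \<Rightarrow> (nat \<Rightarrow> 'a) \<Rightarrow> (nat \<Rightarrow> 'a) \<Rightarrow> real"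
  where "accept_prob n x y = enn2real (min 1 (weight n y / weight n x))"

text \<open>The law of \<open>X\<^sub>n\<^sup>(\<^sup>i\<^sup>)\<close> given the history \<open>h\<close> up to level \<open>n - 1\<close> of iteration \<open>i\<close>.\<close>

definition transition :: "nat \<Rightarrow> nat \<Rightarrow> (nat \<times> nat \<Rightarrow> nat \<Rightarrow> 'a) \<Rightarrow> (nat \<Rightarrow> 'a) measure"
  where "transition i n h =
    proposal i n h \<bind> (\<lambda>y.
      distr (measure_pmf (bernoulli_pmf (accept_prob n (h (i - 1, n)) y))) (paths E n)
        (\<lambda>accept. if accept then y else h (i - 1, n)))"

text \<open>
  \<open>run x0 i n\<close> is the law of the history after level \<open>n\<close> of iteration \<open>i\<close>, with
  \<open>X\<^sub>k\<^sup>(\<^sup>0\<^sup>) = x0 k\<close> for \<open>k = 1, \<dots>, P\<close>. Iteration \<open>0\<close> is the initialization, hence does not depend on \<open>n\<close>.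
\<close>

fun run :: "(nat \<Rightarrow> nat \<Rightarrow> 'a) \<Rightarrow> nat \<Rightarrow> nat \<Rightarrow> (nat \<times> nat \<Rightarrow> nat \<Rightarrow> 'a) measure"
  where
    "run x0 0 n = return (histories 0 P) (\<lambda>(m, k)\<in>processed 0 P. x0 k)"
  | "run x0 (Suc i) 0 = run x0 i P"
  | "run x0 (Suc i) (Suc n) =
      run x0 (Suc i) n \<bind> (\<lambda>h.
        distr (transition (Suc i) (Suc n) h) (histories (Suc i) (Suc n)) (\<lambda>x. h((Suc i, Suc n) := x)))"

definition unit_bounded :: "nat \<Rightarrow> ((nat \<Rightarrow> 'a) \<Rightarrow> real) set"
  where "unit_bounded n = {f \<in> borel_measurable (paths E n). \<forall>x\<in>space (paths E n). \<bar>f x\<bar> \<le> 1}"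

text \<open>
  The binds above are meaningful only for measurable kernels, and the Bochner integral only for
  integrable functions. The rest of this theory shows that this holds in the model: \<open>run_prob\<close> says that
  \<open>run x0 i P\<close> is a probability measure on the histories, and \<open>integrable_error\<close> that the \<open>p\<close>-th
  power of the error of the empirical measure is integrable.
\<close>

lemma space_historiesD:
  assumes "h \<in> space (histories i n)" "(m, k) \<in> processed i n"
  shows "h (m, k) \<in> space (paths E k)"
  using assms by (auto simp: histories_def space_PiM PiE_def Pi_def)

lemma measurable_history_component:
  assumes "(m, k) \<in> processed i n"
  shows "(\<lambda>h. h (m, k)) \<in> histories i n \<rightarrow>\<^sub>M paths E k"
  using measurable_component_singleton[OF assms, of "\<lambda>(m, k). paths E k"]
  by (simp add: histories_def)

lemma emeasure_empirical:
  assumes "\<And>m. m \<le> i \<Longrightarrow> h (m, n) \<in> space (paths E n)" and A: "A \<in> sets (paths E n)"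
  shows "emeasure (empirical n i h) A =
    (\<Sum>m\<le>i. emeasure (return (paths E n) (h (m, n))) A) / of_nat (i + 1)"
proof -
  have meas: "(\<lambda>m. h (m, n)) \<in> uniform_count_measure {..i} \<rightarrow>\<^sub>M paths E n"
    using assms(1) by (auto simp: measurable_def sets_uniform_count_measure space_uniform_count_measure)
  have "emeasure (empirical n i h) A = emeasure (uniform_count_measure {..i}) {m\<in>{..i}. h (m, n) \<in> A}"
    unfolding empirical_def
    by (subst emeasure_distr[OF meas A])
       (auto simp: space_uniform_count_measure intro!: arg_cong2[where f=emeasure])
  also have "\<dots> = (\<Sum>m | m \<in> {..i} \<and> h (m, n) \<in> A. 1 / of_nat (i + 1))"
    unfolding uniform_count_measure_def
    by (subst emeasure_point_measure_finite)
       (auto simp: ennreal_of_nat_eq_real_of_nat simp flip: divide_ennreal)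
  also have "\<dots> = (\<Sum>m\<le>i. indicator A (h (m, n)) / of_nat (i + 1))"
    by (intro sum.mono_neutral_cong_left) (auto simp: indicator_def)
  also have "\<dots> = (\<Sum>m\<le>i. emeasure (return (paths E n) (h (m, n))) A / of_nat (i + 1))"
    using A by simp
  finally show ?thesis
    by (simp add: divide_ennreal_def sum_distrib_right)
qed

lemma measurable_empirical:
  assumes "\<And>m. m \<le> i \<Longrightarrow> (m, n) \<in> processed j l"
  shows "empirical n i \<in> histories j l \<rightarrow>\<^sub>M prob_algebra (paths E n)"
proof (rule measurable_prob_algebraI)
  fix h assume h: "h \<in> space (histories j l)"
  have "(\<lambda>m. h (m, n)) \<in> uniform_count_measure {..i} \<rightarrow>\<^sub>M paths E n"
    using space_historiesD[OF h assms]
    by (auto simp: measurable_def sets_uniform_count_measure space_uniform_count_measure)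
  then show p: "prob_space (empirical n i h)"
    unfolding empirical_def
    by (intro prob_space.prob_space_distr prob_space_uniform_count_measure) auto
next
  show "empirical n i \<in> histories j l \<rightarrow>\<^sub>M subprob_algebra (paths E n)"
  proof (rule measurable_subprob_algebra)
    fix h assume h: "h \<in> space (histories j l)"
    have "(\<lambda>m. h (m, n)) \<in> uniform_count_measure {..i} \<rightarrow>\<^sub>M paths E n"
      using space_historiesD[OF h assms]
      by (auto simp: measurable_def sets_uniform_count_measure space_uniform_count_measure)
    then show "subprob_space (empirical n i h)"
      unfolding empirical_def
      by (intro prob_space_imp_subprob_space prob_space.prob_space_distr
          prob_space_uniform_count_measure) auto
    show "sets (empirical n i h) = sets (paths E n)"
      by (simp add: empirical_def)
  next
    fix A assume A: "A \<in> sets (paths E n)"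
    have "(\<lambda>h. (\<Sum>m\<le>i. indicator A (h (m, n))) / of_nat (i + 1) :: ennreal) \<in> borel_measurable (histories j l)"
    proof (intro borel_measurable_divide_ennreal borel_measurable_sum measurable_const)
      fix m assume "m \<in> {..i}"
      then have "(\<lambda>h. h (m, n)) \<in> histories j l \<rightarrow>\<^sub>M paths E n"
        by (intro measurable_history_component assms) simp
      from measurable_compose[OF this borel_measurable_indicator[OF A]]
      show "(\<lambda>h. indicator A (h (m, n)) :: ennreal) \<in> borel_measurable (histories j l)" .
    qed simp
    also have "?this \<longleftrightarrow> (\<lambda>h. emeasure (empirical n i h) A) \<in> borel_measurable (histories j l)"
    proof (rule measurable_cong)
      fix h assume h: "h \<in> space (histories j l)"
      show "(\<Sum>m\<le>i. indicator A (h (m, n))) / of_nat (i + 1) = emeasure (empirical n i h) A"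
        using space_historiesD[OF h assms] A
        by (subst emeasure_empirical) auto
    qed
    finally show "(\<lambda>h. emeasure (empirical n i h) A) \<in> borel_measurable (histories j l)" .
  qed
qed

lemma measurable_append:
  assumes "1 \<le> n"
  shows "(\<lambda>(x, y). x(n := y)) \<in> paths E (n - 1) \<Otimes>\<^sub>M E \<rightarrow>\<^sub>M paths E n"
proof -
  have "insert n {1..n - 1} = {1..n}"
    using assms by auto
  with measurable_add_dim[of n "{1..n - 1}" "\<lambda>_. E"] show ?thesis
    unfolding paths_def by metis
qed

lemma extend_kernel:
  assumes n: "n \<in> {2..P}"
  defines "K \<equiv> \<lambda>x. distr (density (ref n) (\<lambda>y. ennreal (q n x y))) (paths E n) (\<lambda>y. x(n := y))"
  shows "K \<in> paths E (n - 1) \<rightarrow>\<^sub>M prob_algebra (paths E n)"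
    and "\<mu> \<in> space (prob_algebra (paths E (n - 1))) \<Longrightarrow> extend n \<mu> = \<mu> \<bind> K"
proof -
  have [simp, measurable_cong]: "sets (ref n) = sets E"
    using n sets_ref by simp
  then have sp [simp]: "space (ref n) = space E"
    by (rule sets_eq_imp_space_eq)
  interpret R: sigma_finite_measure "ref n"
    using n sigma_finite_ref by simp
  have [measurable]: "(\<lambda>(x, y). q n x y) \<in> borel_measurable (paths E (n - 1) \<Otimes>\<^sub>M E)"
    using q_measurable n by simp
  have app [measurable]: "(\<lambda>(x, y). x(n := y)) \<in> paths E (n - 1) \<Otimes>\<^sub>M E \<rightarrow>\<^sub>M paths E n"
    using n by (intro measurable_append) simp
  have app1 [measurable]: "(\<lambda>y. x(n := y)) \<in> E \<rightarrow>\<^sub>M paths E n" if "x \<in> space (paths E (n - 1))" for x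
    using measurable_compose[OF measurable_Pair1'[OF that] app] by simp
  have q1' [measurable]: "q n x \<in> borel_measurable E" if "x \<in> space (paths E (n - 1))" for x
    using that by measurable
  have K_em: "emeasure (K x) A = (\<integral>\<^sup>+y. ennreal (q n x y) * indicator A (x(n := y)) \<partial>ref n)"
    if x: "x \<in> space (paths E (n - 1))" and A [measurable]: "A \<in> sets (paths E n)" for x A
  proof -
    have "emeasure (K x) A = (\<integral>\<^sup>+z. indicator A z \<partial>K x)"
      by (simp add: K_def A)
    also have "\<dots> = (\<integral>\<^sup>+y. ennreal (q n x y) * indicator A (x(n := y)) \<partial>ref n)"
      unfolding K_def using x
      by (subst nn_integral_distr, simp, simp)
         (subst nn_integral_density, auto)
    finally show ?thesis .
  qed
  have pK: "prob_space (K x)" if x: "x \<in> space (paths E (n - 1))" for x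
  proof
    have "emeasure (K x) (space (K x)) = (\<integral>\<^sup>+y. ennreal (q n x y) * indicator (space (paths E n)) (x(n := y)) \<partial>ref n)"
      using K_em[OF x, of "space (paths E n)"] by (simp add: K_def)
    also have "\<dots> = (\<integral>\<^sup>+y. ennreal (q n x y) \<partial>ref n)"
      using measurable_space[OF app1[OF x]] by (intro nn_integral_cong) auto
    finally show "emeasure (K x) (space (K x)) = 1"
      using q_density[OF n x] by simp
  qed
  show K: "K \<in> paths E (n - 1) \<rightarrow>\<^sub>M prob_algebra (paths E n)"
  proof (intro measurable_prob_algebraI pK measurable_subprob_algebra prob_space_imp_subprob_space)
    fix A assume [measurable]: "A \<in> sets (paths E n)"
    have "(\<lambda>x. \<integral>\<^sup>+y. ennreal (q n x y) * indicator A (x(n := y)) \<partial>ref n) \<in> borel_measurable (paths E (n - 1))"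
      by measurable
    then show "(\<lambda>x. emeasure (K x) A) \<in> borel_measurable (paths E (n - 1))"
      by (subst measurable_cong[OF K_em]) auto
  qed (auto simp: K_def)
  assume "\<mu> \<in> space (prob_algebra (paths E (n - 1)))"
  then have [simp, measurable_cong]: "sets \<mu> = sets (paths E (n - 1))" and "prob_space \<mu>"
    by (auto simp: space_prob_algebra)
  interpret M: prob_space \<mu> by fact
  have spm [simp]: "space \<mu> = space (paths E (n - 1))"
    by (rule sets_eq_imp_space_eq) simp
  show "extend n \<mu> = \<mu> \<bind> K"
  proof (rule measure_eqI)
    show s: "sets (extend n \<mu>) = sets (\<mu> \<bind> K)"
      by (subst sets_bind[where N="paths E n"]) (auto simp: extend_def K_def M.not_empty simp flip: spm)
    fix A assume "A \<in> sets (extend n \<mu>)"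
    then have A [measurable]: "A \<in> sets (paths E n)"
      by (simp add: extend_def)
    have "emeasure (extend n \<mu>) A = (\<integral>\<^sup>+z. indicator A z \<partial>extend n \<mu>)"
      using A by (simp add: extend_def)
    also have "\<dots> = (\<integral>\<^sup>+(x, y). ennreal (q n x y) * indicator A (x(n := y)) \<partial>(\<mu> \<Otimes>\<^sub>M ref n))"
      unfolding extend_def
      by (subst nn_integral_distr, simp, simp)
         (subst nn_integral_density, auto simp: split_beta')
    also have "\<dots> = (\<integral>\<^sup>+x. \<integral>\<^sup>+y. ennreal (q n x y) * indicator A (x(n := y)) \<partial>ref n \<partial>\<mu>)"
      by (subst R.nn_integral_fst[symmetric]) simp_all
    also have "\<dots> = (\<integral>\<^sup>+x. emeasure (K x) A \<partial>\<mu>)"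
      by (intro nn_integral_cong) (simp add: K_em)
    also have "\<dots> = emeasure (\<mu> \<bind> K) A"
      using measurable_prob_algebraD[OF K] A M.not_empty
      by (subst emeasure_bind[where N="paths E n"])
         (auto simp: measurable_cong_sets[OF \<open>sets \<mu> = _\<close> refl])
    finally show "emeasure (extend n \<mu>) A = emeasure (\<mu> \<bind> K) A" .
  qed
qed

lemma measurable_proposal:
  assumes n: "n \<in> {1..P}" and pr: "\<And>m k. m \<le> i \<Longrightarrow> 1 \<le> k \<Longrightarrow> k < n \<Longrightarrow> (m, k) \<in> processed j l"
  shows "proposal i n \<in> histories j l \<rightarrow>\<^sub>M prob_algebra (paths E n)"
proof (cases "n = 1")
  case True
  have [simp, measurable_cong]: "sets (ref 1) = sets E"
    using P_ge_1 sets_ref by simp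
  have [measurable]: "q1 \<in> borel_measurable E"
    by (rule q1_measurable)
  have m: "(\<lambda>y. \<lambda>k\<in>{1}. y) \<in> E \<rightarrow>\<^sub>M paths E 1"
    unfolding paths_def atLeastAtMost_singleton by (intro measurable_restrict) auto
  have "prob_space (density (ref 1) (\<lambda>y. ennreal (q1 y)))"
  proof
    have "(\<integral>\<^sup>+y. ennreal (q1 y) * indicator (space (ref 1)) y \<partial>ref 1) = (\<integral>\<^sup>+y. ennreal (q1 y) \<partial>ref 1)"
      by (intro nn_integral_cong) simp
    moreover have "(\<lambda>y. ennreal (q1 y)) \<in> borel_measurable (ref 1)"
      by measurable
    ultimately show "emeasure (density (ref 1) (\<lambda>y. ennreal (q1 y))) (space (density (ref 1) (\<lambda>y. ennreal (q1 y)))) = 1"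
      using q1_density by (simp add: emeasure_density)
  qed
  then have "prob_space (distr (density (ref 1) (\<lambda>y. ennreal (q1 y))) (paths E 1) (\<lambda>y. \<lambda>k\<in>{1}. y))"
    using m by (intro prob_space.prob_space_distr) (simp_all cong: measurable_cong_sets del: One_nat_def)
  moreover have "proposal i n = (\<lambda>h. distr (density (ref 1) (\<lambda>y. ennreal (q1 y))) (paths E 1) (\<lambda>y. \<lambda>k\<in>{1}. y))"
    using True by (auto simp: proposal_def)
  ultimately show ?thesis
    using True by (auto simp: space_prob_algebra intro!: measurable_const)
next
  case False
  with n have n2: "n \<in> {2..P}" by auto
  have e: "empirical (n - 1) i \<in> histories j l \<rightarrow>\<^sub>M prob_algebra (paths E (n - 1))"
    using n2 by (intro measurable_empirical pr) auto
  show ?thesis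
    using measurable_bind_prob_space[OF e extend_kernel(1)[OF n2]]
    by (rule iffD1[OF measurable_cong, rotated])
       (use False in \<open>simp add: proposal_def extend_kernel(2)[OF n2 measurable_space[OF e]]
         del: One_nat_def\<close>)
qed

lemma measurable_weight:
  assumes n: "n \<in> {1..P}"
  shows "weight n \<in> borel_measurable (paths E n)"
proof -
  have g: "\<gamma> k \<in> borel_measurable (paths E k)" if "k \<in> {1..P}" for k
  proof -
    have "sets (Pi\<^sub>M {1..k} ref) = sets (paths E k)"
      unfolding paths_def using that sets_ref by (intro sets_PiM_cong) auto
    with gamma_integrable[OF that] show ?thesis
      using measurable_cong_sets by (metis borel_measurable_integrable)
  qed
  note g[OF n, measurable]
  show ?thesis
  proof (cases "n = 1")
    case True
    note q1_measurable[measurable]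
    have [measurable]: "(\<lambda>x. x 1) \<in> paths E 1 \<rightarrow>\<^sub>M E"
      unfolding paths_def by (rule measurable_component_singleton) simp
    note \<open>\<gamma> n \<in> _\<close>[unfolded True, measurable]
    have "(\<lambda>x. ennreal (\<gamma> 1 x) / ennreal (q1 (x 1))) \<in> borel_measurable (paths E 1)"
      by measurable
    with True show ?thesis
      by (simp add: weight_def[abs_def])
  next
    case False
    with n have n2: "n \<in> {2..P}" "n - 1 \<in> {1..P}" by auto
    note g[OF n2(2), measurable] q_measurable[OF n2(1), measurable]
    have [measurable]: "(\<lambda>x. x n) \<in> paths E n \<rightarrow>\<^sub>M E"
      unfolding paths_def using n by (intro measurable_component_singleton) simp
    have [measurable]: "(\<lambda>x. restrict x {1..n - 1}) \<in> paths E n \<rightarrow>\<^sub>M paths E (n - 1)"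
      unfolding paths_def by (intro measurable_restrict_subset) auto
    have "(\<lambda>x. ennreal (\<gamma> n x) /
       ennreal (\<gamma> (n - 1) (restrict x {1..n - 1}) * q n (restrict x {1..n - 1}) (x n)))
       \<in> borel_measurable (paths E n)"
      by measurable
    with False show ?thesis
      by (simp add: weight_def[abs_def])
  qed
qed

lemma accept_prob_bounds: "accept_prob n x y \<in> {0..1}"
  by (auto simp: accept_prob_def intro!: enn2real_leI)

lemma measurable_bernoulli:
  assumes a: "a \<in> borel_measurable M" and "\<And>x. x \<in> space M \<Longrightarrow> a x \<in> {0..1}"
  shows "(\<lambda>x. measure_pmf (bernoulli_pmf (a x))) \<in> M \<rightarrow>\<^sub>M prob_algebra (count_space UNIV)"
proof (intro measurable_prob_algebraI measurable_subprob_algebra prob_space_imp_subprob_space)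
  fix A :: "bool set"
  have "emeasure (measure_pmf (bernoulli_pmf (a x))) A =
     (\<Sum>b\<in>A. ennreal (if b then a x else 1 - a x))" if "x \<in> space M" for x
    using assms(2)[OF that] by (subst emeasure_measure_pmf_finite) (auto intro!: sum.cong arg_cong[where f=ennreal])
  moreover have "(\<lambda>x. (\<Sum>b\<in>A. ennreal (if b then a x else 1 - a x))) \<in> borel_measurable M"
    using a by measurable
  ultimately show "(\<lambda>x. emeasure (measure_pmf (bernoulli_pmf (a x))) A) \<in> borel_measurable M"
    by (subst measurable_cong) auto
qed (auto intro: prob_space_measure_pmf)

lemma measurable_transition:
  assumes n: "n \<in> {1..P}" and pr: "\<And>m k. m \<le> i \<Longrightarrow> 1 \<le> k \<Longrightarrow> k < n \<Longrightarrow> (m, k) \<in> processed j l"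
    and pr': "(i - 1, n) \<in> processed j l"
  shows "transition i n \<in> histories j l \<rightarrow>\<^sub>M prob_algebra (paths E n)"
proof -
  note [measurable] = measurable_history_component[OF pr'] measurable_weight[OF n]
    measurable_proposal[OF n, of i, OF pr]
  have [measurable]: "(\<lambda>x. measure_pmf (bernoulli_pmf (accept_prob n (fst x (i - 1, n)) (snd x))))
     \<in> histories j l \<Otimes>\<^sub>M paths E n \<rightarrow>\<^sub>M prob_algebra (count_space UNIV)"
    unfolding accept_prob_def
    by (rule measurable_bernoulli, measurable)
       (use accept_prob_bounds in \<open>auto simp: accept_prob_def\<close>)
  show ?thesis
    unfolding transition_def[abs_def] by measurable
qed

lemma prob_space_target:
  assumes n: "n \<in> {1..P}"
  shows "prob_space (target n)"
proof
  have sp: "space (Pi\<^sub>M {1..n} ref) = space (paths E n)"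
    unfolding paths_def using n sets_ref by (intro sets_eq_imp_space_eq sets_PiM_cong) auto
  have Z: "0 < Z n"
    using gamma_integral_pos[OF n] by (simp add: Z_def)
  have int: "integrable (Pi\<^sub>M {1..n} ref) (\<lambda>x. \<gamma> n x / Z n)"
    using gamma_integrable[OF n] by simp
  have "(\<integral>\<^sup>+x. ennreal (\<gamma> n x / Z n) \<partial>Pi\<^sub>M {1..n} ref) = ennreal (LINT x|Pi\<^sub>M {1..n} ref. \<gamma> n x / Z n)"
    using Z gamma_nonneg[OF n] by (intro nn_integral_eq_integral int AE_I2) (simp add: sp del: One_nat_def)
  also have "\<dots> = 1"
    using Z by (simp add: Z_def)
  finally have 1: "(\<integral>\<^sup>+x. ennreal (\<gamma> n x / Z n) \<partial>Pi\<^sub>M {1..n} ref) = 1" .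
  have "(\<integral>\<^sup>+x. ennreal (\<gamma> n x / Z n) * indicator (space (Pi\<^sub>M {1..n} ref)) x \<partial>Pi\<^sub>M {1..n} ref) =
      (\<integral>\<^sup>+x. ennreal (\<gamma> n x / Z n) \<partial>Pi\<^sub>M {1..n} ref)"
    by (intro nn_integral_cong) simp
  with 1 show "emeasure (target n) (space (target n)) = 1"
    unfolding target_def using borel_measurable_integrable[OF int]
    by (subst emeasure_density) (auto simp: space_density)
qed

lemma run_prob:
  assumes x0: "\<And>k. k \<in> {1..P} \<Longrightarrow> x0 k \<in> supp k"
  shows "run x0 i P \<in> space (prob_algebra (histories i P))"
proof (induction i)
  case 0
  have "(\<lambda>(m, k)\<in>processed 0 P. x0 k) \<in> space (histories 0 P)"
    using x0 by (auto simp: histories_def space_PiM processed_def supp_def)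
  then show ?case
    by (simp add: space_prob_algebra prob_space_return)
next
  case (Suc i)
  have "processed (Suc i) 0 = processed i P"
    by (auto simp: processed_def)
  then have 0: "histories (Suc i) 0 = histories i P"
    by (simp add: histories_def)
  have "run x0 (Suc i) n \<in> space (prob_algebra (histories (Suc i) n))" if "n \<le> P" for n
    using that
  proof (induction n)
    case 0
    with Suc.IH show ?case
      by (simp add: \<open>histories (Suc i) 0 = histories i P\<close>)
  next
    case (Suc n)
    have ins: "insert (Suc i, Suc n) (processed (Suc i) n) = processed (Suc i) (Suc n)"
      using Suc.prems by (auto simp: processed_def)
    have upd: "(\<lambda>(h, x). h((Suc i, Suc n) := x))
        \<in> histories (Suc i) n \<Otimes>\<^sub>M paths E (Suc n) \<rightarrow>\<^sub>M histories (Suc i) (Suc n)"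
      using measurable_add_dim[of "(Suc i, Suc n)" "processed (Suc i) n" "\<lambda>(m, k). paths E k"]
      by (simp add: histories_def ins)
    have tr: "transition (Suc i) (Suc n) \<in> histories (Suc i) n \<rightarrow>\<^sub>M prob_algebra (paths E (Suc n))"
      using Suc.prems by (intro measurable_transition) (auto simp: processed_def)
    have "(\<lambda>h. distr (transition (Suc i) (Suc n) h) (histories (Suc i) (Suc n))
        (\<lambda>x. h((Suc i, Suc n) := x))) \<in> histories (Suc i) n \<rightarrow>\<^sub>M prob_algebra (histories (Suc i) (Suc n))"
      by (rule measurable_distr_prob_space2[OF tr upd])
    from measurable_bind_prob_space[OF measurable_const[OF Suc.IH[OF Suc_leD[OF Suc.prems]]] this,
        THEN measurable_space, of undefined "count_space UNIV"]
    show ?case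
      by simp
  qed
  then show ?case
    by blast
qed

lemma integral_empirical:
  fixes f :: "(nat \<Rightarrow> 'a) \<Rightarrow> real"
  assumes "\<And>m. m \<le> i \<Longrightarrow> h (m, n) \<in> space (paths E n)" and f: "f \<in> borel_measurable (paths E n)"
  shows "(LINT x|empirical n i h. f x) = (\<Sum>m\<le>i. f (h (m, n))) / real (i + 1)"
proof -
  have meas: "(\<lambda>m. h (m, n)) \<in> uniform_count_measure {..i} \<rightarrow>\<^sub>M paths E n"
    using assms(1) by (auto simp: measurable_def sets_uniform_count_measure space_uniform_count_measure)
  have "(LINT x|empirical n i h. f x) = (LINT m|uniform_count_measure {..i}. f (h (m, n)))"
    unfolding empirical_def by (rule integral_distr[OF meas f])
  also have "\<dots> = (\<Sum>m\<le>i. f (h (m, n)) / real (i + 1))"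
    unfolding uniform_count_measure_def
    by (subst lebesgue_integral_point_measure_finite) (auto intro!: sum.cong)
  finally show ?thesis
    by (simp add: sum_divide_distrib)
qed

lemma integrable_error:
  assumes x0: "\<And>k. k \<in> {1..P} \<Longrightarrow> x0 k \<in> supp k" and n: "n \<in> {1..P}"
    and f: "f \<in> unit_bounded n" and p: "1 \<le> p"
  shows "integrable (run x0 i P)
    (\<lambda>h. \<bar>(LINT x|empirical n i h. f x) - (LINT x|target n. f x)\<bar> powr p)"
proof -
  have fm: "f \<in> borel_measurable (paths E n)" and fb: "\<And>x. x \<in> space (paths E n) \<Longrightarrow> \<bar>f x\<bar> \<le> 1"
    using f by (auto simp: unit_bounded_def)
  have s: "sets (run x0 i P) = sets (histories i P)" and "prob_space (run x0 i P)"
    using run_prob[OF x0] by (auto simp: space_prob_algebra)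
  then interpret R: prob_space "run x0 i P" by simp
  have pr: "(m, n) \<in> processed i P" if "m \<le> i" for m
    using that n by (auto simp: processed_def)
  define c where "c = (LINT x|target n. f x)"
  define avg where "avg h = (\<Sum>m\<le>i. f (h (m, n))) / real (i + 1)" for h :: "nat \<times> nat \<Rightarrow> nat \<Rightarrow> 'a"
  have avg: "(LINT x|empirical n i h. f x) = avg h \<and> \<bar>avg h\<bar> \<le> 1" if "h \<in> space (histories i P)" for h
  proof -
    have mem: "h (m, n) \<in> space (paths E n)" if "m \<le> i" for m
      using space_historiesD[OF \<open>h \<in> _\<close> pr[OF that]] .
    have "\<bar>\<Sum>m\<le>i. f (h (m, n))\<bar> \<le> (\<Sum>m\<le>i. 1)"
      by (intro order_trans[OF sum_abs] sum_mono fb mem) simp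
    then have "\<bar>avg h\<bar> \<le> 1"
      by (simp add: avg_def divide_le_eq)
    with integral_empirical[of i h n f, OF mem fm] show ?thesis
      by (simp add: avg_def)
  qed
  have meas: "avg \<in> borel_measurable (histories i P)"
    unfolding avg_def[abs_def]
    by (intro borel_measurable_divide borel_measurable_sum measurable_const
        measurable_compose[OF measurable_history_component fm] pr) simp_all
  have "integrable (run x0 i P) (\<lambda>h. \<bar>avg h - c\<bar> powr p)"
  proof (rule R.integrable_const_bound)
    show "AE h in run x0 i P. norm (\<bar>avg h - c\<bar> powr p) \<le> (1 + \<bar>c\<bar>) powr p"
    proof (rule AE_I2)
      fix h assume "h \<in> space (run x0 i P)"
      then have "h \<in> space (histories i P)"
        using sets_eq_imp_space_eq[OF s] by simp
      then have "\<bar>avg h - c\<bar> \<le> 1 + \<bar>c\<bar>"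
        using avg by fastforce
      then show "norm (\<bar>avg h - c\<bar> powr p) \<le> (1 + \<bar>c\<bar>) powr p"
        using p by (simp add: powr_mono2)
    qed
    note [measurable] = meas
    show "(\<lambda>h. \<bar>avg h - c\<bar> powr p) \<in> borel_measurable (run x0 i P)"
      unfolding measurable_cong_sets[OF s refl] by measurable
  qed
  moreover have "space (run x0 i P) = space (histories i P)"
    by (rule sets_eq_imp_space_eq[OF s])
  ultimately show ?thesis
    by (subst Bochner_Integration.integrable_cong[OF refl]) (auto simp: avg c_def)
qed

end

end

theory Submission
  imports Defs
begin

text \<open>
  Let \<open>\<mu>\<close> be the empirical measure at level \<open>n - 1\<close>. Level \<open>n\<close> then moves by an independent
  Metropolis-Hastings kernel \<open>K\<^sub>\<mu>\<close> with proposal \<open>\<mu> \<times> q\<^sub>n\<close>, whose invariant law \<open>\<omega>(\<mu>)\<close> has density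
  proportional to \<open>w\<^sub>n\<close> with respect to the proposal; in particular \<open>\<omega>(\<pi>\<^sub>n\<^sub>-\<^sub>1) = \<pi>\<^sub>n\<close>. Since \<open>w\<^sub>n \<le> B\<^sub>n\<close>, the kernel
  dominates \<open>w\<^sub>n / B\<^sub>n\<close> times the proposal, so it contracts at the rate \<open>(\<mu> \<times> q\<^sub>n)(w\<^sub>n) / B\<^sub>n\<close>. When this rate is
  bounded below by \<open>\<epsilon>\<close>, the Poisson equation of \<open>K\<^sub>\<mu>\<close> has a solution bounded by \<open>2 / \<epsilon>\<close> that is Lipschitz in
  \<open>\<mu>\<close> for the total variation distance, and \<open>\<mu>\<close> changes only by \<open>O(1 / i)\<close> in iteration \<open>i\<close>. The error at
  level \<open>n\<close> thus splits into a martingale with bounded increments, controlled by Hoeffding's lemma, a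
  remainder of order \<open>\<surd>i\<close>, and the errors \<open>\<omega>(\<mu>)(f) - \<pi>\<^sub>n(f)\<close>, controlled by level \<open>n - 1\<close>.

  The rate may vanish for a bad \<open>\<mu>\<close>. But it is itself an average over \<open>\<mu>\<close> of a bounded
  function, so the induction hypothesis also bounds the contribution of the iterations where it falls
  below half of its limit.

  The induction runs on exponential moments of \<open>\<surd>(i + 1)\<close> times the error, for every scale: the
  martingale bound is of this form, sums are handled by the convexity of \<open>exp\<close>, and all \<open>L\<^sup>p\<close> bounds follow
  from \<open>x\<^sup>p \<le> exp (p x)\<close>.
\<close>

section \<open>Bounds on exponentials and integrals\<close>

lemma abs_mult_le: "\<bar>u\<bar> \<le> c \<Longrightarrow> \<bar>v\<bar> \<le> d \<Longrightarrow> \<bar>u * v\<bar> \<le> c * (d::real)"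
  by (simp add: abs_mult mult_mono')

lemma (in prob_space) integrable_bounded:
  fixes g :: "'a \<Rightarrow> real"
  assumes "g \<in> borel_measurable M" "\<And>x. x \<in> space M \<Longrightarrow> \<bar>g x\<bar> \<le> b"
  shows "integrable M g"
  using assms by (intro integrable_const_bound[where B=b]) auto

lemma (in prob_space) abs_expectation_le:
  fixes g :: "'a \<Rightarrow> real"
  assumes g: "g \<in> borel_measurable M" and b: "\<And>x. x \<in> space M \<Longrightarrow> \<bar>g x\<bar> \<le> b"
  shows "\<bar>expectation g\<bar> \<le> b"
proof -
  have i: "integrable M g"
    using assms by (rule integrable_bounded)
  have "\<bar>expectation g\<bar> \<le> expectation (\<lambda>x. \<bar>g x\<bar>)"
    using integral_norm_bound[of M g] by simp
  also have "\<dots> \<le> expectation (\<lambda>_. b)"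
    using i b by (intro integral_mono) auto
  finally show ?thesis
    by (simp add: prob_space)
qed

text \<open>The integrand depends on \<open>x\<close> too. Pushing \<open>L x\<close> forward along
  \<open>y \<mapsto> (x, y)\<close> gives a measurable kernel into the product space, against which
  one fixed function is integrated.\<close>

lemma integral_measurable_subprob_algebra2:
  fixes f :: "'a \<Rightarrow> 'b \<Rightarrow> real"
  assumes f [measurable]: "(\<lambda>(x, y). f x y) \<in> borel_measurable (M \<Otimes>\<^sub>M N)"
    and L [measurable]: "L \<in> M \<rightarrow>\<^sub>M subprob_algebra N"
  shows "(\<lambda>x. LINT y|L x. f x y) \<in> borel_measurable M"
proof -
  note measurable_distr2[measurable]
  have "(\<lambda>x. integral\<^sup>L (distr (L x) (M \<Otimes>\<^sub>M N) (\<lambda>y. (x, y))) (\<lambda>(x, y). f x y)) \<in> borel_measurable M"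
    by measurable
  then show ?thesis
  proof (rule measurable_cong[THEN iffD1, rotated])
    fix x assume x: "x \<in> space M"
    with L have [measurable_cong]: "sets (L x) = sets N"
      by (rule sets_kernel)
    from x show "integral\<^sup>L (distr (L x) (M \<Otimes>\<^sub>M N) (\<lambda>y. (x, y))) (\<lambda>(x, y). f x y) = (LINT y|L x. f x y)"
      by (subst integral_distr) simp_all
  qed
qed

lemma sum_inverse_sqrt_le: "(\<Sum>m=1..i. 1 / sqrt (real m)) \<le> 2 * sqrt (real i)"
proof (induction i)
  case 0
  show ?case by simp
next
  case (Suc i)
  \<comment> \<open>Expanding the square gives the increment bound
    \<open>1 / sqrt (i + 1) \<le> 2 * (sqrt (i + 1) - sqrt i)\<close>.\<close>
  have "(sqrt (real (Suc i)) - sqrt (real i))\<^sup>2 \<ge> 0"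
    by simp
  then have "2 * sqrt (real i) * sqrt (real (Suc i)) + 1 \<le> 2 * sqrt (real (Suc i)) * sqrt (real (Suc i))"
    by (simp add: power2_diff algebra_simps del: of_nat_Suc) simp
  then have "2 * sqrt (real i) + 1 / sqrt (real (Suc i)) \<le> 2 * sqrt (real (Suc i))"
    by (simp add: field_simps del: of_nat_Suc)
  with Suc show ?case
    by simp
qed

lemma sum_inverse_sqrt_normalized:
  fixes i :: nat
  assumes "A = (\<Sum>m=1..i. 1 / sqrt (real m))" "0 < A"
  shows "(\<Sum>m=1..i. 1 / sqrt (real m) / A) = 1"
  unfolding sum_divide_distrib[symmetric] assms(1)[symmetric] using assms(2) by simp

text \<open>Jensen's inequality with weights proportional to \<open>1 / \<surd>m\<close>, whose sum is at most \<open>2 \<surd>i\<close>.\<close>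

lemma exp_sum_le:
  fixes D :: "nat \<Rightarrow> real"
  assumes i: "1 \<le> i" and D: "\<And>m. m \<in> {1..i} \<Longrightarrow> 0 \<le> D m" and l: "0 \<le> l"
  defines "A \<equiv> (\<Sum>m=1..i. 1 / sqrt (real m))"
  shows "exp (l / sqrt (real (i + 1)) * (\<Sum>m=1..i. D m))
    \<le> (\<Sum>m=1..i. 1 / sqrt (real m) / A * exp (2 * l * sqrt (real (m + 1)) * D m))"
proof -
  have A: "0 < A"
    unfolding A_def using i by (intro sum_pos) auto
  have A2: "A \<le> 2 * sqrt (real (i + 1))"
    unfolding A_def by (rule order_trans[OF sum_inverse_sqrt_le]) simp
  have "l / sqrt (real (i + 1)) * (\<Sum>m=1..i. D m) \<le> 2 * l / A * (\<Sum>m=1..i. D m)"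
  proof (rule mult_right_mono)
    have "l * A \<le> l * (2 * sqrt (real (i + 1)))"
      using A2 l by (rule mult_left_mono)
    then show "l / sqrt (real (i + 1)) \<le> 2 * l / A"
      using A by (simp add: field_simps)
  qed (use D in \<open>auto intro: sum_nonneg\<close>)
  also have "\<dots> = (\<Sum>m=1..i. 2 * l / A * D m)"
    by (simp add: sum_distrib_left)
  also have "\<dots> \<le> (\<Sum>m=1..i. (1 / sqrt (real m) / A) *\<^sub>R (2 * l * sqrt (real (m + 1)) * D m))"
  proof (rule sum_mono)
    fix m assume m: "m \<in> {1..i}"
    \<comment> \<open>Inserting this factor turns \<open>2 * l / A\<close> into the Jensen weight
      \<open>1 / (sqrt m * A)\<close> times \<open>2 * l * sqrt (m + 1)\<close>, the scale at which
      errors of iteration \<open>m\<close> are measured.\<close>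
    have "1 \<le> sqrt (real (m + 1)) / sqrt (real m)"
      using m by (simp add: divide_simps)
    then have "1 * (2 * l / A * D m) \<le> sqrt (real (m + 1)) / sqrt (real m) * (2 * l / A * D m)"
      using D[OF m] l A by (intro mult_right_mono) auto
    then show "2 * l / A * D m \<le> (1 / sqrt (real m) / A) *\<^sub>R (2 * l * sqrt (real (m + 1)) * D m)"
      by (simp add: field_simps)
  qed
  finally have "exp (l / sqrt (real (i + 1)) * (\<Sum>m=1..i. D m))
      \<le> exp (\<Sum>m=1..i. (1 / sqrt (real m) / A) *\<^sub>R (2 * l * sqrt (real (m + 1)) * D m))"
    by simp
  also have "\<dots> \<le> (\<Sum>m=1..i. 1 / sqrt (real m) / A * exp (2 * l * sqrt (real (m + 1)) * D m))"
  proof (rule convex_on_sum[OF _ _ exp_convex])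
    show "(\<Sum>m=1..i. 1 / sqrt (real m) / A) = 1"
      using A_def A by (rule sum_inverse_sqrt_normalized[OF meta_eq_to_obj_eq])
  qed (use i A in auto)
  finally show ?thesis .
qed

text \<open>Accumulates errors of order \<open>1 / sqrt (m + 1)\<close> into an average of order
  \<open>1 / sqrt (i + 1)\<close>. The price is a doubled scale \<open>l\<close>; the constant
  \<open>C\<close> survives unchanged because the Jensen weights sum to 1.\<close>

lemma nn_integral_exp_sum_le:
  fixes D :: "nat \<Rightarrow> 'a \<Rightarrow> real"
  assumes i: "1 \<le> i" and l: "0 \<le> l"
    and D: "\<And>m x. m \<in> {1..i} \<Longrightarrow> x \<in> space M \<Longrightarrow> 0 \<le> D m x"
    and meas: "\<And>m. m \<in> {1..i} \<Longrightarrow> D m \<in> borel_measurable M"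
    and C: "\<And>m. m \<in> {1..i} \<Longrightarrow> (\<integral>\<^sup>+x. ennreal (exp (2 * l * sqrt (real (m + 1)) * D m x)) \<partial>M) \<le> C"
  shows "(\<integral>\<^sup>+x. ennreal (exp (l / sqrt (real (i + 1)) * (\<Sum>m=1..i. D m x))) \<partial>M) \<le> C"
proof -
  define A where "A = (\<Sum>m=1..i. 1 / sqrt (real m))"
  have A: "0 < A"
    unfolding A_def using i by (intro sum_pos) auto
  note [measurable] = meas
  have "(\<integral>\<^sup>+x. ennreal (exp (l / sqrt (real (i + 1)) * (\<Sum>m=1..i. D m x))) \<partial>M)
     \<le> (\<integral>\<^sup>+x. ennreal (\<Sum>m=1..i. 1 / sqrt (real m) / A * exp (2 * l * sqrt (real (m + 1)) * D m x)) \<partial>M)"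
    unfolding A_def using i l D by (intro nn_integral_mono ennreal_leI exp_sum_le) auto
  also have "\<dots> = (\<integral>\<^sup>+x. (\<Sum>m=1..i. ennreal (1 / sqrt (real m) / A) * ennreal (exp (2 * l * sqrt (real (m + 1)) * D m x))) \<partial>M)"
    using A by (intro nn_integral_cong) (simp add: sum_ennreal flip: ennreal_mult)
  also have "\<dots> = (\<Sum>m=1..i. ennreal (1 / sqrt (real m) / A) * (\<integral>\<^sup>+x. ennreal (exp (2 * l * sqrt (real (m + 1)) * D m x)) \<partial>M))"
    by (subst nn_integral_sum, measurable) (intro sum.cong refl nn_integral_cmult, measurable)
  also have "\<dots> \<le> (\<Sum>m=1..i. ennreal (1 / sqrt (real m) / A) * C)"
    using C by (intro sum_mono mult_left_mono) auto
  also have "\<dots> = ennreal (\<Sum>m=1..i. 1 / sqrt (real m) / A) * C"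
    unfolding sum_distrib_right[symmetric] using A by (subst sum_ennreal) auto
  also have "(\<Sum>m=1..i. 1 / sqrt (real m) / A) = 1"
    using A_def A by (rule sum_inverse_sqrt_normalized)
  finally show ?thesis by simp
qed

text \<open>Abel summation. Later \<open>U m\<close> is the corrector of iteration \<open>m\<close>
  and \<open>X\<close> the trajectory, so only two boundary values and the changes of the corrector
  between iterations remain.\<close>

lemma sum_telescope:
  fixes U :: "nat \<Rightarrow> 'c \<Rightarrow> real"
  shows "(\<Sum>m=1..Suc i. U m (X (m - 1)) - U m (X m)) =
    U 1 (X 0) - U (Suc i) (X (Suc i)) + (\<Sum>m=1..i. U (Suc m) (X m) - U m (X m))"
  by (induction i) simp_all

text \<open>Separates two dependent summands at the price of doubled exponents, by
  \<open>2 * a * b \<le> a^2 + b^2\<close>.\<close>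

lemma exp_add_le: "exp (u + v) \<le> exp (2 * u) + exp (2 * v :: real)"
proof -
  have "2 * exp u * exp v \<le> exp u ^ 2 + exp v ^ 2"
    by (rule sum_squares_bound)
  moreover have "0 \<le> exp u * exp v"
    by simp
  ultimately have "exp u * exp v \<le> exp u ^ 2 + exp v ^ 2"
    by linarith
  then show ?thesis
    by (simp add: exp_add exp_double)
qed

lemma exp_abs_le: "exp \<bar>u\<bar> \<le> exp u + exp (- u :: real)"
  by (cases "0 \<le> u") auto

lemma powr_le_exp:
  fixes x p :: real
  assumes "0 \<le> x" "0 \<le> p"
  shows "x powr p \<le> exp (p * x)"
proof -
  have "x powr p \<le> exp x powr p"
    using assms exp_ge_add_one_self[of x] by (intro powr_mono2) linarith+
  then show ?thesis
    by (simp add: exp_powr_real mult.commute)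
qed

lemma integral_bind_prob:
  fixes f :: "'b \<Rightarrow> real"
  assumes \<mu>: "\<mu> \<in> space (prob_algebra M)" and K: "K \<in> M \<rightarrow>\<^sub>M prob_algebra N"
    and f: "f \<in> borel_measurable N" and b: "\<And>x. x \<in> space N \<Longrightarrow> \<bar>f x\<bar> \<le> b"
  shows "(LINT x|(\<mu> \<bind> K). f x) = (LINT x|\<mu>. LINT y|K x. f y)"
proof -
  have s: "sets \<mu> = sets M" and "prob_space \<mu>"
    using \<mu> by (auto simp: space_prob_algebra)
  then interpret prob_space \<mu> by simp
  have "K \<in> \<mu> \<rightarrow>\<^sub>M subprob_algebra N"
    using measurable_prob_algebraD[OF K] s by (simp cong: measurable_cong_sets)
  moreover have "AE x in \<mu>. emeasure (K x) (space (K x)) \<le> ennreal 1"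
    using measurable_space[OF K] sets_eq_imp_space_eq[OF s]
    by (intro AE_I2) (auto simp: space_prob_algebra prob_space.emeasure_space_1)
  ultimately show ?thesis
    using f b by (intro integral_bind[where K=N and B=b and B'=1]) (auto intro: finite_measure_axioms)
qed

text \<open>Hoeffding's lemma on the interval from \<open>- b\<close> to \<open>b\<close>: the
  squared length over 8 is \<open>b^2 / 2\<close>.\<close>

lemma nn_integral_exp_centered_le:
  fixes g :: "'a \<Rightarrow> real"
  assumes M: "prob_space M" and g: "g \<in> borel_measurable M" and b: "\<And>x. x \<in> space M \<Longrightarrow> \<bar>g x\<bar> \<le> b"
    and 0: "(LINT x|M. g x) = 0" and l: "0 < l"
  shows "(\<integral>\<^sup>+x. ennreal (exp (l * g x)) \<partial>M) \<le> ennreal (exp (l\<^sup>2 * b\<^sup>2 / 2))"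
proof -
  have "AE x in M. g x \<in> {- b..b}"
  proof (rule AE_I2)
    fix x assume "x \<in> space M"
    from b[OF this] show "g x \<in> {- b..b}"
      by auto
  qed
  with M g interpret interval_bounded_random_variable M g "- b" b
    by (simp add: interval_bounded_random_variable_def interval_bounded_random_variable_axioms_def)
  have "l\<^sup>2 * (b - - b)\<^sup>2 / 8 = l\<^sup>2 * b\<^sup>2 / 2"
    by (simp add: power2_eq_square)
  with Hoeffdings_lemma_nn_integral_0[OF l 0] show ?thesis
    by metis
qed

section \<open>Independent Metropolis-Hastings kernels\<close>

text \<open>\<open>W\<close> stands for the importance weight scaled into the unit interval,
  \<open>a x y\<close> for the probability of accepting a move from \<open>x\<close> to
  \<open>y\<close>. The proposal is an argument of the definitions and not a parameter of the
  locale, since the algorithm changes it in every iteration while weight and acceptance rule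
  stay.\<close>

locale indep_mh =
  fixes M :: "'b measure" and W :: "'b \<Rightarrow> real" and a :: "'b \<Rightarrow> 'b \<Rightarrow> real"
  assumes W_measurable [measurable]: "W \<in> borel_measurable M"
    and W_nonneg: "x \<in> space M \<Longrightarrow> 0 \<le> W x"
    and a_measurable [measurable]: "(\<lambda>(x, y). a x y) \<in> borel_measurable (M \<Otimes>\<^sub>M M)"
    and W_le_a: "x \<in> space M \<Longrightarrow> y \<in> space M \<Longrightarrow> W y \<le> a x y"
    and a_le_1: "x \<in> space M \<Longrightarrow> y \<in> space M \<Longrightarrow> a x y \<le> 1"
    and balance: "x \<in> space M \<Longrightarrow> y \<in> space M \<Longrightarrow> W x * a x y = W y * a y x"
begin

text \<open>The minorization constant: from every point, the kernel with proposal
  \<open>\<rho>\<close> dominates the measure \<open>W \<cdot> \<rho>\<close>, and this is its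
  mass.\<close>

definition rate :: "'b measure \<Rightarrow> real"
  where "rate \<rho> = (LINT y|\<rho>. W y)"

definition invar :: "'b measure \<Rightarrow> ('b \<Rightarrow> real) \<Rightarrow> real"
  where "invar \<rho> f = (LINT y|\<rho>. W y * f y) / rate \<rho>"

definition kern :: "'b measure \<Rightarrow> ('b \<Rightarrow> real) \<Rightarrow> 'b \<Rightarrow> real"
  where "kern \<rho> g x = (LINT y|\<rho>. a x y * g y + (1 - a x y) * g x)"

text \<open>
  The kernel \<open>kern \<rho>\<close> minus its minorizing part \<open>W \<cdot> \<rho>\<close>. The iterates \<open>pois\<close> are defined with \<open>resid\<close>, which is a
  contraction for the supremum norm; they are the partial sums of the Neumann series for the Poisson
  equation of \<open>kern\<close> because
  \<open>W \<cdot> \<rho>\<close> annihilates them (\<open>W_pois\<close>). Working with a finite number of iterates avoids the limit.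
\<close>

definition resid :: "'b measure \<Rightarrow> ('b \<Rightarrow> real) \<Rightarrow> 'b \<Rightarrow> real"
  where "resid \<rho> g x = (LINT y|\<rho>. (a x y - W y) * g y + (1 - a x y) * g x)"

primrec pois :: "'b measure \<Rightarrow> ('b \<Rightarrow> real) \<Rightarrow> nat \<Rightarrow> 'b \<Rightarrow> real"
  where
    "pois \<rho> f 0 = (\<lambda>_. 0)"
  | "pois \<rho> f (Suc N) = (\<lambda>x. f x - invar \<rho> f + resid \<rho> (pois \<rho> f N) x)"

lemma W_le_1: "x \<in> space M \<Longrightarrow> W x \<le> 1"
  using W_le_a[of x x] a_le_1[of x x] by simp

section \<open>Joint measurability in the state and in a parameter (later the history) that
  determines the proposal\<close>

lemma measurable_kern:
  assumes R: "R \<in> T \<rightarrow>\<^sub>M prob_algebra M"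
    and g [measurable]: "(\<lambda>(t, x). g t x) \<in> borel_measurable (T \<Otimes>\<^sub>M M)"
  shows "(\<lambda>(t, x). kern (R t) (g t) x) \<in> borel_measurable (T \<Otimes>\<^sub>M M)"
proof -
  have [measurable]: "R \<in> T \<rightarrow>\<^sub>M subprob_algebra M"
    using R by (rule measurable_prob_algebraD)
  show ?thesis
    unfolding kern_def split_beta'
    by (rule integral_measurable_subprob_algebra2[where N=M]) measurable
qed

lemma measurable_resid:
  assumes R: "R \<in> T \<rightarrow>\<^sub>M prob_algebra M"
    and g [measurable]: "(\<lambda>(t, x). g t x) \<in> borel_measurable (T \<Otimes>\<^sub>M M)"
  shows "(\<lambda>(t, x). resid (R t) (g t) x) \<in> borel_measurable (T \<Otimes>\<^sub>M M)"
proof -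
  have [measurable]: "R \<in> T \<rightarrow>\<^sub>M subprob_algebra M"
    using R by (rule measurable_prob_algebraD)
  show ?thesis
    unfolding resid_def split_beta'
    by (rule integral_measurable_subprob_algebra2[where N=M]) measurable
qed

lemma measurable_rate:
  assumes R: "R \<in> T \<rightarrow>\<^sub>M prob_algebra M"
  shows "(\<lambda>t. rate (R t)) \<in> borel_measurable T"
proof -
  have [measurable]: "R \<in> T \<rightarrow>\<^sub>M subprob_algebra M"
    using R by (rule measurable_prob_algebraD)
  show ?thesis
    unfolding rate_def by measurable
qed

lemma measurable_invar:
  assumes R: "R \<in> T \<rightarrow>\<^sub>M prob_algebra M" and f [measurable]: "f \<in> borel_measurable M"
  shows "(\<lambda>t. invar (R t) f) \<in> borel_measurable T"
proof -
  have [measurable]: "R \<in> T \<rightarrow>\<^sub>M subprob_algebra M"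
    using R by (rule measurable_prob_algebraD)
  note measurable_rate[OF R, measurable]
  show ?thesis
    unfolding invar_def by measurable
qed

lemma measurable_pois:
  assumes R: "R \<in> T \<rightarrow>\<^sub>M prob_algebra M" and f [measurable]: "f \<in> borel_measurable M"
  shows "(\<lambda>(t, x). pois (R t) f N x) \<in> borel_measurable (T \<Otimes>\<^sub>M M)"
proof (induction N)
  case 0
  show ?case by simp
next
  case (Suc N)
  note measurable_resid[OF R Suc, measurable] measurable_invar[OF R f, measurable]
  show ?case
    by simp measurable
qed

lemma pois_measurable:
  assumes \<rho>: "\<rho> \<in> space (prob_algebra M)" and f: "f \<in> borel_measurable M"
  shows "pois \<rho> f N \<in> borel_measurable M"
proof -
  \<comment> \<open>A one-point parameter space reduces joint measurability to the case of a fixed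
    proposal.\<close>
  have "(\<lambda>(t, x). pois \<rho> f N x) \<in> borel_measurable (count_space (UNIV :: unit set) \<Otimes>\<^sub>M M)"
    using \<rho> by (intro measurable_pois measurable_const f)
  moreover have "Pair () \<in> M \<rightarrow>\<^sub>M count_space UNIV \<Otimes>\<^sub>M M"
    by (rule measurable_Pair1') simp
  ultimately have "(\<lambda>x. case ((), x) of (t, x) \<Rightarrow> pois \<rho> f N x) \<in> borel_measurable M"
    by (rule measurable_compose[rotated])
  then show ?thesis
    by simp
qed

section \<open>The kernel of a fixed proposal\<close>

context
  fixes \<rho> :: "'b measure"
  assumes \<rho>: "\<rho> \<in> space (prob_algebra M)"
begin

lemma sets_rho [simp, measurable_cong]: "sets \<rho> = sets M"
  using \<rho> by (simp add: space_prob_algebra)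

lemma space_rho [simp]: "space \<rho> = space M"
  by (rule sets_eq_imp_space_eq) simp

interpretation rho: prob_space \<rho>
  using \<rho> by (simp add: space_prob_algebra)

lemma prob_M [simp]: "measure \<rho> (space M) = 1"
  using rho.prob_space by simp

lemma integrable_rho:
  fixes g :: "'b \<Rightarrow> real"
  assumes "g \<in> borel_measurable M" "\<And>x. x \<in> space M \<Longrightarrow> \<bar>g x\<bar> \<le> b"
  shows "integrable \<rho> g"
  using assms by (intro rho.integrable_bounded[where b=b]) auto

text \<open>The coefficients \<open>a x y - W y\<close> and \<open>1 - a x y\<close> are nonnegative
  and add up to \<open>1 - W y\<close>.\<close>

lemma resid_integrand_bound:
  assumes "x \<in> space M" "y \<in> space M" "\<bar>g y\<bar> \<le> b" "\<bar>g x\<bar> \<le> b"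
  shows "\<bar>(a x y - W y) * g y + (1 - a x y) * g x\<bar> \<le> (1 - W y) * b"
proof -
  have "\<bar>(a x y - W y) * g y\<bar> \<le> (a x y - W y) * b" "\<bar>(1 - a x y) * g x\<bar> \<le> (1 - a x y) * b"
    using assms W_le_a a_le_1 by (intro abs_mult_le; simp)+
  then have "\<bar>(a x y - W y) * g y + (1 - a x y) * g x\<bar> \<le> (a x y - W y) * b + (1 - a x y) * b"
    by linarith
  also have "\<dots> = (1 - W y) * b"
    by algebra
  finally show ?thesis .
qed

lemma rate_bounds: "0 \<le> rate \<rho>" "rate \<rho> \<le> 1"
proof -
  show "0 \<le> rate \<rho>"
    unfolding rate_def using W_nonneg by (intro integral_nonneg_AE AE_I2) simp
  show "rate \<rho> \<le> 1"
    unfolding rate_def using rho.abs_expectation_le[of W 1] W_nonneg W_le_1 by simp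
qed

lemma resid_integrable:
  assumes [measurable]: "g \<in> borel_measurable M" and b: "\<And>x. x \<in> space M \<Longrightarrow> \<bar>g x\<bar> \<le> b"
    and [measurable]: "x \<in> space M"
  shows "integrable \<rho> (\<lambda>y. (a x y - W y) * g y + (1 - a x y) * g x)"
proof (rule integrable_rho)
  fix y assume y: "y \<in> space M"
  have "0 \<le> b"
    using b[OF y] by simp
  then have "(1 - W y) * b \<le> 1 * b"
    using W_nonneg[OF y] by (intro mult_right_mono) auto
  then show "\<bar>(a x y - W y) * g y + (1 - a x y) * g x\<bar> \<le> b"
    using resid_integrand_bound[OF \<open>x \<in> _\<close> y b b, OF y \<open>x \<in> _\<close>] by simp
qed measurable

text \<open>Removing the minorizing part leaves mass \<open>1 - rate \<rho>\<close>; this is the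
  contraction in the supremum norm.\<close>

lemma abs_resid_le:
  assumes g: "g \<in> borel_measurable M" and b: "\<And>x. x \<in> space M \<Longrightarrow> \<bar>g x\<bar> \<le> b"
    and x: "x \<in> space M"
  shows "\<bar>resid \<rho> g x\<bar> \<le> (1 - rate \<rho>) * b"
proof -
  have W: "integrable \<rho> W"
    using W_nonneg W_le_1 by (intro integrable_rho[where b=1]) auto
  have i: "integrable \<rho> (\<lambda>y. (a x y - W y) * g y + (1 - a x y) * g x)"
    using g b x by (rule resid_integrable)
  have "\<bar>resid \<rho> g x\<bar> \<le> (LINT y|\<rho>. \<bar>(a x y - W y) * g y + (1 - a x y) * g x\<bar>)"
    unfolding resid_def
    using integral_norm_bound[of \<rho> "\<lambda>y. (a x y - W y) * g y + (1 - a x y) * g x"] by simp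
  also have "\<dots> \<le> (LINT y|\<rho>. (1 - W y) * b)"
    using i W resid_integrand_bound[OF x _ b b] x by (intro integral_mono) auto
  also have "\<dots> = (1 - rate \<rho>) * b"
    using W by (simp add: rate_def)
  finally show ?thesis .
qed

lemma resid_diff:
  assumes g: "g \<in> borel_measurable M" "\<And>x. x \<in> space M \<Longrightarrow> \<bar>g x\<bar> \<le> b"
    and h: "h \<in> borel_measurable M" "\<And>x. x \<in> space M \<Longrightarrow> \<bar>h x\<bar> \<le> c"
    and x: "x \<in> space M"
  shows "resid \<rho> (\<lambda>x. g x - h x) x = resid \<rho> g x - resid \<rho> h x"
  unfolding resid_def
  by (subst Bochner_Integration.integral_diff[symmetric])
     (use resid_integrable[OF g x] resid_integrable[OF h x] in \<open>auto simp: algebra_simps\<close>)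

text \<open>The two integrands differ exactly by \<open>W y * g y\<close>, whose integral vanishes
  by assumption.\<close>

lemma resid_eq_kern:
  assumes [measurable]: "g \<in> borel_measurable M" and b: "\<And>x. x \<in> space M \<Longrightarrow> \<bar>g x\<bar> \<le> b"
    and x: "x \<in> space M" and 0: "(LINT y|\<rho>. W y * g y) = 0"
  shows "resid \<rho> g x = kern \<rho> g x"
proof -
  have Wg: "integrable \<rho> (\<lambda>y. W y * g y)"
    using b W_nonneg W_le_1 by (intro integrable_rho[where b="1 * b"] abs_mult_le) auto
  have "kern \<rho> g x = (LINT y|\<rho>. ((a x y - W y) * g y + (1 - a x y) * g x) + W y * g y)"
    unfolding kern_def by (simp add: algebra_simps)
  also have "\<dots> = resid \<rho> g x + 0"
    unfolding resid_def 0[symmetric] using Wg resid_integrable[OF \<open>g \<in> _\<close> b x]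
    by (intro Bochner_Integration.integral_add)
  finally show ?thesis by simp
qed

lemma abs_kern_le:
  assumes [measurable]: "g \<in> borel_measurable M" and b: "\<And>x. x \<in> space M \<Longrightarrow> \<bar>g x\<bar> \<le> b"
    and x [measurable]: "x \<in> space M"
  shows "\<bar>kern \<rho> g x\<bar> \<le> b"
  unfolding kern_def
proof (rule rho.abs_expectation_le)
  show "(\<lambda>y. a x y * g y + (1 - a x y) * g x) \<in> borel_measurable \<rho>"
    by measurable
  fix y assume "y \<in> space \<rho>"
  then have y: "y \<in> space M" by simp
  have a: "0 \<le> a x y" "a x y \<le> 1"
    using W_nonneg[OF y] W_le_a[OF x y] a_le_1[OF x y] by auto
  then have "\<bar>a x y * g y\<bar> \<le> a x y * b" "\<bar>(1 - a x y) * g x\<bar> \<le> (1 - a x y) * b"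
    using b[OF x] b[OF y] by (intro abs_mult_le; simp)+
  then have "\<bar>a x y * g y + (1 - a x y) * g x\<bar> \<le> a x y * b + (1 - a x y) * b"
    by linarith
  also have "a x y * b + (1 - a x y) * b = b"
    by (simp add: algebra_simps)
  finally show "\<bar>a x y * g y + (1 - a x y) * g x\<bar> \<le> b" .
qed

text \<open>Detailed balance makes \<open>W x * a x y * (g y - g x)\<close> antisymmetric in
  \<open>x\<close> and \<open>y\<close>, so by Fubini its double integral equals its own negative.
  Its inner integral is \<open>W x * (kern \<rho> g x - g x)\<close>.\<close>

lemma kern_invariant:
  assumes [measurable]: "g \<in> borel_measurable M" and b: "\<And>x. x \<in> space M \<Longrightarrow> \<bar>g x\<bar> \<le> b"
  shows "(LINT x|\<rho>. W x * kern \<rho> g x) = (LINT x|\<rho>. W x * g x)"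
proof -
  define F where "F = (\<lambda>x y. W x * a x y * (g y - g x))"
  interpret pair: pair_prob_space \<rho> \<rho> ..
  have F_b: "\<bar>F x y\<bar> \<le> 1 * 1 * (2 * b)" if "x \<in> space M" "y \<in> space M" for x y
    unfolding F_def using that W_nonneg[of x] W_le_1[of x] W_le_a[of x y] W_nonneg[of y] a_le_1[of x y]
      b[of x] b[of y]
    by (intro abs_mult_le) (auto simp: abs_le_iff)
  have [measurable]: "(\<lambda>(x, y). F x y) \<in> borel_measurable (M \<Otimes>\<^sub>M M)"
    unfolding F_def by measurable
  have F_int: "integrable (\<rho> \<Otimes>\<^sub>M \<rho>) (\<lambda>(x, y). F x y)"
    using F_b by (intro pair.integrable_bounded[where b="2 * b"]) (auto simp: space_pair_measure)
  have anti: "F x y = - F y x" if "x \<in> space M" "y \<in> space M" for x y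
    unfolding F_def using balance[OF that] by (simp add: algebra_simps)
  have "(LINT x|\<rho>. LINT y|\<rho>. F x y) = (LINT y|\<rho>. LINT x|\<rho>. F x y)"
    using pair.Fubini_integral[OF F_int] by simp
  also have "\<dots> = (LINT y|\<rho>. LINT x|\<rho>. - F y x)"
    by (intro Bochner_Integration.integral_cong refl, rule anti) auto
  finally have F0: "(LINT x|\<rho>. LINT y|\<rho>. F x y) = 0"
    by simp
  have inner: "(LINT y|\<rho>. F x y) = W x * kern \<rho> g x - W x * g x" if x [measurable]: "x \<in> space M" for x
  proof -
    have i: "integrable \<rho> (\<lambda>y. a x y * (g y - g x))"
    proof (rule integrable_rho)
      fix y assume y: "y \<in> space M"
      show "\<bar>a x y * (g y - g x)\<bar> \<le> 1 * (2 * b)"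
        using W_le_a[OF x y] W_nonneg[OF y] a_le_1[OF x y] b[OF x] b[OF y] by (intro abs_mult_le) auto
    qed measurable
    have "kern \<rho> g x = (LINT y|\<rho>. a x y * (g y - g x) + g x)"
      unfolding kern_def by (simp add: algebra_simps)
    also have "\<dots> = (LINT y|\<rho>. a x y * (g y - g x)) + g x"
      using i by simp
    moreover have "(LINT y|\<rho>. F x y) = W x * (LINT y|\<rho>. a x y * (g y - g x))"
      by (simp add: F_def mult.assoc)
    ultimately show ?thesis
      by (simp add: algebra_simps)
  qed
  have Wg: "integrable \<rho> (\<lambda>y. W y * g y)"
    using b W_nonneg W_le_1 by (intro integrable_rho[where b="1 * b"] abs_mult_le) auto
  have "integrable \<rho> (\<lambda>x. LINT y|\<rho>. F x y)"
    using pair.integrable_fst'[OF F_int] by simp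
  from Bochner_Integration.integral_add[OF this Wg] F0
  have "(LINT x|\<rho>. (LINT y|\<rho>. F x y) + W x * g x) = (LINT x|\<rho>. W x * g x)"
    by simp
  also have "(LINT x|\<rho>. (LINT y|\<rho>. F x y) + W x * g x) = (LINT x|\<rho>. W x * kern \<rho> g x)"
    by (intro Bochner_Integration.integral_cong refl) (auto simp: inner)
  finally show ?thesis .
qed

section \<open>Approximate solutions of the Poisson equation when the rate is bounded below\<close>

context
  fixes f :: "'b \<Rightarrow> real" and \<epsilon> :: real
  assumes f [measurable]: "f \<in> borel_measurable M" and f_le: "\<And>x. x \<in> space M \<Longrightarrow> \<bar>f x\<bar> \<le> 1"
    and \<epsilon>: "0 < \<epsilon>" "\<epsilon> \<le> rate \<rho>"
begin

lemma integrable_W_f: "integrable \<rho> (\<lambda>y. W y * f y)"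
  using f_le W_nonneg W_le_1 by (intro integrable_rho[where b="1 * 1"] abs_mult_le) auto

lemma integrable_W: "integrable \<rho> W"
  using W_nonneg W_le_1 by (intro integrable_rho[where b=1]) auto

lemma abs_invar_le: "\<bar>invar \<rho> f\<bar> \<le> 1"
proof -
  have "\<bar>LINT y|\<rho>. W y * f y\<bar> \<le> (LINT y|\<rho>. \<bar>W y * f y\<bar>)"
    using integral_norm_bound[of \<rho> "\<lambda>y. W y * f y"] by simp
  also have "\<dots> \<le> rate \<rho>"
    unfolding rate_def using integrable_W_f[THEN integrable_abs] integrable_W f_le W_nonneg
    by (intro integral_mono) (auto simp: abs_mult intro!: mult_left_le)
  finally show ?thesis
    unfolding invar_def using \<epsilon> by (simp add: divide_le_eq)
qed

lemma one_minus_rate: "0 \<le> 1 - rate \<rho>" "1 - rate \<rho> \<le> 1 - \<epsilon>"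
  using rate_bounds \<epsilon> by auto

text \<open>Since \<open>f - invar \<rho> f\<close> is bounded by 2 and \<open>resid\<close>
  contracts by \<open>1 - \<epsilon>\<close>, the bound is the fixed point of
  \<open>b = 2 + (1 - \<epsilon>) * b\<close>.\<close>

lemma abs_pois_le:
  assumes "x \<in> space M"
  shows "\<bar>pois \<rho> f N x\<bar> \<le> 2 / \<epsilon>"
  using assms
proof (induction N arbitrary: x)
  case 0
  then show ?case using \<epsilon> by simp
next
  case (Suc N)
  have "\<bar>resid \<rho> (pois \<rho> f N) x\<bar> \<le> (1 - rate \<rho>) * (2 / \<epsilon>)"
    using \<rho> f Suc by (intro abs_resid_le pois_measurable)
  also have "\<dots> \<le> (1 - \<epsilon>) * (2 / \<epsilon>)"
    using one_minus_rate \<epsilon> by (intro mult_right_mono) auto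
  also have "\<dots> = 2 / \<epsilon> - 2"
    using \<epsilon> by (simp add: field_simps)
  finally show ?case
    using f_le[OF Suc.prems] abs_invar_le by (simp del: One_nat_def)
qed

text \<open>The inhomogeneity \<open>f - invar \<rho> f\<close> cancels between consecutive
  iterates, and each further step applies \<open>resid\<close> to the previous difference. The bound
  is the error with which the \<open>N\<close>-th iterate solves the Poisson equation.\<close>

lemma pois_Cauchy:
  assumes "x \<in> space M"
  shows "\<bar>pois \<rho> f (Suc N) x - pois \<rho> f N x\<bar> \<le> 2 * (1 - \<epsilon>) ^ N"
  using assms
proof (induction N arbitrary: x)
  case 0
  then show ?case
    using f_le[of x] abs_invar_le by (simp add: resid_def)
next
  case (Suc N)
  note m = pois_measurable[OF \<rho> f]
  have "pois \<rho> f (Suc (Suc N)) x - pois \<rho> f (Suc N) x =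
      resid \<rho> (pois \<rho> f (Suc N)) x - resid \<rho> (pois \<rho> f N) x"
    by simp
  also have "\<dots> = resid \<rho> (\<lambda>x. pois \<rho> f (Suc N) x - pois \<rho> f N x) x"
    using Suc.prems abs_pois_le m by (intro resid_diff[symmetric])
  also have "\<bar>\<dots>\<bar> \<le> (1 - rate \<rho>) * (2 * (1 - \<epsilon>) ^ N)"
    using Suc m by (intro abs_resid_le) (auto intro!: borel_measurable_diff simp del: pois.simps)
  also have "\<dots> \<le> (1 - \<epsilon>) * (2 * (1 - \<epsilon>) ^ N)"
    using one_minus_rate by (intro mult_right_mono) auto
  finally show ?case by simp
qed

text \<open>The measure \<open>W \<cdot> \<rho>\<close> annihilates
  \<open>f - invar \<rho> f\<close> by the choice of \<open>invar\<close>. Once it annihilates an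
  iterate, \<open>resid\<close> acts on that iterate as \<open>kern\<close>, which preserves
  \<open>W \<cdot> \<rho>\<close>.\<close>

lemma W_pois: "(LINT y|\<rho>. W y * pois \<rho> f N y) = 0"
proof (induction N)
  case 0
  show ?case by simp
next
  case (Suc N)
  note m [measurable] = pois_measurable[OF \<rho> f]
  have k: "resid \<rho> (pois \<rho> f N) x = kern \<rho> (pois \<rho> f N) x" if "x \<in> space M" for x
    using that m abs_pois_le Suc by (intro resid_eq_kern)
  \<comment> \<open>Measurability of \<open>kern \<rho> (pois \<rho> f N)\<close> is read off from
    the next iterate, from which it differs on the space by
    \<open>f - invar \<rho> f\<close>.\<close>
  have "pois \<rho> f (Suc N) \<in> borel_measurable M"
    by (rule m)
  then have "(\<lambda>x. pois \<rho> f (Suc N) x - f x + invar \<rho> f) \<in> borel_measurable M"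
    by measurable
  then have [measurable]: "kern \<rho> (pois \<rho> f N) \<in> borel_measurable M"
    by (rule measurable_cong[THEN iffD1, rotated]) (simp add: k)
  have "integrable \<rho> (\<lambda>y. W y * kern \<rho> (pois \<rho> f N) y)"
    using abs_kern_le[OF m abs_pois_le] W_nonneg W_le_1
    by (intro integrable_rho[where b="1 * (2 / \<epsilon>)"] abs_mult_le) auto
  moreover have "(LINT y|\<rho>. W y * pois \<rho> f (Suc N) y) =
     (LINT y|\<rho>. W y * f y - W y * invar \<rho> f + W y * kern \<rho> (pois \<rho> f N) y)"
    by (intro Bochner_Integration.integral_cong refl) (simp add: k algebra_simps)
  ultimately have "(LINT y|\<rho>. W y * pois \<rho> f (Suc N) y) =
      (LINT y|\<rho>. W y * f y) - rate \<rho> * invar \<rho> f + (LINT y|\<rho>. W y * kern \<rho> (pois \<rho> f N) y)"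
    using integrable_W integrable_W_f by (simp add: rate_def del: pois.simps)
  moreover have "(LINT y|\<rho>. W y * kern \<rho> (pois \<rho> f N) y) = (LINT y|\<rho>. W y * pois \<rho> f N y)"
    using m abs_pois_le by (rule kern_invariant)
  ultimately have "(LINT y|\<rho>. W y * pois \<rho> f (Suc N) y) =
      (LINT y|\<rho>. W y * f y) - rate \<rho> * invar \<rho> f + (LINT y|\<rho>. W y * pois \<rho> f N y)"
    by metis
  then show ?case
    using Suc \<epsilon> by (simp add: invar_def del: pois.simps)
qed

lemma pois_Suc_eq:
  assumes "x \<in> space M"
  shows "pois \<rho> f (Suc N) x = f x - invar \<rho> f + kern \<rho> (pois \<rho> f N) x"
  using resid_eq_kern[OF pois_measurable[OF \<rho> f] abs_pois_le assms W_pois] by simp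

end

end

text \<open>As global rewrite rules these would match every \<open>sets\<close> and \<open>space\<close> and make the simplifier loop.\<close>

declare sets_rho [simp del, measurable_cong del] space_rho [simp del] prob_M [simp del]

text \<open>The assumption \<open>close\<close> is a total variation bound in terms of test
  functions. The change of \<open>invar\<close> and the change of the proposal inside
  \<open>resid\<close> contribute \<open>2 * \<delta> / \<epsilon>\<close> each, so the bound is the
  fixed point of \<open>d = (1 - \<epsilon>) * d + 4 * \<delta> / \<epsilon>\<close>.\<close>

lemma pois_Lipschitz:
  assumes \<rho>: "\<rho> \<in> space (prob_algebra M)" and \<rho>': "\<rho>' \<in> space (prob_algebra M)"
    and f [measurable]: "f \<in> borel_measurable M" and f_le: "\<And>x. x \<in> space M \<Longrightarrow> \<bar>f x\<bar> \<le> 1"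
    and \<epsilon>: "0 < \<epsilon>" "\<epsilon> \<le> rate \<rho>" "\<epsilon> \<le> rate \<rho>'"
    and close: "\<And>g b. g \<in> borel_measurable M \<Longrightarrow> (\<And>x. x \<in> space M \<Longrightarrow> \<bar>g x\<bar> \<le> b) \<Longrightarrow>
      \<bar>(LINT y|\<rho>'. g y) - (LINT y|\<rho>. g y)\<bar> \<le> \<delta> * b"
    and x: "x \<in> space M"
  shows "\<bar>pois \<rho>' f N x - pois \<rho> f N x\<bar> \<le> 4 * \<delta> / \<epsilon>\<^sup>2"
proof -
  note m = pois_measurable[OF \<rho> f] and m' = pois_measurable[OF \<rho>' f]
  have b: "\<bar>pois \<rho> f N x\<bar> \<le> 2 / \<epsilon>" and b': "\<bar>pois \<rho>' f N x\<bar> \<le> 2 / \<epsilon>"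
    if "x \<in> space M" for N x
    using that \<epsilon> f_le by (auto intro!: abs_pois_le \<rho> \<rho>' f)
  have "\<bar>rate \<rho>' - rate \<rho>\<bar> \<le> \<delta> * 1"
    unfolding rate_def using W_nonneg W_le_1 by (intro close) auto
  moreover have "\<bar>(LINT y|\<rho>'. W y * f y) - (LINT y|\<rho>. W y * f y)\<bar> \<le> \<delta> * (1 * 1)"
    using W_nonneg W_le_1 f_le by (intro close abs_mult_le) auto
  moreover have "\<bar>invar \<rho> f\<bar> \<le> 1"
    using \<rho> f f_le \<epsilon>(1,2) by (rule abs_invar_le)
  ultimately have "\<bar>((LINT y|\<rho>'. W y * f y) - (LINT y|\<rho>. W y * f y)) + invar \<rho> f * (rate \<rho> - rate \<rho>')\<bar>
      \<le> \<delta> * (1 * 1) + 1 * (\<delta> * 1)"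
    by (intro abs_triangle_ineq[THEN order_trans] add_mono abs_mult_le) auto
  \<comment> \<open>Writing the difference of the two quotients over \<open>rate \<rho>'\<close>
    alone keeps a single power of \<open>\<epsilon>\<close> in the denominator.\<close>
  moreover have "invar \<rho>' f - invar \<rho> f =
      (((LINT y|\<rho>'. W y * f y) - (LINT y|\<rho>. W y * f y)) + invar \<rho> f * (rate \<rho> - rate \<rho>')) / rate \<rho>'"
    using \<epsilon> by (simp add: invar_def field_simps)
  ultimately have "\<bar>invar \<rho>' f - invar \<rho> f\<bar> \<le> 2 * \<delta> / rate \<rho>'"
    using \<epsilon> by (simp add: divide_right_mono)
  also have \<delta>: "0 \<le> \<delta>"
    using \<open>\<bar>rate \<rho>' - rate \<rho>\<bar> \<le> \<delta> * 1\<close> by simp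
  then have "2 * \<delta> / rate \<rho>' \<le> 2 * \<delta> / \<epsilon>"
    using \<epsilon> by (intro divide_left_mono) auto
  finally have inv: "\<bar>invar \<rho>' f - invar \<rho> f\<bar> \<le> 2 * \<delta> / \<epsilon>" .
  show ?thesis
    using x
  proof (induction N arbitrary: x)
    case 0
    then show ?case using \<delta> by simp
  next
    case (Suc N)
    note x [measurable] = Suc.prems
    note [measurable] = m
    have "\<bar>resid \<rho>' (pois \<rho> f N) x - resid \<rho> (pois \<rho> f N) x\<bar> \<le> \<delta> * (2 / \<epsilon>)"
      unfolding resid_def
    proof (rule close)
      fix y assume y: "y \<in> space M"
      have "(1 - W y) * (2 / \<epsilon>) \<le> 1 * (2 / \<epsilon>)"
        using W_nonneg[OF y] \<epsilon> by (intro mult_right_mono) auto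
      with resid_integrand_bound[where g="pois \<rho> f N", OF \<rho> x y b[OF y] b[OF x]]
      show "\<bar>(a x y - W y) * pois \<rho> f N y + (1 - a x y) * pois \<rho> f N x\<bar> \<le> 2 / \<epsilon>"
        by simp
    qed measurable
    moreover have "\<bar>resid \<rho>' (\<lambda>x. pois \<rho>' f N x - pois \<rho> f N x) x\<bar> \<le> (1 - rate \<rho>') * (4 * \<delta> / \<epsilon>\<^sup>2)"
      using Suc x m m' by (intro abs_resid_le[OF \<rho>']) (auto intro!: borel_measurable_diff)
    moreover have "(1 - rate \<rho>') * (4 * \<delta> / \<epsilon>\<^sup>2) \<le> (1 - \<epsilon>) * (4 * \<delta> / \<epsilon>\<^sup>2)"
      using \<epsilon> \<delta> by (intro mult_right_mono) auto
    moreover have "(1 - \<epsilon>) * (4 * \<delta> / \<epsilon>\<^sup>2) = 4 * \<delta> / \<epsilon>\<^sup>2 - 4 * \<delta> / \<epsilon>"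
      using \<epsilon> by (simp add: field_simps power2_eq_square)
    moreover have "resid \<rho>' (\<lambda>x. pois \<rho>' f N x - pois \<rho> f N x) x =
        resid \<rho>' (pois \<rho>' f N) x - resid \<rho>' (pois \<rho> f N) x"
      using m m' b b' x by (intro resid_diff[OF \<rho>'])
    moreover have "pois \<rho>' f (Suc N) x - pois \<rho> f (Suc N) x =
       (resid \<rho>' (pois \<rho>' f N) x - resid \<rho>' (pois \<rho> f N) x)
       + (resid \<rho>' (pois \<rho> f N) x - resid \<rho> (pois \<rho> f N) x) - (invar \<rho>' f - invar \<rho> f)"
      by simp
    ultimately show ?case
      using inv by (simp del: pois.simps)
  qed
qed

end

section \<open>Integrals over the run of the algorithm\<close>

context simcmc
begin

lemma processed_Suc_0:
  "processed (Suc i) 0 = processed i P" "histories (Suc i) 0 = histories i P"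
proof -
  show "processed (Suc i) 0 = processed i P"
    by (auto simp: processed_def)
  then show "histories (Suc i) 0 = histories i P"
    by (simp add: histories_def)
qed

lemma processed_Suc:
  "processed i (Suc n) = insert (i, Suc n) (processed i n)"
  by (auto simp: processed_def)

lemma measurable_upd_history:
  "(\<lambda>(h, x). h((i, Suc n) := x)) \<in> histories i n \<Otimes>\<^sub>M paths E (Suc n) \<rightarrow>\<^sub>M histories i (Suc n)"
  using measurable_add_dim[of "(i, Suc n)" "processed i n" "\<lambda>(m, k). paths E k"]
  by (simp add: histories_def processed_Suc)

lemma transition_kernel:
  assumes "n < P"
  shows "transition (Suc i) (Suc n) \<in> histories (Suc i) n \<rightarrow>\<^sub>M prob_algebra (paths E (Suc n))"
  using assms by (intro measurable_transition) (auto simp: processed_def)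

lemma upd_kernel:
  assumes n: "n < P"
  shows "(\<lambda>h. distr (transition (Suc i) (Suc n) h) (histories (Suc i) (Suc n))
      (\<lambda>x. h((Suc i, Suc n) := x))) \<in> histories (Suc i) n \<rightarrow>\<^sub>M prob_algebra (histories (Suc i) (Suc n))"
  by (rule measurable_distr_prob_space2[OF transition_kernel[OF n] measurable_upd_history])

text \<open>Histories of different lengths live in different product spaces, while a functional of
  the algorithm is one function on all of them. This notion allows measurability and integrals to be
  moved between these spaces without explicit restrictions.\<close>

definition depends :: "nat \<Rightarrow> nat \<Rightarrow> ((nat \<times> nat \<Rightarrow> nat \<Rightarrow> 'a) \<Rightarrow> 'b) \<Rightarrow> bool"
  where "depends i n F \<longleftrightarrow> (\<forall>h h'. (\<forall>k\<in>processed i n. h k = h' k) \<longrightarrow> F h = F h')"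

lemma dependsD: "depends i n F \<Longrightarrow> (\<And>k. k \<in> processed i n \<Longrightarrow> h k = h' k) \<Longrightarrow> F h = F h'"
  unfolding depends_def by blast

lemma measurable_depends:
  assumes F: "F \<in> histories i n \<rightarrow>\<^sub>M N" "depends i n F" and sub: "processed i n \<subseteq> processed j l"
  shows "F \<in> histories j l \<rightarrow>\<^sub>M N"
proof -
  have "(\<lambda>h. restrict h (processed i n)) \<in> histories j l \<rightarrow>\<^sub>M histories i n"
    unfolding histories_def using sub by (rule measurable_restrict_subset)
  then have "(\<lambda>h. F (restrict h (processed i n))) \<in> histories j l \<rightarrow>\<^sub>M N"
    using F(1) by (rule measurable_compose)
  also have "(\<lambda>h. F (restrict h (processed i n))) = F"
    using F(2) by (intro ext dependsD[OF F(2)]) simp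
  finally show ?thesis .
qed

context
  fixes x0 :: "nat \<Rightarrow> nat \<Rightarrow> 'a"
  assumes x0: "\<And>k. k \<in> {1..P} \<Longrightarrow> x0 k \<in> supp k"
begin

lemma run_prob_level:
  assumes "n \<le> P"
  shows "run x0 (Suc i) n \<in> space (prob_algebra (histories (Suc i) n))"
  using assms
proof (induction n)
  case 0
  show ?case
    using run_prob[of x0 i] x0 by (simp add: processed_Suc_0)
next
  case (Suc n)
  then have n: "n < P" by simp
  from measurable_bind_prob_space[OF measurable_const[OF Suc.IH[OF Suc_leD[OF Suc.prems]]] upd_kernel[OF n],
      THEN measurable_space, of undefined "count_space UNIV"]
  show ?case
    by simp
qed

text \<open>The tower property: the inner integral is the conditional expectation given the history
  before the level.\<close>

lemma nn_integral_run_Suc: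
  assumes n: "n < P" and F: "F \<in> borel_measurable (histories (Suc i) (Suc n))"
  shows "(\<integral>\<^sup>+h. F h \<partial>run x0 (Suc i) (Suc n)) =
    (\<integral>\<^sup>+h. \<integral>\<^sup>+x. F (h((Suc i, Suc n) := x)) \<partial>transition (Suc i) (Suc n) h \<partial>run x0 (Suc i) n)"
proof -
  have s: "sets (run x0 (Suc i) n) = sets (histories (Suc i) n)"
    using run_prob_level[of n i] n by (simp add: space_prob_algebra)
  note k = measurable_prob_algebraD[OF upd_kernel[OF n, of i]]
  have "(\<integral>\<^sup>+h. F h \<partial>run x0 (Suc i) (Suc n)) =
     (\<integral>\<^sup>+h. \<integral>\<^sup>+y. F y \<partial>distr (transition (Suc i) (Suc n) h) (histories (Suc i) (Suc n))
      (\<lambda>x. h((Suc i, Suc n) := x)) \<partial>run x0 (Suc i) n)"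
    unfolding run.simps using k by (intro nn_integral_bind[OF F]) (simp add: measurable_cong_sets[OF s refl])
  also have "\<dots> = (\<integral>\<^sup>+h. \<integral>\<^sup>+x. F (h((Suc i, Suc n) := x)) \<partial>transition (Suc i) (Suc n) h \<partial>run x0 (Suc i) n)"
  proof (rule nn_integral_cong)
    fix h assume "h \<in> space (run x0 (Suc i) n)"
    then have h: "h \<in> space (histories (Suc i) n)"
      using sets_eq_imp_space_eq[OF s] by simp
    have t: "sets (transition (Suc i) (Suc n) h) = sets (paths E (Suc n))"
      using measurable_space[OF transition_kernel[OF n] h] by (simp add: space_prob_algebra)
    have "(\<lambda>x. h((Suc i, Suc n) := x)) \<in> paths E (Suc n) \<rightarrow>\<^sub>M histories (Suc i) (Suc n)"
      using measurable_compose[OF measurable_Pair1'[OF h] measurable_upd_history] by simp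
    then show "(\<integral>\<^sup>+y. F y \<partial>distr (transition (Suc i) (Suc n) h) (histories (Suc i) (Suc n)) (\<lambda>x. h((Suc i, Suc n) := x)))
      = (\<integral>\<^sup>+x. F (h((Suc i, Suc n) := x)) \<partial>transition (Suc i) (Suc n) h)"
      using F by (intro nn_integral_distr) (simp_all add: measurable_cong_sets[OF t refl])
  qed
  finally show ?thesis .
qed

text \<open>Later levels write only coordinates that \<open>F\<close> does not read, and their
  transitions have mass 1.\<close>

lemma nn_integral_run_level:
  assumes F: "F \<in> borel_measurable (histories (Suc i) l)" "depends (Suc i) l F" and l: "l \<le> n" "n \<le> P"
  shows "(\<integral>\<^sup>+h. F h \<partial>run x0 (Suc i) n) = (\<integral>\<^sup>+h. F h \<partial>run x0 (Suc i) l)"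
  using l
proof (induction n rule: dec_induct)
  case base
  show ?case ..
next
  case (step n)
  then have n: "n < P" by simp
  have s: "sets (run x0 (Suc i) n) = sets (histories (Suc i) n)"
    using run_prob_level[of n i] n by (simp add: space_prob_algebra)
  have "(\<integral>\<^sup>+h. F h \<partial>run x0 (Suc i) (Suc n)) =
    (\<integral>\<^sup>+h. \<integral>\<^sup>+x. F (h((Suc i, Suc n) := x)) \<partial>transition (Suc i) (Suc n) h \<partial>run x0 (Suc i) n)"
    using step by (intro nn_integral_run_Suc n measurable_depends[OF F]) (auto simp: processed_def)
  also have "\<dots> = (\<integral>\<^sup>+h. \<integral>\<^sup>+x. F h \<partial>transition (Suc i) (Suc n) h \<partial>run x0 (Suc i) n)"
    using step by (intro nn_integral_cong dependsD[OF F(2)]) (auto simp: processed_def)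
  also have "\<dots> = (\<integral>\<^sup>+h. F h \<partial>run x0 (Suc i) n)"
  proof (rule nn_integral_cong)
    fix h assume "h \<in> space (run x0 (Suc i) n)"
    then have "h \<in> space (histories (Suc i) n)"
      using sets_eq_imp_space_eq[OF s] by simp
    from measurable_space[OF transition_kernel[OF n] this]
    have "prob_space (transition (Suc i) (Suc n) h)"
      by (simp add: space_prob_algebra)
    then show "(\<integral>\<^sup>+x. F h \<partial>transition (Suc i) (Suc n) h) = F h"
      by (simp add: prob_space.emeasure_space_1)
  qed
  finally show ?case
    using step by simp
qed

lemma nn_integral_run:
  assumes F: "F \<in> borel_measurable (histories m P)" "depends m P F" and i: "m \<le> i"
  shows "(\<integral>\<^sup>+h. F h \<partial>run x0 i P) = (\<integral>\<^sup>+h. F h \<partial>run x0 m P)"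
  using i
proof (induction i rule: dec_induct)
  case base
  show ?case ..
next
  case (step i)
  have "F \<in> borel_measurable (histories (Suc i) 0)"
    using step by (intro measurable_depends[OF F]) (auto simp: processed_def)
  moreover have "depends (Suc i) 0 F"
    unfolding depends_def using step by (intro allI impI dependsD[OF F(2)]) (auto simp: processed_def)
  ultimately have "(\<integral>\<^sup>+h. F h \<partial>run x0 (Suc i) P) = (\<integral>\<^sup>+h. F h \<partial>run x0 (Suc i) 0)"
    by (intro nn_integral_run_level) auto
  with step show ?case
    by simp
qed

text \<open>The Azuma-Hoeffding bound. The relevant past of iteration \<open>m\<close> ends just
  before level \<open>n\<close>, where the earlier increments are already fixed and
  \<open>G m\<close> is centered; Hoeffding's lemma then contributes one factor per
  iteration.\<close>

lemma nn_integral_exp_martingale_le: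
  fixes G :: "nat \<Rightarrow> (nat \<times> nat \<Rightarrow> nat \<Rightarrow> 'a) \<Rightarrow> real"
  assumes n: "n \<in> {1..P}" and l: "0 < l"
    and meas: "\<And>m. 1 \<le> m \<Longrightarrow> G m \<in> borel_measurable (histories m n)"
    and dep: "\<And>m. 1 \<le> m \<Longrightarrow> depends m n (G m)"
    and b: "\<And>m h. 1 \<le> m \<Longrightarrow> h \<in> space (histories m n) \<Longrightarrow> \<bar>G m h\<bar> \<le> b"
    and mart: "\<And>m h. 1 \<le> m \<Longrightarrow> h \<in> space (histories m (n - 1)) \<Longrightarrow>
      (LINT x|transition m n h. G m (h((m, n) := x))) = 0"
  shows "(\<integral>\<^sup>+h. ennreal (exp (l * (\<Sum>m=1..i. G m h))) \<partial>run x0 i P) \<le> ennreal (exp (i * (l\<^sup>2 * b\<^sup>2 / 2)))"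
proof (induction i)
  case 0
  have "prob_space (run x0 0 P)"
    using run_prob[of x0 0] x0 by (simp add: space_prob_algebra)
  then show ?case
    by (simp add: prob_space.emeasure_space_1 del: run.simps)
next
  case (Suc i)
  obtain k where k: "n = Suc k" "k < P"
    using n by (cases n) auto
  define S where "S = (\<lambda>h. \<Sum>m=1..i. G m h)"
  have S_dep: "depends i P S"
    unfolding depends_def S_def using n
    by (intro allI impI sum.cong refl dependsD[OF dep]) (auto simp: processed_def)
  have S_meas: "S \<in> borel_measurable (histories i P)"
    unfolding S_def using n
    by (intro borel_measurable_sum measurable_depends[OF meas dep]) (auto simp: processed_def)
  have S_meas' [measurable]: "S \<in> borel_measurable (histories (Suc i) k)" "S \<in> borel_measurable (histories (Suc i) n)"
    by (rule measurable_depends[OF S_meas S_dep], force simp: processed_def)+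
  note [measurable] = meas[of "Suc i"]
  have sets_k: "sets (run x0 (Suc i) k) = sets (histories (Suc i) k)"
    using run_prob_level[of k i] k by (simp add: space_prob_algebra)
  have eq: "(\<Sum>m=1..Suc i. G m h) = S h + G (Suc i) h" for h
    by (simp add: S_def)
  let ?c = "ennreal (exp (l\<^sup>2 * b\<^sup>2 / 2))"
  \<comment> \<open>The levels after \<open>n\<close> are integrated out first, so that level
    \<open>n\<close> is the last one and can be conditioned on its past.\<close>
  have "(\<integral>\<^sup>+h. ennreal (exp (l * (S h + G (Suc i) h))) \<partial>run x0 (Suc i) P) =
      (\<integral>\<^sup>+h. ennreal (exp (l * (S h + G (Suc i) h))) \<partial>run x0 (Suc i) n)"
  proof (rule nn_integral_run_level)
    show "depends (Suc i) n (\<lambda>h. ennreal (exp (l * (S h + G (Suc i) h))))"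
      unfolding depends_def
      by (intro allI impI arg_cong[where f=ennreal] arg_cong[where f=exp] arg_cong2[where f="(*)"] refl
          arg_cong2[where f="(+)"] dependsD[OF S_dep] dependsD[OF dep]) (auto simp: processed_def)
  qed (use n in auto)
  also have "\<dots> = (\<integral>\<^sup>+h. \<integral>\<^sup>+x. ennreal (exp (l * (S (h((Suc i, n) := x)) + G (Suc i) (h((Suc i, n) := x)))))
      \<partial>transition (Suc i) n h \<partial>run x0 (Suc i) k)"
    unfolding k(1) using S_meas' meas[of "Suc i"] k(1) by (intro nn_integral_run_Suc[OF k(2)]) simp
  also have "\<dots> \<le> (\<integral>\<^sup>+h. ennreal (exp (l * S h)) * ?c \<partial>run x0 (Suc i) k)"
  proof (rule nn_integral_mono)
    fix h assume "h \<in> space (run x0 (Suc i) k)"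
    then have h: "h \<in> space (histories (Suc i) k)"
      using sets_eq_imp_space_eq[OF sets_k] by simp
    have "transition (Suc i) n h \<in> space (prob_algebra (paths E n))"
      using measurable_space[OF transition_kernel[OF k(2)] h] k by simp
    then have t: "sets (transition (Suc i) n h) = sets (paths E n)" and p: "prob_space (transition (Suc i) n h)"
      by (auto simp: space_prob_algebra)
    have upd: "(\<lambda>x. h((Suc i, n) := x)) \<in> paths E n \<rightarrow>\<^sub>M histories (Suc i) n"
      using measurable_compose[OF measurable_Pair1'[OF h] measurable_upd_history] k by simp
    have Gm: "(\<lambda>x. G (Suc i) (h((Suc i, n) := x))) \<in> borel_measurable (transition (Suc i) n h)"
      using measurable_compose[OF upd meas[of "Suc i"]] by (simp add: measurable_cong_sets[OF t refl])
    have "S (h((Suc i, n) := x)) = S h" for x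
      by (rule dependsD[OF S_dep]) (auto simp: processed_def)
    then have "(\<integral>\<^sup>+x. ennreal (exp (l * (S (h((Suc i, n) := x)) + G (Suc i) (h((Suc i, n) := x)))))
        \<partial>transition (Suc i) n h) =
        (\<integral>\<^sup>+x. ennreal (exp (l * S h)) * ennreal (exp (l * G (Suc i) (h((Suc i, n) := x)))) \<partial>transition (Suc i) n h)"
      by (simp add: distrib_left exp_add ennreal_mult)
    also have "\<dots> = ennreal (exp (l * S h)) * (\<integral>\<^sup>+x. ennreal (exp (l * G (Suc i) (h((Suc i, n) := x)))) \<partial>transition (Suc i) n h)"
      by (intro nn_integral_cmult measurable_compose[OF Gm]) measurable
    also have "\<dots> \<le> ennreal (exp (l * S h)) * ?c"
    proof (intro mult_left_mono nn_integral_exp_centered_le p l Gm)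
      fix x assume "x \<in> space (transition (Suc i) n h)"
      then show "\<bar>G (Suc i) (h((Suc i, n) := x))\<bar> \<le> b"
        using sets_eq_imp_space_eq[OF t] by (intro b measurable_space[OF upd]) auto
    qed (use mart[of "Suc i" h] h k in auto)
    finally show "(\<integral>\<^sup>+x. ennreal (exp (l * (S (h((Suc i, n) := x)) + G (Suc i) (h((Suc i, n) := x)))))
        \<partial>transition (Suc i) n h) \<le> ennreal (exp (l * S h)) * ?c" .
  qed
  also have "\<dots> = (\<integral>\<^sup>+h. ennreal (exp (l * S h)) \<partial>run x0 (Suc i) k) * ?c"
    by (rule nn_integral_multc) (simp add: measurable_cong_sets[OF sets_k refl])
  \<comment> \<open>The levels before \<open>n\<close> do not affect \<open>S\<close> either; level
    0 of this iteration is the end of the previous one, where the induction hypothesis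
    applies.\<close>
  also have "(\<integral>\<^sup>+h. ennreal (exp (l * S h)) \<partial>run x0 (Suc i) k) = (\<integral>\<^sup>+h. ennreal (exp (l * S h)) \<partial>run x0 (Suc i) 0)"
  proof (rule nn_integral_run_level)
    show "depends (Suc i) 0 (\<lambda>h. ennreal (exp (l * S h)))"
      unfolding depends_def processed_Suc_0 using dependsD[OF S_dep] by metis
  qed (use S_meas k in \<open>auto simp: processed_Suc_0\<close>)
  also have "\<dots> * ?c \<le> ennreal (exp (i * (l\<^sup>2 * b\<^sup>2 / 2))) * ?c"
    using Suc by (intro mult_right_mono) (simp_all add: S_def)
  also have "\<dots> = ennreal (exp (Suc i * (l\<^sup>2 * b\<^sup>2 / 2)))"
    by (simp add: ennreal_mult[symmetric] exp_add[symmetric]) (simp add: field_simps)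
  finally show ?case
    unfolding eq .
qed

end

section \<open>The proposals as functions of the history\<close>

lemma unit_boundedD:
  assumes "f \<in> unit_bounded n"
  shows "f \<in> borel_measurable (paths E n)" "x \<in> space (paths E n) \<Longrightarrow> \<bar>f x\<bar> \<le> 1"
  using assms by (auto simp: unit_bounded_def)

lemma Z_pos: "n \<in> {1..P} \<Longrightarrow> 0 < Z n"
  using gamma_integral_pos by (simp add: Z_def)

lemma depends_mono:
  "depends i n F \<Longrightarrow> processed i n \<subseteq> processed j l \<Longrightarrow> depends j l F"
  unfolding depends_def by blast

lemma depends_empirical:
  assumes "\<And>m. m \<le> i \<Longrightarrow> (m, n) \<in> processed j l"
  shows "depends j l (empirical n i)"
  unfolding depends_def empirical_def using assms
  by (intro allI impI distr_cong refl) (auto simp: space_uniform_count_measure)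

lemma depends_proposal:
  assumes "1 \<le> m" "n \<in> {1..P}"
  shows "depends m (n - 1) (proposal m n)"
proof (cases "n = 1")
  case True
  then show ?thesis by (simp add: depends_def proposal_def)
next
  case False
  with assms have "depends m (n - 1) (empirical (n - 1) m)"
    by (intro depends_empirical) (auto simp: processed_def)
  with False show ?thesis
    unfolding depends_def proposal_def by metis
qed

lemma proposal_kernel:
  assumes "1 \<le> m" "n \<in> {1..P}"
  shows "proposal m n \<in> histories m (n - 1) \<rightarrow>\<^sub>M prob_algebra (paths E n)"
  using assms by (intro measurable_proposal) (auto simp: processed_def)

lemma proposal_prob:
  assumes "1 \<le> m" "n \<in> {1..P}" "h \<in> space (histories i l)" "processed m (n - 1) \<subseteq> processed i l"
  shows "proposal m n h \<in> space (prob_algebra (paths E n))"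
  using measurable_space[OF measurable_depends[OF proposal_kernel depends_proposal]] assms by blast

text \<open>The Markov kernel whose composition with \<open>\<mu>\<close> is
  \<open>extend n \<mu>\<close>. It turns a test function at level \<open>n\<close> into one at
  level \<open>n - 1\<close>.\<close>

definition append_kernel :: "nat \<Rightarrow> (nat \<Rightarrow> 'a) \<Rightarrow> (nat \<Rightarrow> 'a) measure"
  where "append_kernel n x =
    distr (density (ref n) (\<lambda>y. ennreal (q n x y))) (paths E n) (\<lambda>y. x(n := y))"

lemma append_kernel:
  assumes n: "n \<in> {2..P}"
  shows "append_kernel n \<in> paths E (n - 1) \<rightarrow>\<^sub>M prob_algebra (paths E n)"
    and "\<mu> \<in> space (prob_algebra (paths E (n - 1))) \<Longrightarrow> extend n \<mu> = \<mu> \<bind> append_kernel n"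
  using extend_kernel[OF n] unfolding append_kernel_def[abs_def] by blast+

lemma integral_extend:
  fixes g :: "(nat \<Rightarrow> 'a) \<Rightarrow> real"
  assumes n: "n \<in> {2..P}" and \<mu>: "\<mu> \<in> space (prob_algebra (paths E (n - 1)))"
    and g: "g \<in> borel_measurable (paths E n)" "\<And>x. x \<in> space (paths E n) \<Longrightarrow> \<bar>g x\<bar> \<le> b"
  shows "(LINT x|extend n \<mu>. g x) = (LINT x|\<mu>. LINT y|append_kernel n x. g y)"
  unfolding append_kernel(2)[OF n \<mu>] by (rule integral_bind_prob[OF \<mu> append_kernel(1)[OF n] g])

lemma integral_append_kernel:
  fixes g :: "(nat \<Rightarrow> 'a) \<Rightarrow> real"
  assumes n: "n \<in> {2..P}"
    and g: "g \<in> borel_measurable (paths E n)" "\<And>x. x \<in> space (paths E n) \<Longrightarrow> \<bar>g x\<bar> \<le> b"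
  shows "(\<lambda>x. LINT y|append_kernel n x. g y) \<in> borel_measurable (paths E (n - 1))"
    and "x \<in> space (paths E (n - 1)) \<Longrightarrow> \<bar>LINT y|append_kernel n x. g y\<bar> \<le> b"
proof -
  show "(\<lambda>x. LINT y|append_kernel n x. g y) \<in> borel_measurable (paths E (n - 1))"
    using measurable_compose[OF measurable_prob_algebraD[OF append_kernel(1)[OF n]]
        integral_measurable_subprob_algebra[OF g(1)]] .
  assume "x \<in> space (paths E (n - 1))"
  then have s: "sets (append_kernel n x) = sets (paths E n)" and p: "prob_space (append_kernel n x)"
    using measurable_space[OF append_kernel(1)[OF n]] by (auto simp: space_prob_algebra)
  show "\<bar>LINT y|append_kernel n x. g y\<bar> \<le> b"
    using g sets_eq_imp_space_eq[OF s]
    by (intro prob_space.abs_expectation_le[OF p]) (simp_all add: measurable_cong_sets[OF s refl])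
qed

text \<open>The explicit average serves to compare consecutive iterations; the integral against the
  empirical measure serves to apply the bound of the previous level.\<close>

lemma integral_proposal:
  fixes g :: "(nat \<Rightarrow> 'a) \<Rightarrow> real"
  assumes n: "n \<in> {2..P}" and h: "\<And>m. m \<le> i \<Longrightarrow> h (m, n - 1) \<in> space (paths E (n - 1))"
    and g: "g \<in> borel_measurable (paths E n)" "\<And>x. x \<in> space (paths E n) \<Longrightarrow> \<bar>g x\<bar> \<le> b"
  shows "(LINT x|proposal i n h. g x) = (\<Sum>m\<le>i. LINT y|append_kernel n (h (m, n - 1)). g y) / real (i + 1)"
    and "(LINT x|proposal i n h. g x) = (LINT x|empirical (n - 1) i h. LINT y|append_kernel n x. g y)"
proof -
  have "(\<lambda>m. h (m, n - 1)) \<in> uniform_count_measure {..i} \<rightarrow>\<^sub>M paths E (n - 1)"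
    using h by (auto simp: measurable_def sets_uniform_count_measure space_uniform_count_measure)
  then have "prob_space (empirical (n - 1) i h)"
    unfolding empirical_def
    by (intro prob_space.prob_space_distr prob_space_uniform_count_measure) auto
  then have e: "empirical (n - 1) i h \<in> space (prob_algebra (paths E (n - 1)))"
    by (simp add: space_prob_algebra empirical_def)
  have "proposal i n h = extend n (empirical (n - 1) i h)"
    using n by (simp add: proposal_def)
  then show *: "(LINT x|proposal i n h. g x) = (LINT x|empirical (n - 1) i h. LINT y|append_kernel n x. g y)"
    using integral_extend[OF n e g] by simp
  show "(LINT x|proposal i n h. g x) = (\<Sum>m\<le>i. LINT y|append_kernel n (h (m, n - 1)). g y) / real (i + 1)"
    unfolding * by (intro integral_empirical h integral_append_kernel[OF n g])
qed

text \<open>Adding one term \<open>r\<close> to an average of \<open>m + 1\<close> terms moves it by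
  \<open>r\<close> minus the old average, divided by \<open>m + 2\<close>. This supplies the total
  variation distance needed in \<open>mh.pois_Lipschitz\<close>.\<close>

lemma integral_proposal_Suc:
  fixes g :: "(nat \<Rightarrow> 'a) \<Rightarrow> real"
  assumes n: "n \<in> {1..P}" and h: "h \<in> space (histories i l)" "processed (Suc m) (n - 1) \<subseteq> processed i l"
    and g: "g \<in> borel_measurable (paths E n)" and b: "\<And>x. x \<in> space (paths E n) \<Longrightarrow> \<bar>g x\<bar> \<le> b"
  shows "\<bar>(LINT x|proposal (Suc m) n h. g x) - (LINT x|proposal m n h. g x)\<bar> \<le> 2 / real (m + 2) * b"
proof (cases "n = 1")
  case True
  \<comment> \<open>The first proposal is the same in all iterations, so only
    \<open>0 \<le> b\<close> is needed; it follows because a space carrying a probability measure is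
    not empty.\<close>
  have "proposal (Suc m) n h \<in> space (prob_algebra (paths E n))"
    using n h by (intro proposal_prob) auto
  then have "prob_space (proposal (Suc m) n h)" "sets (proposal (Suc m) n h) = sets (paths E n)"
    by (auto simp: space_prob_algebra)
  then obtain x where "x \<in> space (paths E n)"
    using prob_space.not_empty sets_eq_imp_space_eq by blast
  then have "0 \<le> b"
    using b[of x] by simp
  then show ?thesis
    using True by (simp add: proposal_def)
next
  case False
  with n have n2: "n \<in> {2..P}" by auto
  have hs: "h (j, n - 1) \<in> space (paths E (n - 1))" if "j \<le> Suc m" for j
    using n2 that by (intro space_historiesD[OF h(1)] subsetD[OF h(2)]) (auto simp: processed_def)
  define S where "S = (\<Sum>j\<le>m. LINT y|append_kernel n (h (j, n - 1)). g y)"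
  define r where "r = (LINT y|append_kernel n (h (Suc m, n - 1)). g y)"
  have "\<bar>S\<bar> \<le> (\<Sum>j\<le>m. \<bar>LINT y|append_kernel n (h (j, n - 1)). g y\<bar>)"
    unfolding S_def by (rule sum_abs)
  also have "\<dots> \<le> (\<Sum>j\<le>m. b)"
    using hs by (intro sum_mono integral_append_kernel(2)[OF n2 g b]) auto
  finally have S: "\<bar>S\<bar> \<le> real (m + 1) * b"
    by simp
  have r: "\<bar>r\<bar> \<le> b"
    unfolding r_def using hs by (intro integral_append_kernel(2)[OF n2 g b]) auto
  have "(LINT x|proposal (Suc m) n h. g x) =
      (\<Sum>j\<le>Suc m. LINT y|append_kernel n (h (j, n - 1)). g y) / real (Suc m + 1)"
    by (rule integral_proposal(1)[OF n2 _ g b]) (rule hs)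
  then have "(LINT x|proposal (Suc m) n h. g x) = (S + r) / real (m + 2)"
    by (simp add: S_def r_def)
  moreover have "(LINT x|proposal m n h. g x) = S / real (m + 1)"
    unfolding S_def by (rule integral_proposal(1)[OF n2 _ g b]) (rule hs, simp)
  moreover have "(S + r) / real (m + 2) - S / real (m + 1) = (r - S / real (m + 1)) / real (m + 2)"
    by (simp add: divide_simps) (simp add: algebra_simps)
  moreover have "\<bar>S / real (m + 1)\<bar> \<le> b"
    using S by (simp add: divide_le_eq mult.commute del: of_nat_Suc)
  then have "\<bar>r - S / real (m + 1)\<bar> \<le> 2 * b"
    using r by linarith
  then have "\<bar>(r - S / real (m + 1)) / real (m + 2)\<bar> \<le> 2 * b / real (m + 2)"
    by (simp add: divide_right_mono)
  ultimately show ?thesis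
    by simp
qed

end

section \<open>One level of the algorithm\<close>

locale simcmc_level = simcmc +
  fixes n :: nat and B :: real
  assumes n: "n \<in> {1..P}" and B_pos: "0 < B"
    and weight_le: "\<And>x. x \<in> supp n \<Longrightarrow> weight n x \<le> ennreal B"
begin

text \<open>
  The minorization and detailed balance of the acceptance probability hold for \<open>W\<close> on all paths, also
  outside \<open>supp n\<close>, where \<open>W = 0\<close>; hence it never matters whether the chain stays in \<open>supp n\<close>.
\<close>

definition W :: "(nat \<Rightarrow> 'a) \<Rightarrow> real"
  where "W x = enn2real (weight n x) / B"

lemma gamma_eq_0:
  assumes "x \<in> space (paths E n)" "x \<notin> supp n"
  shows "\<gamma> n x = 0"
  using assms Z_pos[OF n] gamma_nonneg[OF n assms(1)] by (auto simp: supp_def zero_less_divide_iff)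

lemma weight_eq_0:
  assumes "x \<in> space (paths E n)" "x \<notin> supp n"
  shows "weight n x = 0"
  using gamma_eq_0[OF assms] by (auto simp: weight_def)

lemma weight_le': "x \<in> space (paths E n) \<Longrightarrow> weight n x \<le> ennreal B"
  using weight_le[of x] weight_eq_0[of x] by (cases "x \<in> supp n") auto

lemma W_bounds:
  assumes "x \<in> space (paths E n)"
  shows "0 \<le> W x" "W x \<le> 1"
proof -
  have "enn2real (weight n x) \<le> B"
    using weight_le'[OF assms] B_pos by (intro enn2real_leI) auto
  then show "0 \<le> W x" "W x \<le> 1"
    using B_pos by (auto simp: W_def)
qed

lemma weight_eq:
  assumes "x \<in> space (paths E n)"
  shows "weight n x = ennreal (B * W x)"
proof -
  have "weight n x < \<top>"
    using le_less_trans[OF weight_le'[OF assms] ennreal_less_top] .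
  then show ?thesis
    using B_pos by (simp add: W_def ennreal_enn2real_if)
qed

text \<open>The conventions of extended division at a current state of weight 0: a proposal of
  positive weight is always accepted, one of weight 0 never. With these values minorization and
  balance hold at such states too.\<close>

lemma accept_prob_eq:
  assumes x: "x \<in> space (paths E n)" and y: "y \<in> space (paths E n)"
  shows "accept_prob n x y = (if W x = 0 then (if W y = 0 then 0 else 1) else min 1 (W y / W x))"
proof (cases "W x = 0")
  case True
  show ?thesis
  proof (cases "W y = 0")
    case True
    then show ?thesis
      using \<open>W x = 0\<close> by (simp add: accept_prob_def weight_eq x y)
  next
    case False
    then have "0 < W y"
      using W_bounds[OF y] by simp
    then have "weight n y / weight n x = \<infinity>"
      using \<open>W x = 0\<close> B_pos by (simp add: weight_eq x y ennreal_divide_zero)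
    then show ?thesis
      using \<open>W x = 0\<close> False by (simp add: accept_prob_def)
  qed
next
  case False
  then have "0 < W x"
    using W_bounds[OF x] by simp
  then have "weight n y / weight n x = ennreal (W y / W x)"
    using W_bounds[OF y] B_pos by (simp add: weight_eq x y divide_ennreal)
  then have "min 1 (weight n y / weight n x) = ennreal (min 1 (W y / W x))"
    using ennreal_leI[of 1 "W y / W x"] ennreal_leI[of "W y / W x" 1]
    by (cases "1 \<le> W y / W x") (simp_all add: min_absorb1 min_absorb2)
  then show ?thesis
    using False \<open>0 < W x\<close> W_bounds[OF y] by (simp add: accept_prob_def)
qed

text \<open>Minorization holds since \<open>W x \<le> 1\<close> makes \<open>W y / W x\<close> at
  least \<open>W y\<close>. Both sides of the balance equation equal
  \<open>min (W x) (W y)\<close>.\<close>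

sublocale mh: indep_mh "paths E n" W "accept_prob n"
proof
  note [measurable] = measurable_weight[OF n]
  show "W \<in> borel_measurable (paths E n)"
    unfolding W_def[abs_def] by measurable
  show "(\<lambda>(x, y). accept_prob n x y) \<in> borel_measurable (paths E n \<Otimes>\<^sub>M paths E n)"
    unfolding accept_prob_def by measurable
next
  fix x y assume x: "x \<in> space (paths E n)" and y: "y \<in> space (paths E n)"
  note b = W_bounds[OF x] W_bounds[OF y]
  show "W y \<le> accept_prob n x y"
  proof (cases "W x = 0")
    case False
    have "W y * W x \<le> W y"
      using b by (simp add: mult_left_le)
    then show ?thesis
      using False b by (simp add: accept_prob_eq x y le_divide_eq)
  qed (use b in \<open>simp add: accept_prob_eq x y\<close>)
  show "accept_prob n x y \<le> 1"
    using accept_prob_bounds[of n x y] by simp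
  show "W x * accept_prob n x y = W y * accept_prob n y x"
    using b by (auto simp: accept_prob_eq x y min_def field_simps)
qed (use W_bounds in auto)

text \<open>Averaging over the acceptance draw for a given proposal \<open>y\<close> yields the
  integrand of \<open>mh.kern\<close>.\<close>

lemma integral_transition:
  fixes g :: "(nat \<Rightarrow> 'a) \<Rightarrow> real"
  assumes m: "1 \<le> m" and h: "h \<in> space (histories m (n - 1))"
    and g: "g \<in> borel_measurable (paths E n)" "\<And>x. x \<in> space (paths E n) \<Longrightarrow> \<bar>g x\<bar> \<le> b"
  shows "(LINT x|transition m n h. g x) = mh.kern (proposal m n h) g (h (m - 1, n))"
proof -
  let ?x = "h (m - 1, n)"
  have x [measurable]: "?x \<in> space (paths E n)"
    using n m by (intro space_historiesD[OF h]) (auto simp: processed_def)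
  have p: "proposal m n h \<in> space (prob_algebra (paths E n))"
    using measurable_space[OF proposal_kernel[OF m n] h] .
  have [measurable]: "(\<lambda>y. measure_pmf (bernoulli_pmf (accept_prob n ?x y))) \<in> paths E n \<rightarrow>\<^sub>M prob_algebra (count_space UNIV)"
    using accept_prob_bounds by (intro measurable_bernoulli) measurable
  have K: "(\<lambda>y. distr (measure_pmf (bernoulli_pmf (accept_prob n ?x y))) (paths E n) (\<lambda>accept. if accept then y else ?x))
      \<in> paths E n \<rightarrow>\<^sub>M prob_algebra (paths E n)"
    by measurable
  have "(LINT x|transition m n h. g x) = (LINT y|proposal m n h.
      LINT z|distr (measure_pmf (bernoulli_pmf (accept_prob n ?x y))) (paths E n) (\<lambda>accept. if accept then y else ?x). g z)"
    unfolding transition_def by (rule integral_bind_prob[OF p K g])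
  also have "\<dots> = mh.kern (proposal m n h) g ?x"
    unfolding mh.kern_def
  proof (rule Bochner_Integration.integral_cong)
    fix y assume "y \<in> space (proposal m n h)"
    moreover have "sets (proposal m n h) = sets (paths E n)"
      using p by (simp add: space_prob_algebra)
    then have "space (proposal m n h) = space (paths E n)"
      by (rule sets_eq_imp_space_eq)
    ultimately have y: "y \<in> space (paths E n)"
      by simp
    then have "(\<lambda>accept. if accept then y else ?x) \<in> measure_pmf (bernoulli_pmf (accept_prob n ?x y)) \<rightarrow>\<^sub>M paths E n"
      using x by simp
    note integral_distr[OF this g(1)]
    moreover have "accept_prob n ?x y \<in> {0..1}"
      by (rule accept_prob_bounds)
    ultimately    show "(LINT z|distr (measure_pmf (bernoulli_pmf (accept_prob n ?x y))) (paths E n) (\<lambda>accept. if accept then y else ?x). g z)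
       = accept_prob n ?x y * g y + (1 - accept_prob n ?x y) * g ?x"
      by simp
  qed simp
  finally show ?thesis .
qed

end

context simcmc
begin

text \<open>\<open>C\<close> may depend on the scale \<open>l\<close>, but not on the start, the
  test function or the iteration. All scales are quantified because each level uses the previous one
  at a larger scale, and all test functions because the induction replaces \<open>f\<close> by its
  average under \<open>append_kernel\<close>.\<close>

definition exp_moment_bound :: "nat \<Rightarrow> bool"
  where "exp_moment_bound n \<longleftrightarrow> (\<forall>l>0. \<exists>C::real. \<forall>x0 f i.
    (\<forall>k\<in>{1..P}. x0 k \<in> supp k) \<longrightarrow> f \<in> unit_bounded n \<longrightarrow>
    (\<integral>\<^sup>+h. ennreal (exp (l * sqrt (real (i + 1)) *
      \<bar>(LINT x|empirical n i h. f x) - (LINT x|target n. f x)\<bar>)) \<partial>run x0 i P) \<le> ennreal C)"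

end

section \<open>Pathwise decomposition of the error by the Poisson equation\<close>

context simcmc_level
begin

context
  fixes f :: "(nat \<Rightarrow> 'a) \<Rightarrow> real" and c \<epsilon> :: real and N :: nat
  assumes f_unit: "f \<in> unit_bounded n" and c: "\<bar>c\<bar> \<le> 1" and \<epsilon>: "0 < \<epsilon>" "\<epsilon> \<le> 1"
begin

text \<open>
  Here \<open>2 * \<epsilon>\<close> stands for the limit of the rate of the proposals and \<open>c\<close> for \<open>\<pi>\<^sub>n(f)\<close>. In the iterations where
  the rate is below \<open>\<epsilon>\<close>, the corrector is cut off to \<open>0\<close> and \<open>bias\<close> exceeds \<open>\<epsilon>\<close>.
\<close>

definition corrector :: "nat \<Rightarrow> (nat \<times> nat \<Rightarrow> nat \<Rightarrow> 'a) \<Rightarrow> (nat \<Rightarrow> 'a) \<Rightarrow> real"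
  where "corrector m h x =
    (if \<epsilon> \<le> mh.rate (proposal m n h) then mh.pois (proposal m n h) f N x else 0)"

text \<open>The martingale increment: the corrector at the new state minus its conditional mean
  given the past.\<close>

definition innovation :: "nat \<Rightarrow> (nat \<times> nat \<Rightarrow> nat \<Rightarrow> 'a) \<Rightarrow> real"
  where "innovation m h = corrector m h (h (m, n)) -
    mh.kern (proposal m n h) (corrector m h) (h (m - 1, n))"

text \<open>Unlike \<open>mh.invar\<close>, both integrals are linear in the proposal, so each
  deviation is an error that the previous level controls.\<close>

definition bias :: "nat \<Rightarrow> (nat \<times> nat \<Rightarrow> nat \<Rightarrow> 'a) \<Rightarrow> real"
  where "bias m h = \<bar>(LINT x|proposal m n h. W x * f x) - 2 * \<epsilon> * c\<bar> +
    \<bar>mh.rate (proposal m n h) - 2 * \<epsilon>\<bar>"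

lemma bias_nonneg: "0 \<le> bias m h"
  by (simp add: bias_def)

lemma depends_innovation:
  assumes "1 \<le> m"
  shows "depends m n (innovation m)"
proof -
  have p: "depends m n (proposal m n)"
    using assms n by (intro depends_mono[OF depends_proposal]) (auto simp: processed_def)
  have k: "(m, n) \<in> processed m n" "(m - 1, n) \<in> processed m n"
    using assms n by (auto simp: processed_def)
  show ?thesis
    unfolding depends_def
  proof (intro allI impI)
    fix h h' :: "nat \<times> nat \<Rightarrow> nat \<Rightarrow> 'a" assume eq: "\<forall>k\<in>processed m n. h k = h' k"
    then have "proposal m n h = proposal m n h'"
      by (intro dependsD[OF p]) simp
    with eq k show "innovation m h = innovation m h'"
      by (simp add: innovation_def corrector_def[abs_def])
  qed
qed

lemma depends_bias:
  assumes "1 \<le> m"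
  shows "depends m P (bias m)"
proof -
  have p: "depends m P (proposal m n)"
    using assms n by (intro depends_mono[OF depends_proposal]) (auto simp: processed_def)
  show ?thesis
    unfolding depends_def
  proof (intro allI impI)
    fix h h' :: "nat \<times> nat \<Rightarrow> nat \<Rightarrow> 'a" assume "\<forall>k\<in>processed m P. h k = h' k"
    then have "proposal m n h = proposal m n h'"
      by (intro dependsD[OF p]) simp
    then show "bias m h = bias m h'"
      by (simp add: bias_def)
  qed
qed

lemma measurable_bias:
  assumes "1 \<le> m"
  shows "bias m \<in> borel_measurable (histories m P)"
proof -
  have p: "proposal m n \<in> histories m P \<rightarrow>\<^sub>M prob_algebra (paths E n)"
    using assms n by (intro measurable_proposal) (auto simp: processed_def)
  have "(\<lambda>h. LINT x|proposal m n h. W x * f x) \<in> borel_measurable (histories m P)"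
    using unit_boundedD(1)[OF f_unit] by (intro measurable_compose[OF measurable_prob_algebraD[OF p] integral_measurable_subprob_algebra]) simp
  with mh.measurable_rate[OF p] show ?thesis
    unfolding bias_def by measurable
qed

lemma measurable_corrector:
  assumes "proposal m n \<in> T \<rightarrow>\<^sub>M prob_algebra (paths E n)"
  shows "(\<lambda>(h, x). corrector m h x) \<in> borel_measurable (T \<Otimes>\<^sub>M paths E n)"
proof -
  note [measurable] = mh.measurable_rate[OF assms] mh.measurable_pois[OF assms unit_boundedD(1)[OF f_unit], of N]
  show ?thesis
    unfolding corrector_def by measurable
qed

lemma measurable_innovation:
  assumes m: "1 \<le> m"
  shows "innovation m \<in> borel_measurable (histories m n)"
proof -
  have p: "proposal m n \<in> histories m n \<rightarrow>\<^sub>M prob_algebra (paths E n)"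
    using assms n by (intro measurable_proposal) (auto simp: processed_def)
  note [measurable] = measurable_corrector[OF p] mh.measurable_kern[OF p measurable_corrector[OF p]]
  have [measurable]: "(\<lambda>h. h (m, n)) \<in> histories m n \<rightarrow>\<^sub>M paths E n" "(\<lambda>h. h (m - 1, n)) \<in> histories m n \<rightarrow>\<^sub>M paths E n"
    using n m by (intro measurable_history_component; simp add: processed_def)+
  show ?thesis
    unfolding innovation_def by measurable
qed

context
  fixes m :: nat and h :: "nat \<times> nat \<Rightarrow> nat \<Rightarrow> 'a"
  assumes p: "proposal m n h \<in> space (prob_algebra (paths E n))"
begin

lemma corrector_measurable: "corrector m h \<in> borel_measurable (paths E n)"
  unfolding corrector_def using mh.pois_measurable[OF p unit_boundedD(1)[OF f_unit]] by simp

lemma abs_corrector_le: "x \<in> space (paths E n) \<Longrightarrow> \<bar>corrector m h x\<bar> \<le> 2 / \<epsilon>"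
  unfolding corrector_def using mh.abs_pois_le[OF p unit_boundedD(1)[OF f_unit] unit_boundedD(2)[OF f_unit] \<epsilon>(1)] \<epsilon> by simp

text \<open>For a good rate, the error of the iterate is \<open>mh.pois_Cauchy\<close>, and
  \<open>mh.invar\<close> differs from \<open>c\<close> by a quotient with denominator at least
  \<open>\<epsilon>\<close>. For a bad rate the corrector vanishes, but then \<open>bias\<close>
  exceeds \<open>\<epsilon>\<close> and the trivial bound 2 is at most \<open>2 / \<epsilon>\<close>
  times it.\<close>

lemma poisson_equation_error:
  assumes x: "x \<in> space (paths E n)"
  shows "\<bar>f x - c - (corrector m h x - mh.kern (proposal m n h) (corrector m h) x)\<bar>
    \<le> 2 / \<epsilon> * bias m h + 2 * (1 - \<epsilon>) ^ N"
proof (cases "\<epsilon> \<le> mh.rate (proposal m n h)")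
  case True
  let ?\<rho> = "proposal m n h"
  have "corrector m h = mh.pois ?\<rho> f N"
    using True by (auto simp: corrector_def)
  then have "f x - mh.invar ?\<rho> f - (corrector m h x - mh.kern ?\<rho> (corrector m h) x) =
      mh.pois ?\<rho> f (Suc N) x - mh.pois ?\<rho> f N x"
    using mh.pois_Suc_eq[OF p unit_boundedD(1)[OF f_unit] unit_boundedD(2)[OF f_unit] \<epsilon>(1) True x, of N] by simp
  then have 1: "\<bar>f x - mh.invar ?\<rho> f - (corrector m h x - mh.kern ?\<rho> (corrector m h) x)\<bar> \<le> 2 * (1 - \<epsilon>) ^ N"
    using mh.pois_Cauchy[OF p unit_boundedD(1)[OF f_unit] unit_boundedD(2)[OF f_unit] \<epsilon>(1) True x, of N] by simp
  have r: "0 < mh.rate ?\<rho>"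
    using True \<epsilon> by simp
  define A where "A = (LINT x|?\<rho>. W x * f x)"
  have "mh.invar ?\<rho> f - c = ((A - 2 * \<epsilon> * c) + c * (2 * \<epsilon> - mh.rate ?\<rho>)) / mh.rate ?\<rho>"
    using r by (simp add: mh.invar_def A_def field_simps)
  then have "\<bar>mh.invar ?\<rho> f - c\<bar> = \<bar>(A - 2 * \<epsilon> * c) + c * (2 * \<epsilon> - mh.rate ?\<rho>)\<bar> / mh.rate ?\<rho>"
    using r by simp
  also have "\<bar>(A - 2 * \<epsilon> * c) + c * (2 * \<epsilon> - mh.rate ?\<rho>)\<bar> \<le> bias m h"
  proof -
    have "\<bar>c * (2 * \<epsilon> - mh.rate ?\<rho>)\<bar> \<le> 1 * \<bar>2 * \<epsilon> - mh.rate ?\<rho>\<bar>"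
      using c by (intro abs_mult_le) auto
    then show ?thesis
      by (simp add: bias_def A_def)
  qed
  then have "\<bar>(A - 2 * \<epsilon> * c) + c * (2 * \<epsilon> - mh.rate ?\<rho>)\<bar> / mh.rate ?\<rho> \<le> bias m h / \<epsilon>"
    using True \<epsilon> bias_nonneg by (intro frac_le) auto
  finally have "\<bar>mh.invar ?\<rho> f - c\<bar> \<le> bias m h / \<epsilon>" .
  moreover have "bias m h / \<epsilon> \<le> 2 / \<epsilon> * bias m h"
    using \<epsilon> bias_nonneg[of m h] by (simp add: divide_simps)
  ultimately show ?thesis
    using 1 by linarith
next
  case False
  then have *: "corrector m h = (\<lambda>_. 0)"
    by (auto simp: corrector_def)
  have "\<epsilon> \<le> \<bar>mh.rate (proposal m n h) - 2 * \<epsilon>\<bar>"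
    using False by simp
  also have "\<dots> \<le> bias m h"
    by (simp add: bias_def)
  finally have "2 \<le> 2 / \<epsilon> * bias m h"
    using \<epsilon> by (simp add: field_simps)
  moreover have "0 \<le> 2 * (1 - \<epsilon>) ^ N"
    using \<epsilon> by simp
  moreover have "\<bar>f x - c\<bar> \<le> 2"
    using unit_boundedD(2)[OF f_unit, OF x] c by linarith
  moreover have "mh.kern (proposal m n h) (\<lambda>_. 0) x = 0"
    by (simp add: mh.kern_def)
  ultimately show ?thesis
    unfolding * by simp
qed

end

text \<open>If both rates are good, the Lipschitz bound applies with distance
  \<open>2 / (m + 2)\<close>. Otherwise one of the correctors is 0, so the change is at most
  \<open>2 / \<epsilon>\<close>, while one of the two biases is at least
  \<open>\<epsilon>\<close>.\<close>

lemma corrector_Suc: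
  assumes m: "1 \<le> m" and h: "h \<in> space (histories i l)" "processed (Suc m) (n - 1) \<subseteq> processed i l"
    and x: "x \<in> space (paths E n)"
  shows "\<bar>corrector (Suc m) h x - corrector m h x\<bar>
    \<le> 8 / \<epsilon>\<^sup>2 * (1 / real (m + 2)) + 2 / \<epsilon>\<^sup>2 * (bias (Suc m) h + bias m h)"
proof -
  have p: "proposal m n h \<in> space (prob_algebra (paths E n))"
    using m n h by (intro proposal_prob) (auto simp: processed_def)
  have p': "proposal (Suc m) n h \<in> space (prob_algebra (paths E n))"
    using n h by (intro proposal_prob) auto
  show ?thesis
  proof (cases "\<epsilon> \<le> mh.rate (proposal m n h) \<and> \<epsilon> \<le> mh.rate (proposal (Suc m) n h)")
    case True
    have "\<bar>corrector (Suc m) h x - corrector m h x\<bar> =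
        \<bar>mh.pois (proposal (Suc m) n h) f N x - mh.pois (proposal m n h) f N x\<bar>"
      using True by (simp add: corrector_def)
    also have "\<dots> \<le> 4 * (2 / real (m + 2)) / \<epsilon>\<^sup>2"
      using True x by (intro mh.pois_Lipschitz p p' unit_boundedD(1)[OF f_unit] unit_boundedD(2)[OF f_unit] \<epsilon> integral_proposal_Suc[OF n h]) auto
    also have "\<dots> = 8 / \<epsilon>\<^sup>2 * (1 / real (m + 2))"
      by simp
    also have "\<dots> \<le> 8 / \<epsilon>\<^sup>2 * (1 / real (m + 2)) + 2 / \<epsilon>\<^sup>2 * (bias (Suc m) h + bias m h)"
      using bias_nonneg by simp
    finally show ?thesis .
  next
    case False
    have "\<epsilon> \<le> bias (Suc m) h + bias m h"
    proof -
      have "\<epsilon> \<le> \<bar>mh.rate (proposal m n h) - 2 * \<epsilon>\<bar> \<or> \<epsilon> \<le> \<bar>mh.rate (proposal (Suc m) n h) - 2 * \<epsilon>\<bar>"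
        using False by linarith
      moreover have "\<bar>mh.rate (proposal m n h) - 2 * \<epsilon>\<bar> \<le> bias m h" for m
        by (simp add: bias_def)
      ultimately show ?thesis
        using bias_nonneg by (smt (verit))
    qed
    then have "2 / \<epsilon> \<le> 2 / \<epsilon>\<^sup>2 * (bias (Suc m) h + bias m h)"
      using \<epsilon> by (simp add: field_simps power2_eq_square)
    moreover have "\<bar>corrector (Suc m) h x - corrector m h x\<bar> \<le> 2 / \<epsilon>"
      using False abs_corrector_le[OF p x] abs_corrector_le[OF p' x] by (auto simp: corrector_def)
    moreover have "0 \<le> 8 / \<epsilon>\<^sup>2 * (1 / real (m + 2))"
      by simp
    ultimately show ?thesis
      by linarith
  qed
qed

lemma abs_innovation_le:
  assumes m: "1 \<le> m" and h: "h \<in> space (histories m n)"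
  shows "\<bar>innovation m h\<bar> \<le> 4 / \<epsilon>"
proof -
  have p: "proposal m n h \<in> space (prob_algebra (paths E n))"
    using m n h by (intro proposal_prob) (auto simp: processed_def)
  have "h (m, n) \<in> space (paths E n)" "h (m - 1, n) \<in> space (paths E n)"
    using n m by (auto intro!: space_historiesD[OF h] simp: processed_def)
  then have "\<bar>corrector m h (h (m, n))\<bar> \<le> 2 / \<epsilon>"
    "\<bar>mh.kern (proposal m n h) (corrector m h) (h (m - 1, n))\<bar> \<le> 2 / \<epsilon>"
    using abs_corrector_le[OF p] mh.abs_kern_le[OF p corrector_measurable[OF p] abs_corrector_le[OF p]] by auto
  then show ?thesis
    unfolding innovation_def by linarith
qed

text \<open>The proposal reads only levels below \<open>n\<close>, so writing the new state leaves
  it and the corrector unchanged, and the mean of the corrector under the transition is the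
  subtracted \<open>mh.kern\<close> term.\<close>

lemma integral_innovation:
  assumes m: "1 \<le> m" and h: "h \<in> space (histories m (n - 1))"
  shows "(LINT x|transition m n h. innovation m (h((m, n) := x))) = 0"
proof -
  have p: "proposal m n h \<in> space (prob_algebra (paths E n))"
    using m n h by (intro proposal_prob) auto
  have "transition m n \<in> histories m (n - 1) \<rightarrow>\<^sub>M prob_algebra (paths E n)"
    using m n by (intro measurable_transition) (auto simp: processed_def)
  from measurable_space[OF this h]
  have s: "sets (transition m n h) = sets (paths E n)" and "prob_space (transition m n h)"
    by (auto simp: space_prob_algebra)
  then interpret T: prob_space "transition m n h" by simp
  let ?k = "mh.kern (proposal m n h) (corrector m h) (h (m - 1, n))"
  have "proposal m n (h((m, n) := x)) = proposal m n h" for x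
    using m n by (intro dependsD[OF depends_proposal]) (auto simp: processed_def)
  \<comment> \<open>Truncated subtraction at \<open>m = 0\<close> would make the previous state the
    one just written.\<close>
  moreover have "m - 1 \<noteq> m"
    using m by linarith
  ultimately have "innovation m (h((m, n) := x)) = corrector m h x - ?k" for x
    by (simp add: innovation_def corrector_def[abs_def])
  moreover have "integrable (transition m n h) (corrector m h)"
    using corrector_measurable[OF p] abs_corrector_le[OF p] sets_eq_imp_space_eq[OF s]
    by (intro T.integrable_bounded[where b="2 / \<epsilon>"]) (simp_all add: measurable_cong_sets[OF s refl])
  ultimately show ?thesis
    using integral_transition[OF m h corrector_measurable[OF p] abs_corrector_le[OF p]]
    by (simp add: T.prob_space)
qed

text \<open>Each summand is split into the error of the Poisson equation, an innovation and a
  difference of corrector values. The differences are summed by \<open>sum_telescope\<close>, whose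
  boundary values give \<open>4 / \<epsilon>\<close>.\<close>

lemma abs_sum_error_le:
  assumes h: "h \<in> space (histories (Suc i) P)"
  shows "\<bar>\<Sum>m\<le>Suc i. f (h (m, n)) - c\<bar> \<le> 2 + 4 / \<epsilon> + \<bar>\<Sum>m=1..Suc i. innovation m h\<bar>
    + (2 / \<epsilon> + 4 / \<epsilon>\<^sup>2) * (\<Sum>m=1..Suc i. bias m h) + 8 / \<epsilon>\<^sup>2 * (\<Sum>m=1..i. 1 / real (m + 2))
    + 2 * real (Suc i) * (1 - \<epsilon>) ^ N"
proof -
  define X where "X = (\<lambda>m. h (m, n))"
  define U where "U = (\<lambda>m. corrector m h)"
  have p: "proposal m n h \<in> space (prob_algebra (paths E n))" if "m \<in> {1..Suc i}" for m
    using that n h by (intro proposal_prob) (auto simp: processed_def)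
  have X: "X m \<in> space (paths E n)" if "m \<le> Suc i" for m
    unfolding X_def using that n by (intro space_historiesD[OF h]) (auto simp: processed_def)
  have "(\<Sum>m\<le>Suc i. f (h (m, n)) - c) = (\<Sum>m\<le>i. f (X m) - c) + (f (X (Suc i)) - c)"
    by (simp add: X_def)
  \<comment> \<open>The state \<open>X (m - 1)\<close> from which iteration \<open>m\<close> starts
    is paired with the Poisson equation of that iteration. The final state has no partner and is
    bounded trivially by 2.\<close>
  also have "(\<Sum>m\<le>i. f (X m) - c) = (\<Sum>m=1..Suc i. f (X (m - 1)) - c)"
    by (rule sum.reindex_bij_witness[of _ "\<lambda>m. m - 1" Suc]) auto
  also have "\<dots> = (\<Sum>m=1..Suc i. (f (X (m - 1)) - c - (U m (X (m - 1)) - mh.kern (proposal m n h) (U m) (X (m - 1))))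
      + innovation m h + (U m (X (m - 1)) - U m (X m)))"
    by (intro sum.cong) (auto simp: innovation_def U_def X_def)
  also have "\<dots> = (\<Sum>m=1..Suc i. (f (X (m - 1)) - c - (U m (X (m - 1)) - mh.kern (proposal m n h) (U m) (X (m - 1)))))
      + (\<Sum>m=1..Suc i. innovation m h) + (\<Sum>m=1..Suc i. U m (X (m - 1)) - U m (X m))"
    by (simp only: sum.distrib)
  finally have eq: "(\<Sum>m\<le>Suc i. f (h (m, n)) - c) =
      (\<Sum>m=1..Suc i. (f (X (m - 1)) - c - (U m (X (m - 1)) - mh.kern (proposal m n h) (U m) (X (m - 1)))))
      + (\<Sum>m=1..Suc i. innovation m h) + (U 1 (X 0) - U (Suc i) (X (Suc i)) + (\<Sum>m=1..i. U (Suc m) (X m) - U m (X m)))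
      + (f (X (Suc i)) - c)"
    unfolding sum_telescope .
  have "\<bar>\<Sum>m=1..Suc i. (f (X (m - 1)) - c - (U m (X (m - 1)) - mh.kern (proposal m n h) (U m) (X (m - 1))))\<bar>
      \<le> (\<Sum>m=1..Suc i. 2 / \<epsilon> * bias m h + 2 * (1 - \<epsilon>) ^ N)"
    unfolding U_def using X by (intro sum_abs[THEN order_trans] sum_mono poisson_equation_error p) auto
  also have "\<dots> = 2 / \<epsilon> * (\<Sum>m=1..Suc i. bias m h) + 2 * real (Suc i) * (1 - \<epsilon>) ^ N"
    by (simp add: sum.distrib sum_distrib_left distrib_left algebra_simps)
  finally have 1: "\<bar>\<Sum>m=1..Suc i. (f (X (m - 1)) - c - (U m (X (m - 1)) - mh.kern (proposal m n h) (U m) (X (m - 1))))\<bar>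
      \<le> 2 / \<epsilon> * (\<Sum>m=1..Suc i. bias m h) + 2 * real (Suc i) * (1 - \<epsilon>) ^ N" .
  have "\<bar>\<Sum>m=1..i. U (Suc m) (X m) - U m (X m)\<bar>
      \<le> (\<Sum>m=1..i. 8 / \<epsilon>\<^sup>2 * (1 / real (m + 2)) + 2 / \<epsilon>\<^sup>2 * (bias (Suc m) h + bias m h))"
    unfolding U_def using X n
    by (intro sum_abs[THEN order_trans] sum_mono corrector_Suc[OF _ h]) (auto simp: processed_def)
  also have "\<dots> = 8 / \<epsilon>\<^sup>2 * (\<Sum>m=1..i. 1 / real (m + 2))
      + 2 / \<epsilon>\<^sup>2 * ((\<Sum>m=1..i. bias (Suc m) h) + (\<Sum>m=1..i. bias m h))"
    by (simp only: sum.distrib sum_distrib_left distrib_left)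
  \<comment> \<open>Every bias occurs in at most two consecutive corrector changes, which doubles
    its coefficient to \<open>4 / \<epsilon>^2\<close>.\<close>
  also have "\<dots> \<le> 8 / \<epsilon>\<^sup>2 * (\<Sum>m=1..i. 1 / real (m + 2))
      + 2 / \<epsilon>\<^sup>2 * ((\<Sum>m=1..Suc i. bias m h) + (\<Sum>m=1..Suc i. bias m h))"
  proof (intro add_mono mult_left_mono order_refl)
    have "(\<Sum>m=1..i. bias (Suc m) h) = (\<Sum>m=Suc 1..Suc i. bias m h)"
      by (rule sum.shift_bounds_cl_Suc_ivl[symmetric])
    also have "\<dots> \<le> (\<Sum>m=1..Suc i. bias m h)"
      using bias_nonneg by (intro sum_mono2) auto
    finally show "(\<Sum>m=1..i. bias (Suc m) h) \<le> (\<Sum>m=1..Suc i. bias m h)" .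
    show "(\<Sum>m=1..i. bias m h) \<le> (\<Sum>m=1..Suc i. bias m h)"
      using bias_nonneg by (intro sum_mono2) auto
  qed (simp_all del: One_nat_def)
  also have "\<dots> = 8 / \<epsilon>\<^sup>2 * (\<Sum>m=1..i. 1 / real (m + 2)) + 4 / \<epsilon>\<^sup>2 * (\<Sum>m=1..Suc i. bias m h)"
    by simp
  finally have 2: "\<bar>\<Sum>m=1..i. U (Suc m) (X m) - U m (X m)\<bar>
      \<le> 8 / \<epsilon>\<^sup>2 * (\<Sum>m=1..i. 1 / real (m + 2)) + 4 / \<epsilon>\<^sup>2 * (\<Sum>m=1..Suc i. bias m h)" .
  have 3: "\<bar>U 1 (X 0)\<bar> \<le> 2 / \<epsilon>" "\<bar>U (Suc i) (X (Suc i))\<bar> \<le> 2 / \<epsilon>"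
    unfolding U_def using X by (auto intro!: abs_corrector_le p)
  have 4: "\<bar>f (X (Suc i)) - c\<bar> \<le> 2"
    using unit_boundedD(2)[OF f_unit, OF X[of "Suc i"]] c by linarith
  have "4 / \<epsilon> = 2 / \<epsilon> + 2 / \<epsilon>"
    by simp
  with 1 2 3 4 show ?thesis
    unfolding eq distrib_right by linarith
qed

end

end

context simcmc
begin

lemma sets_target: "n \<in> {1..P} \<Longrightarrow> sets (target n) = sets (paths E n)"
  unfolding target_def paths_def sets_density using sets_ref by (intro sets_PiM_cong) auto

lemma target_prob_algebra: "n \<in> {1..P} \<Longrightarrow> target n \<in> space (prob_algebra (paths E n))"
  using prob_space_target sets_target by (simp add: space_prob_algebra)

lemma abs_integral_target_le:
  assumes n: "n \<in> {1..P}" and f: "f \<in> unit_bounded n"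
  shows "\<bar>LINT x|target n. f x\<bar> \<le> 1"
  using f sets_eq_imp_space_eq[OF sets_target[OF n]]
  by (intro prob_space.abs_expectation_le[OF prob_space_target[OF n]])
     (auto simp: unit_bounded_def measurable_cong_sets[OF sets_target[OF n] refl])

end

section \<open>Exponential moments of the error at one level\<close>

context simcmc_level
begin

context
  fixes x0 :: "nat \<Rightarrow> nat \<Rightarrow> 'a" and \<epsilon> :: real and f :: "(nat \<Rightarrow> 'a) \<Rightarrow> real"
  assumes x0: "\<And>k. k \<in> {1..P} \<Longrightarrow> x0 k \<in> supp k"
    and \<epsilon>: "0 < \<epsilon>" "\<epsilon> \<le> 1 / 2" and f: "f \<in> unit_bounded n"
begin

lemma abs_target_le_1: "\<bar>LINT x|target n. f x\<bar> \<le> 1"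
  by (rule abs_integral_target_le[OF n f])

lemma eps_le_1: "\<epsilon> \<le> 1"
  using \<epsilon> by simp

lemmas bias_measurable = measurable_bias[OF f abs_target_le_1 \<epsilon>(1) eps_le_1]
  and bias_depends = depends_bias[OF f abs_target_le_1 \<epsilon>(1) eps_le_1]
  and bias_nonneg_test = bias_nonneg[OF f abs_target_le_1 \<epsilon>(1) eps_le_1]
  and innovation_facts = measurable_innovation[OF f abs_target_le_1 \<epsilon>(1) eps_le_1]
    depends_innovation[OF f abs_target_le_1 \<epsilon>(1) eps_le_1]
    abs_innovation_le[OF f abs_target_le_1 \<epsilon>(1) eps_le_1]
    integral_innovation[OF f abs_target_le_1 \<epsilon>(1) eps_le_1]

lemma sets_run: "sets (run x0 i P) = sets (histories i P)"
  using run_prob[of x0 i] x0 by (simp add: space_prob_algebra)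

lemma space_run: "space (run x0 i P) = space (histories i P)"
  by (rule sets_eq_imp_space_eq[OF sets_run])

text \<open>The rate is the integral of \<open>W\<close> times the constant 1, so both parts of
  \<open>bias\<close> are instances of the hypothesis, for \<open>f\<close> and for 1. Splitting the
  sum by \<open>exp_add_le\<close> causes the factor 2 in the exponent there.\<close>

lemma nn_integral_exp_bias_le:
  fixes C :: ennreal
  assumes m: "1 \<le> m" "m \<le> i"
    and C: "\<And>F. F \<in> unit_bounded n \<Longrightarrow>
      (\<integral>\<^sup>+h. ennreal (exp (2 * l * sqrt (real (m + 1)) *
        \<bar>(LINT x|proposal m n h. W x * F x) - 2 * \<epsilon> * (LINT x|target n. F x)\<bar>)) \<partial>run x0 m P) \<le> C"
  shows "(\<integral>\<^sup>+h. ennreal (exp (l * sqrt (real (m + 1)) * bias f (LINT x|target n. f x) \<epsilon> m h)) \<partial>run x0 i P) \<le> C + C"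
proof -
  let ?c = "LINT x|target n. f x"
  note [measurable] = bias_measurable[OF m(1)]
  have p: "proposal m n \<in> histories m P \<rightarrow>\<^sub>M prob_algebra (paths E n)"
    using m n by (intro measurable_proposal) (auto simp: processed_def)
  have WF [measurable]: "(\<lambda>h. LINT x|proposal m n h. W x * F x) \<in> borel_measurable (histories m P)"
    if "F \<in> borel_measurable (paths E n)" for F
    using that mh.W_measurable
    by (intro measurable_compose[OF measurable_prob_algebraD[OF p] integral_measurable_subprob_algebra]) simp
  note [measurable] = WF[OF unit_boundedD(1)[OF f]] WF[of "\<lambda>_. 1"]
  have dep: "depends m P (\<lambda>h. ennreal (exp (l * sqrt (real (m + 1)) * bias f ?c \<epsilon> m h)))"
    unfolding depends_def using dependsD[OF bias_depends[OF m(1)]] by metis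
  have one: "(\<lambda>_. 1) \<in> unit_bounded n"
    by (simp add: unit_bounded_def)
  have t1: "(LINT x|target n. (1::real)) = 1"
    using prob_space.prob_space[OF prob_space_target[OF n]] by simp
  define d :: "((nat \<Rightarrow> 'a) \<Rightarrow> real) \<Rightarrow> (nat \<times> nat \<Rightarrow> nat \<Rightarrow> 'a) \<Rightarrow> real" where
    "d = (\<lambda>F h. exp (2 * l * sqrt (real (m + 1)) *
        \<bar>(LINT x|proposal m n h. W x * F x) - 2 * \<epsilon> * (LINT x|target n. F x)\<bar>))"
  have [measurable]: "d f \<in> borel_measurable (histories m P)" "d (\<lambda>_. 1) \<in> borel_measurable (histories m P)"
    unfolding d_def by measurable
  have "(\<integral>\<^sup>+h. ennreal (exp (l * sqrt (real (m + 1)) * bias f ?c \<epsilon> m h)) \<partial>run x0 i P) =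
      (\<integral>\<^sup>+h. ennreal (exp (l * sqrt (real (m + 1)) * bias f ?c \<epsilon> m h)) \<partial>run x0 m P)"
    by (rule nn_integral_run[OF x0 _ dep m(2)]) measurable
  also have "\<dots> \<le> (\<integral>\<^sup>+h. ennreal (d f h) + ennreal (d (\<lambda>_. 1) h) \<partial>run x0 m P)"
  proof (rule nn_integral_mono)
    fix h
    let ?s = "l * sqrt (real (m + 1))"
    have "exp (?s * bias f ?c \<epsilon> m h) \<le>
        exp (2 * (?s * \<bar>(LINT x|proposal m n h. W x * f x) - 2 * \<epsilon> * ?c\<bar>)) +
        exp (2 * (?s * \<bar>mh.rate (proposal m n h) - 2 * \<epsilon>\<bar>))"
      unfolding bias_def[OF f abs_target_le_1 \<epsilon>(1) eps_le_1] distrib_left by (rule exp_add_le)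
    also have "\<dots> = d f h + d (\<lambda>_. 1) h"
      by (simp add: d_def mh.rate_def t1 mult.assoc del: lebesgue_integral_const)
    finally show "ennreal (exp (?s * bias f ?c \<epsilon> m h)) \<le> ennreal (d f h) + ennreal (d (\<lambda>_. 1) h)"
      by (simp add: d_def flip: ennreal_plus)
  qed
  also have "\<dots> = (\<integral>\<^sup>+h. ennreal (d f h) \<partial>run x0 m P) + (\<integral>\<^sup>+h. ennreal (d (\<lambda>_. 1) h) \<partial>run x0 m P)"
    by (intro nn_integral_add) (simp_all add: measurable_cong_sets[OF sets_run refl])
  also have "\<dots> \<le> C + C"
    unfolding d_def by (intro add_mono C f one)
  finally show ?thesis .
qed

text \<open>Azuma-Hoeffding with increments bounded by \<open>4 / \<epsilon>\<close>, applied to the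
  martingale and to its negative. The scale \<open>l / sqrt (i + 1)\<close> cancels the number of
  steps.\<close>

lemma nn_integral_exp_innovations_le:
  assumes l: "0 < l"
  shows "(\<integral>\<^sup>+h. ennreal (exp (l / sqrt (real (i + 1)) * \<bar>\<Sum>m=1..i. innovation f \<epsilon> N m h\<bar>)) \<partial>run x0 i P)
    \<le> 2 * ennreal (exp (8 * l\<^sup>2 / \<epsilon>\<^sup>2))"
proof -
  define s where "s = l / sqrt (real (i + 1))"
  have s: "0 < s"
    using l by (simp add: s_def)
  define M where "M = (\<lambda>h. \<Sum>m=1..i. innovation f \<epsilon> N m h)"
  note facts = innovation_facts[where N=N]
  have e: "real i * (s\<^sup>2 * (4 / \<epsilon>)\<^sup>2 / 2) \<le> 8 * l\<^sup>2 / \<epsilon>\<^sup>2"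
  proof -
    have "real i * (s\<^sup>2 * (4 / \<epsilon>)\<^sup>2 / 2) = real i / real (i + 1) * (8 * l\<^sup>2 / \<epsilon>\<^sup>2)"
      by (simp add: s_def power_divide)
    also have "\<dots> \<le> 1 * (8 * l\<^sup>2 / \<epsilon>\<^sup>2)"
      by (intro mult_right_mono) auto
    finally show ?thesis by simp
  qed
  have M_meas: "M \<in> borel_measurable (histories i P)"
    unfolding M_def using n
    by (intro borel_measurable_sum measurable_depends[OF facts(1) facts(2)]) (auto simp: processed_def)
  have 1: "(\<integral>\<^sup>+h. ennreal (exp (s * M h)) \<partial>run x0 i P) \<le> ennreal (exp (real i * (s\<^sup>2 * (4 / \<epsilon>)\<^sup>2 / 2)))"
    unfolding M_def by (intro nn_integral_exp_martingale_le[where n=n] x0 n s facts)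
  have 2: "(\<integral>\<^sup>+h. ennreal (exp (s * (\<Sum>m=1..i. - innovation f \<epsilon> N m h))) \<partial>run x0 i P)
      \<le> ennreal (exp (real i * (s\<^sup>2 * (4 / \<epsilon>)\<^sup>2 / 2)))"
  proof (intro nn_integral_exp_martingale_le[where n=n] x0 n s)
    fix m :: nat assume m: "1 \<le> m"
    show "depends m n (\<lambda>h. - innovation f \<epsilon> N m h)"
      using facts(2)[OF m] unfolding depends_def by metis
  qed (use facts in auto)
  have "(\<integral>\<^sup>+h. ennreal (exp (s * \<bar>M h\<bar>)) \<partial>run x0 i P) \<le>
      (\<integral>\<^sup>+h. ennreal (exp (s * M h)) + ennreal (exp (s * (\<Sum>m=1..i. - innovation f \<epsilon> N m h))) \<partial>run x0 i P)"
  proof (rule nn_integral_mono)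
    fix h
    have "exp (s * \<bar>M h\<bar>) = exp \<bar>s * M h\<bar>"
      using s by (simp add: abs_mult)
    also have "\<dots> \<le> exp (s * M h) + exp (- (s * M h))"
      by (rule exp_abs_le)
    also have "- (s * M h) = s * (\<Sum>m=1..i. - innovation f \<epsilon> N m h)"
      by (simp add: M_def sum_negf)
    finally show "ennreal (exp (s * \<bar>M h\<bar>)) \<le>
        ennreal (exp (s * M h)) + ennreal (exp (s * (\<Sum>m=1..i. - innovation f \<epsilon> N m h)))"
      by (simp flip: ennreal_plus)
  qed
  also have "\<dots> = (\<integral>\<^sup>+h. ennreal (exp (s * M h)) \<partial>run x0 i P) +
      (\<integral>\<^sup>+h. ennreal (exp (s * (\<Sum>m=1..i. - innovation f \<epsilon> N m h))) \<partial>run x0 i P)"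
  proof (rule nn_integral_add)
    show "(\<lambda>h. ennreal (exp (s * (\<Sum>m=1..i. - innovation f \<epsilon> N m h)))) \<in> borel_measurable (run x0 i P)"
      using M_meas by (simp add: sum_negf M_def measurable_cong_sets[OF sets_run refl])
  qed (use M_meas in \<open>simp add: measurable_cong_sets[OF sets_run refl]\<close>)
  also have "\<dots> \<le> ennreal (exp (8 * l\<^sup>2 / \<epsilon>\<^sup>2)) + ennreal (exp (8 * l\<^sup>2 / \<epsilon>\<^sup>2))"
    using e by (intro add_mono order_trans[OF 1] order_trans[OF 2] ennreal_leI) simp_all
  finally show ?thesis
    by (simp add: s_def M_def mult_2)
qed

lemma scaled_error_le:
  assumes l: "0 < l" and N: "real (Suc k) * (1 - \<epsilon>) ^ N \<le> 1" and h: "h \<in> space (histories (Suc k) P)"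
  defines "c \<equiv> (LINT x|target n. f x)" and "s \<equiv> sqrt (real (Suc k + 1))"
  shows "l * s * \<bar>(LINT x|empirical n (Suc k) h. f x) - c\<bar> \<le> l * (4 + 4 / \<epsilon> + 16 / \<epsilon>\<^sup>2)
    + (l / s * \<bar>\<Sum>m=1..Suc k. innovation f \<epsilon> N m h\<bar>
      + l * (2 / \<epsilon> + 4 / \<epsilon>\<^sup>2) / s * (\<Sum>m=1..Suc k. bias f c \<epsilon> m h))"
proof -
  have s: "1 \<le> s" "s * s = real (Suc k + 1)"
    by (simp_all add: s_def)
  define I where "I = \<bar>\<Sum>m=1..Suc k. innovation f \<epsilon> N m h\<bar>"
  define D where "D = (\<Sum>m=1..Suc k. bias f c \<epsilon> m h)"
  have "(LINT x|empirical n (Suc k) h. f x) = (\<Sum>m\<le>Suc k. f (h (m, n))) / real (Suc k + 1)"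
    using n by (intro integral_empirical unit_boundedD(1)[OF f] space_historiesD[OF h]) (auto simp: processed_def)
  then have "(LINT x|empirical n (Suc k) h. f x) - c = (\<Sum>m\<le>Suc k. f (h (m, n)) - c) / (s * s)"
    unfolding s(2) by (simp add: sum_subtractf field_simps)
  then have "l * s * \<bar>(LINT x|empirical n (Suc k) h. f x) - c\<bar> = l / s * \<bar>\<Sum>m\<le>Suc k. f (h (m, n)) - c\<bar>"
    using s(1) by (simp add: abs_mult)
  also have "\<dots> \<le> l / s * (2 + 4 / \<epsilon> + I + (2 / \<epsilon> + 4 / \<epsilon>\<^sup>2) * D + 8 / \<epsilon>\<^sup>2 * (2 * s) + 2)"
  proof (rule mult_left_mono)
    \<comment> \<open>This harmonic sum grows only logarithmically, but order \<open>s\<close> is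
      enough and gives the constant \<open>16 / \<epsilon>^2\<close>.\<close>
    have "(\<Sum>m=1..k. 1 / real (m + 2)) \<le> (\<Sum>m=1..k. 1 / sqrt (real m))"
    proof (rule sum_mono)
      fix m assume m: "m \<in> {1..k}"
      have "sqrt (real m) * 1 \<le> sqrt (real m) * sqrt (real m)"
        using m by (intro mult_left_mono) auto
      then have "sqrt (real m) \<le> real (m + 2)"
        by simp
      then show "1 / real (m + 2) \<le> 1 / sqrt (real m)"
        using m by (intro divide_left_mono) auto
    qed
    also have "\<dots> \<le> 2 * sqrt (real k)"
      by (rule sum_inverse_sqrt_le)
    also have "\<dots> \<le> 2 * s"
      by (simp add: s_def)
    finally have "8 / \<epsilon>\<^sup>2 * (\<Sum>m=1..k. 1 / real (m + 2)) \<le> 8 / \<epsilon>\<^sup>2 * (2 * s)"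
      by (intro mult_left_mono) auto
    then show "\<bar>\<Sum>m\<le>Suc k. f (h (m, n)) - c\<bar> \<le>
        2 + 4 / \<epsilon> + I + (2 / \<epsilon> + 4 / \<epsilon>\<^sup>2) * D + 8 / \<epsilon>\<^sup>2 * (2 * s) + 2"
      using abs_sum_error_le[OF f abs_target_le_1 \<epsilon>(1) eps_le_1 h, of N] N unfolding I_def D_def c_def by linarith
  qed (use l s in auto)
  also have "\<dots> = l * (4 + 4 / \<epsilon>) / s + l * (16 / \<epsilon>\<^sup>2) + (l / s * I + l * (2 / \<epsilon> + 4 / \<epsilon>\<^sup>2) / s * D)"
    using s(1) \<epsilon>(1) by (simp add: field_simps)
  also have "\<dots> \<le> l * (4 + 4 / \<epsilon>) + l * (16 / \<epsilon>\<^sup>2) + (l / s * I + l * (2 / \<epsilon> + 4 / \<epsilon>\<^sup>2) / s * D)"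
  proof (intro add_right_mono)
    have "l * (4 + 4 / \<epsilon>) * 1 \<le> l * (4 + 4 / \<epsilon>) * s"
      using s(1) \<epsilon>(1) l by (intro mult_left_mono) auto
    then show "l * (4 + 4 / \<epsilon>) / s \<le> l * (4 + 4 / \<epsilon>)"
      using s(1) by (simp add: divide_le_eq)
  qed
  finally show ?thesis
    by (simp add: I_def D_def distrib_left)
qed

text \<open>The factor 8 collects three doublings of the scale: separating the biases from the
  innovations, Jensen's inequality over the iterations, and splitting each bias into its two
  parts.\<close>

lemma nn_integral_exp_error_le:
  fixes l C :: real
  assumes l: "0 < l" and C0: "0 \<le> C"
  defines "\<kappa> \<equiv> l * (2 / \<epsilon> + 4 / \<epsilon>\<^sup>2)"
  assumes C: "\<And>F m. F \<in> unit_bounded n \<Longrightarrow> 1 \<le> m \<Longrightarrow>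
      (\<integral>\<^sup>+h. ennreal (exp (8 * \<kappa> * sqrt (real (m + 1)) *
        \<bar>(LINT x|proposal m n h. W x * F x) - 2 * \<epsilon> * (LINT x|target n. F x)\<bar>)) \<partial>run x0 m P) \<le> ennreal C"
  shows "(\<integral>\<^sup>+h. ennreal (exp (l * sqrt (real (Suc k + 1)) *
      \<bar>(LINT x|empirical n (Suc k) h. f x) - (LINT x|target n. f x)\<bar>)) \<partial>run x0 (Suc k) P)
    \<le> ennreal (exp (l * (4 + 4 / \<epsilon> + 16 / \<epsilon>\<^sup>2)) * (2 * exp (32 * l\<^sup>2 / \<epsilon>\<^sup>2) + 2 * C))"
proof -
  \<comment> \<open>The number of iterates may depend on \<open>k\<close>, because none of the
    bounds on moments below involves \<open>N\<close>.\<close>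
  obtain N where N: "real (Suc k) * (1 - \<epsilon>) ^ N \<le> 1"
  proof -
    have "1 - \<epsilon> < 1"
      using \<epsilon> by simp
    then obtain N where "(1 - \<epsilon>) ^ N < 1 / real (Suc k)"
      using real_arch_pow_inv[of "1 / real (Suc k)" "1 - \<epsilon>"] by auto
    then have "real (Suc k) * (1 - \<epsilon>) ^ N \<le> 1"
      by (simp add: field_simps)
    then show ?thesis by (rule that)
  qed
  define s where "s = sqrt (real (Suc k + 1))"
  define K where "K = exp (l * (4 + 4 / \<epsilon> + 16 / \<epsilon>\<^sup>2))"
  define I where "I = (\<lambda>h. \<bar>\<Sum>m=1..Suc k. innovation f \<epsilon> N m h\<bar>)"
  define b where "b = bias f (LINT x|target n. f x) \<epsilon>"
  define D where "D = (\<lambda>h. \<Sum>m=1..Suc k. b m h)"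
  have \<kappa>: "0 < \<kappa>"
    unfolding \<kappa>_def using l \<epsilon> by (intro mult_pos_pos add_pos_pos) auto
  have b_meas: "b m \<in> borel_measurable (run x0 (Suc k) P)" if "m \<in> {1..Suc k}" for m
    unfolding b_def measurable_cong_sets[OF sets_run refl] using that
    by (intro measurable_depends[OF bias_measurable bias_depends]) (auto simp: processed_def)
  have [measurable]: "I \<in> borel_measurable (run x0 (Suc k) P)"
    unfolding I_def measurable_cong_sets[OF sets_run refl] using n
    by (intro borel_measurable_abs borel_measurable_sum
        measurable_depends[OF innovation_facts(1,2)])
       (auto simp: processed_def)
  have [measurable]: "D \<in> borel_measurable (run x0 (Suc k) P)"
    unfolding D_def by (intro borel_measurable_sum b_meas)
  have I_le: "(\<integral>\<^sup>+h. ennreal (exp (2 * l / s * I h)) \<partial>run x0 (Suc k) P) \<le> 2 * ennreal (exp (32 * l\<^sup>2 / \<epsilon>\<^sup>2))"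
    using nn_integral_exp_innovations_le[of "2 * l" "Suc k" N] l
    unfolding I_def s_def by (simp add: power_mult_distrib del: of_nat_Suc)
  have D_le: "(\<integral>\<^sup>+h. ennreal (exp (2 * \<kappa> / s * D h)) \<partial>run x0 (Suc k) P) \<le> ennreal C + ennreal C"
    unfolding D_def s_def
  proof (rule nn_integral_exp_sum_le)
    fix m assume m: "m \<in> {1..Suc k}"
    then show "(\<integral>\<^sup>+h. ennreal (exp (2 * (2 * \<kappa>) * sqrt (real (m + 1)) * b m h)) \<partial>run x0 (Suc k) P)
        \<le> ennreal C + ennreal C"
      unfolding b_def using C by (intro nn_integral_exp_bias_le) auto
  qed (use \<kappa> b_meas bias_nonneg_test in \<open>auto simp: b_def\<close>)
  have "(\<integral>\<^sup>+h. ennreal (exp (l * s * \<bar>(LINT x|empirical n (Suc k) h. f x) - (LINT x|target n. f x)\<bar>)) \<partial>run x0 (Suc k) P)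
     \<le> (\<integral>\<^sup>+h. ennreal K * (ennreal (exp (2 * l / s * I h)) + ennreal (exp (2 * \<kappa> / s * D h))) \<partial>run x0 (Suc k) P)"
  proof (rule nn_integral_mono)
    fix h assume "h \<in> space (run x0 (Suc k) P)"
    then have h: "h \<in> space (histories (Suc k) P)"
      by (simp add: space_run)
    have "exp (l * s * \<bar>(LINT x|empirical n (Suc k) h. f x) - (LINT x|target n. f x)\<bar>)
       \<le> exp (l * (4 + 4 / \<epsilon> + 16 / \<epsilon>\<^sup>2) + (l / s * I h + \<kappa> / s * D h))"
      using scaled_error_le[OF l N h] by (simp add: I_def D_def \<kappa>_def b_def s_def del: of_nat_Suc)
    also have "\<dots> = K * exp (l / s * I h + \<kappa> / s * D h)"
      by (simp add: K_def exp_add)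
    also have "\<dots> \<le> K * (exp (2 * (l / s * I h)) + exp (2 * (\<kappa> / s * D h)))"
      by (intro mult_left_mono exp_add_le) (simp add: K_def)
    also have "\<dots> = K * (exp (2 * l / s * I h) + exp (2 * \<kappa> / s * D h))"
      by (simp add: mult.assoc)
    finally show "ennreal (exp (l * s * \<bar>(LINT x|empirical n (Suc k) h. f x) - (LINT x|target n. f x)\<bar>))
       \<le> ennreal K * (ennreal (exp (2 * l / s * I h)) + ennreal (exp (2 * \<kappa> / s * D h)))"
      by (simp add: K_def ennreal_mult[symmetric] flip: ennreal_plus)
  qed
  also have "\<dots> = ennreal K * ((\<integral>\<^sup>+h. ennreal (exp (2 * l / s * I h)) \<partial>run x0 (Suc k) P)
      + (\<integral>\<^sup>+h. ennreal (exp (2 * \<kappa> / s * D h)) \<partial>run x0 (Suc k) P))"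
    by (subst nn_integral_cmult, measurable) (subst nn_integral_add, simp_all)
  also have "\<dots> \<le> ennreal K * (2 * ennreal (exp (32 * l\<^sup>2 / \<epsilon>\<^sup>2)) + (ennreal C + ennreal C))"
    by (intro mult_left_mono add_mono I_le D_le) simp
  also have "\<dots> = ennreal (K * (2 * exp (32 * l\<^sup>2 / \<epsilon>\<^sup>2) + 2 * C))"
    using C0 by (simp only: K_def mult_2 ennreal_mult ennreal_plus exp_ge_zero add_nonneg_nonneg)
  finally show ?thesis
    by (simp add: s_def K_def)
qed

end

text \<open>Reduces a level to the errors of its proposals integrated against \<open>W * F\<close>;
  \<open>e\<close> is the limit of the rate.\<close>

lemma exp_moment_bound_step:
  assumes e: "0 < e" "e \<le> 1"
    and H: "\<And>l. 0 < l \<Longrightarrow> \<exists>C::real. \<forall>x0 F m. (\<forall>k\<in>{1..P}. x0 k \<in> supp k) \<longrightarrow> F \<in> unit_bounded n \<longrightarrow> 1 \<le> m \<longrightarrow>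
      (\<integral>\<^sup>+h. ennreal (exp (l * sqrt (real (m + 1)) *
        \<bar>(LINT x|proposal m n h. W x * F x) - e * (LINT x|target n. F x)\<bar>)) \<partial>run x0 m P) \<le> ennreal C"
  shows "exp_moment_bound n"
  unfolding exp_moment_bound_def
proof (intro allI impI)
  fix l :: real assume l: "0 < l"
  \<comment> \<open>Half of the limit rate as threshold: a rate below it deviates from
    \<open>2 * \<epsilon>\<close> by more than \<open>\<epsilon>\<close>.\<close>
  define \<epsilon> where "\<epsilon> = e / 2"
  have \<epsilon>: "0 < \<epsilon>" "\<epsilon> \<le> 1 / 2" "2 * \<epsilon> = e"
    using e by (auto simp: \<epsilon>_def)
  define \<kappa> where "\<kappa> = l * (2 / \<epsilon> + 4 / \<epsilon>\<^sup>2)"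
  have "0 < 8 * \<kappa>"
    unfolding \<kappa>_def using l \<epsilon> by (intro mult_pos_pos add_pos_pos) auto
  then obtain C0 :: real where C0: "\<And>x0 F m. (\<forall>k\<in>{1..P}. x0 k \<in> supp k) \<Longrightarrow> F \<in> unit_bounded n \<Longrightarrow> 1 \<le> m \<Longrightarrow>
      (\<integral>\<^sup>+h. ennreal (exp (8 * \<kappa> * sqrt (real (m + 1)) *
        \<bar>(LINT x|proposal m n h. W x * F x) - e * (LINT x|target n. F x)\<bar>)) \<partial>run x0 m P) \<le> ennreal C0"
    using H[of "8 * \<kappa>"] by blast
  define C where "C = max C0 0"
  have C: "0 \<le> C" "ennreal C0 \<le> ennreal C"
    by (auto simp: C_def intro: ennreal_leI)
  define R where "R = max (exp (2 * l)) (exp (l * (4 + 4 / \<epsilon> + 16 / \<epsilon>\<^sup>2)) * (2 * exp (32 * l\<^sup>2 / \<epsilon>\<^sup>2) + 2 * C))"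
  show "\<exists>C::real. \<forall>x0 f i. (\<forall>k\<in>{1..P}. x0 k \<in> supp k) \<longrightarrow> f \<in> unit_bounded n \<longrightarrow>
    (\<integral>\<^sup>+h. ennreal (exp (l * sqrt (real (i + 1)) *
      \<bar>(LINT x|empirical n i h. f x) - (LINT x|target n. f x)\<bar>)) \<partial>run x0 i P) \<le> ennreal C"
  proof (intro exI[of _ R] allI impI)
    fix x0 f and i :: nat
    assume x0: "\<forall>k\<in>{1..P}. x0 k \<in> supp k" and f: "f \<in> unit_bounded n"
    show "(\<integral>\<^sup>+h. ennreal (exp (l * sqrt (real (i + 1)) *
      \<bar>(LINT x|empirical n i h. f x) - (LINT x|target n. f x)\<bar>)) \<partial>run x0 i P) \<le> ennreal R"
    proof (cases i)
      \<comment> \<open>No move has been made yet, so only the trivial bound 2 on the error is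
        available.\<close>
      case 0
      have r: "prob_space (run x0 0 P)" "sets (run x0 0 P) = sets (histories 0 P)"
        using run_prob[of x0 0] x0 by (simp_all add: space_prob_algebra del: run.simps)
      have "(\<integral>\<^sup>+h. ennreal (exp (l * sqrt (real (0 + 1)) *
          \<bar>(LINT x|empirical n 0 h. f x) - (LINT x|target n. f x)\<bar>)) \<partial>run x0 0 P)
          \<le> (\<integral>\<^sup>+h. ennreal (exp (2 * l)) \<partial>run x0 0 P)"
      proof (rule nn_integral_mono)
        fix h assume "h \<in> space (run x0 0 P)"
        then have h: "h \<in> space (histories 0 P)"
          using sets_eq_imp_space_eq[OF r(2)] by simp
        have X: "h (0, n) \<in> space (paths E n)"
          using n by (intro space_historiesD[OF h]) (auto simp: processed_def)
        have "(LINT x|empirical n 0 h. f x) = (\<Sum>m\<le>0. f (h (m, n))) / real (0 + 1)"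
          using X f by (intro integral_empirical) (auto simp: unit_bounded_def)
        moreover have "\<bar>f (h (0, n))\<bar> \<le> 1"
          using X f by (auto simp: unit_bounded_def)
        ultimately have "\<bar>(LINT x|empirical n 0 h. f x) - (LINT x|target n. f x)\<bar> \<le> 2"
          using abs_integral_target_le[OF n f] by simp
        then show "ennreal (exp (l * sqrt (real (0 + 1)) *
            \<bar>(LINT x|empirical n 0 h. f x) - (LINT x|target n. f x)\<bar>)) \<le> ennreal (exp (2 * l))"
          using l by (intro ennreal_leI) (simp add: mult.commute)
      qed
      also have "\<dots> = ennreal (exp (2 * l))"
        using r(1) by (simp add: prob_space.emeasure_space_1 del: run.simps)
      also have "\<dots> \<le> ennreal R"
        by (intro ennreal_leI) (simp add: R_def)
      finally show ?thesis
        using 0 by simp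
    next
      case (Suc k)
      have "(\<integral>\<^sup>+h. ennreal (exp (l * sqrt (real (Suc k + 1)) *
          \<bar>(LINT x|empirical n (Suc k) h. f x) - (LINT x|target n. f x)\<bar>)) \<partial>run x0 (Suc k) P)
        \<le> ennreal (exp (l * (4 + 4 / \<epsilon> + 16 / \<epsilon>\<^sup>2)) * (2 * exp (32 * l\<^sup>2 / \<epsilon>\<^sup>2) + 2 * C))"
      proof (rule nn_integral_exp_error_le)
        fix F and m :: nat assume "F \<in> unit_bounded n" "1 \<le> m"
        then show "(\<integral>\<^sup>+h. ennreal (exp (8 * (l * (2 / \<epsilon> + 4 / \<epsilon>\<^sup>2)) * sqrt (real (m + 1)) *
          \<bar>(LINT x|proposal m n h. W x * F x) - 2 * \<epsilon> * (LINT x|target n. F x)\<bar>)) \<partial>run x0 m P) \<le> ennreal C"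
          unfolding \<epsilon>(3) \<kappa>_def[symmetric] using C0[OF x0] C(2) order_trans by blast
      qed (use x0 \<epsilon> f l C in auto)
      also have "\<dots> \<le> ennreal R"
        by (intro ennreal_leI) (simp add: R_def)
      finally show ?thesis
        using Suc by simp
    qed
  qed
qed

end

section \<open>Induction over the levels\<close>

context simcmc
begin

lemma nn_integral_PiM_split:
  fixes G :: "(nat \<Rightarrow> 'a) \<Rightarrow> ennreal"
  assumes k: "k \<in> {1..P}" and G: "G \<in> borel_measurable (Pi\<^sub>M {1..k} ref)"
  shows "(\<integral>\<^sup>+z. G z \<partial>Pi\<^sub>M {1..k} ref) = (\<integral>\<^sup>+x. \<integral>\<^sup>+y. G (x(k := y)) \<partial>ref k \<partial>Pi\<^sub>M {1..k - 1} ref)"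
proof -
  \<comment> \<open>The product theory asks for sigma-finiteness at every index, whereas
    \<open>ref\<close> is constrained on \<open>{1..P}\<close> only; any admissible filler works
    elsewhere.\<close>
  define M where "M = (\<lambda>i. if i \<in> {1..P} then ref i else ref 1)"
  have "sigma_finite_measure (M i)" for i
    using sigma_finite_ref P_ge_1 by (simp add: M_def)
  then interpret product_sigma_finite M
    by (rule product_sigma_finite.intro)
  have eq: "Pi\<^sub>M {1..j} ref = Pi\<^sub>M {1..j} M" if "j \<le> P" for j
    using that by (intro PiM_cong) (auto simp: M_def)
  have ins: "{1..k} = insert k {1..k - 1}"
    using k by auto
  have "G \<in> borel_measurable (Pi\<^sub>M (insert k {1..k - 1}) M)"
    using G k eq[of k] ins by simp
  then have "(\<integral>\<^sup>+z. G z \<partial>Pi\<^sub>M (insert k {1..k - 1}) M) = (\<integral>\<^sup>+x. \<integral>\<^sup>+y. G (x(k := y)) \<partial>M k \<partial>Pi\<^sub>M {1..k - 1} M)"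
    using k by (intro product_nn_integral_insert) auto
  moreover have "M k = ref k"
    using k by (simp add: M_def)
  moreover have "Pi\<^sub>M {1..k - 1} ref = Pi\<^sub>M {1..k - 1} M"
    using k by (intro eq) auto
  moreover have "Pi\<^sub>M {1..k} ref = Pi\<^sub>M (insert k {1..k - 1}) M"
    using k eq[of k] ins by simp
  ultimately show ?thesis
    by simp
qed

lemma sets_PiM_ref: "k \<le> P \<Longrightarrow> sets (Pi\<^sub>M {1..k} ref) = sets (paths E k)"
  unfolding paths_def using sets_ref by (intro sets_PiM_cong) auto

lemma space_PiM_ref: "k \<le> P \<Longrightarrow> space (Pi\<^sub>M {1..k} ref) = space (paths E k)"
  by (rule sets_eq_imp_space_eq[OF sets_PiM_ref])

lemma gamma_measurable: "k \<in> {1..P} \<Longrightarrow> \<gamma> k \<in> borel_measurable (paths E k)"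
  using borel_measurable_integrable[OF gamma_integrable[of k]] measurable_cong_sets[OF sets_PiM_ref[of k] refl]
  by auto

lemma nn_integral_target:
  assumes k: "k \<in> {1..P}" and F: "F \<in> borel_measurable (paths E k)"
  shows "(\<integral>\<^sup>+x. F x \<partial>target k) = (\<integral>\<^sup>+x. ennreal (\<gamma> k x / Z k) * F x \<partial>Pi\<^sub>M {1..k} ref)"
proof -
  have [measurable_cong]: "sets (Pi\<^sub>M {1..k} ref) = sets (paths E k)"
    using k by (intro sets_PiM_ref) auto
  note [measurable] = F gamma_measurable[OF k]
  show ?thesis
    unfolding target_def by (rule nn_integral_density) measurable
qed

lemma nn_integral_append_kernel:
  assumes k: "k \<in> {2..P}" and x: "x \<in> space (paths E (k - 1))" and F: "F \<in> borel_measurable (paths E k)"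
  shows "(\<integral>\<^sup>+z. F z \<partial>append_kernel k x) = (\<integral>\<^sup>+y. ennreal (q k x y) * F (x(k := y)) \<partial>ref k)"
proof -
  note [measurable] = F
  have [measurable_cong]: "sets (ref k) = sets E"
    using k sets_ref by simp
  have "(\<lambda>(x, y). x(k := y)) \<in> paths E (k - 1) \<Otimes>\<^sub>M E \<rightarrow>\<^sub>M paths E k"
    using k by (intro measurable_append) simp
  from measurable_compose[OF measurable_Pair1'[OF x] this]
  have [measurable]: "(\<lambda>y. x(k := y)) \<in> E \<rightarrow>\<^sub>M paths E k"
    by simp
  from measurable_compose[OF measurable_Pair1'[OF x] q_measurable[OF k]]
  have [measurable]: "q k x \<in> borel_measurable E"
    by simp
  show ?thesis
    unfolding append_kernel_def
    by (subst nn_integral_distr, measurable) (subst nn_integral_density, measurable)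
qed

end

section \<open>The limit of the proposals and its reweighting to the target\<close>

context simcmc_level
begin

text \<open>The value 1 at the first level reflects that \<open>q1\<close> is already normalized; in
  all cases \<open>prop_density / prev_Z\<close> is the density of
  \<open>limit_proposal\<close>.\<close>

definition prev_Z :: real
  where "prev_Z = (if n = 1 then 1 else Z (n - 1))"

definition prop_density :: "(nat \<Rightarrow> 'a) \<Rightarrow> real"
  where "prop_density x =
    (if n = 1 then q1 (x 1) else \<gamma> (n - 1) (restrict x {1..n - 1}) * q n (restrict x {1..n - 1}) (x n))"

text \<open>The proposal with the empirical measure of the previous level replaced by its
  target.\<close>

definition limit_proposal :: "(nat \<Rightarrow> 'a) measure"
  where "limit_proposal =
    (if n = 1 then distr (density (ref 1) (\<lambda>y. ennreal (q1 y))) (paths E 1) (\<lambda>y. \<lambda>k\<in>{1}. y)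
     else extend n (target (n - 1)))"

lemma prev_Z_pos: "0 < prev_Z"
proof (cases "n = 1")
  case False
  then have "n - 1 \<in> {1..P}"
    using n by auto
  from Z_pos[OF this] False show ?thesis
    by (simp add: prev_Z_def)
next
  case True
  then show ?thesis
    unfolding prev_Z_def by simp
qed

lemma limit_proposal_prob: "limit_proposal \<in> space (prob_algebra (paths E n))"
proof (cases "n = 1")
  case True
  have h: "(\<lambda>_. undefined) \<in> space (histories 0 0)"
    by (simp add: histories_def processed_def space_PiM)
  have "proposal 0 n (\<lambda>_. undefined) \<in> space (prob_algebra (paths E n))"
    by (rule measurable_space[OF measurable_proposal[OF n, of 0 0 0] h]) (use True in auto)
  also have "proposal 0 n (\<lambda>_. undefined) = limit_proposal"
    unfolding limit_proposal_def using True by (simp add: proposal_def)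
  finally show ?thesis .
next
  case False
  with n have n2: "n \<in> {2..P}" "n - 1 \<in> {1..P}" by auto
  have "target (n - 1) \<bind> append_kernel n \<in> space (prob_algebra (paths E n))"
    using measurable_space[OF measurable_bind_prob_space[OF measurable_const[OF target_prob_algebra[OF n2(2)]]
        append_kernel(1)[OF n2(1)]], of undefined "count_space UNIV"] by simp
  then show ?thesis
    using False append_kernel(2)[OF n2(1) target_prob_algebra[OF n2(2)]] by (simp add: limit_proposal_def)
qed

text \<open>The definition of the weight with its denominator cleared. Where
  \<open>\<gamma> n x > 0\<close>, the bound on the weights excludes a zero denominator; elsewhere
  both sides vanish.\<close>

lemma prop_density_W:
  assumes x: "x \<in> space (paths E n)"
  shows "0 \<le> prop_density x" "prop_density x * W x = \<gamma> n x / B"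
proof -
  have xn: "x n \<in> space E"
    using x n by (auto simp: paths_def space_PiM)
  show nonneg: "0 \<le> prop_density x"
  proof (cases "n = 1")
    case True
    then show ?thesis
      unfolding prop_density_def using xn q1_nonneg by simp
  next
    case False
    with n have n2: "n \<in> {2..P}" "n - 1 \<in> {1..P}" by auto
    have "restrict x {1..n - 1} \<in> space (paths E (n - 1))"
      using x by (auto simp: paths_def space_PiM)
    then show ?thesis
      using False gamma_nonneg[OF n2(2)] q_nonneg[OF n2(1) _ xn] by (simp add: prop_density_def)
  qed
  have w: "weight n x = ennreal (\<gamma> n x) / ennreal (prop_density x)"
    by (auto simp: weight_def prop_density_def)
  have g: "0 \<le> \<gamma> n x"
    using gamma_nonneg[OF n x] .
  show "prop_density x * W x = \<gamma> n x / B"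
  proof (cases "\<gamma> n x = 0")
    case True
    then show ?thesis
      using w by (simp add: W_def)
  next
    case False
    have "prop_density x \<noteq> 0"
    proof
      assume "prop_density x = 0"
      with False g have "weight n x = \<top>"
        by (simp add: w ennreal_divide_zero)
      then show False
        using weight_le'[OF x] by (simp add: top_unique)
    qed
    then show ?thesis
      using nonneg g B_pos by (simp add: W_def w divide_ennreal field_simps)
  qed
qed

lemma nn_integral_limit_proposal:
  fixes G :: "(nat \<Rightarrow> 'a) \<Rightarrow> ennreal"
  assumes G: "G \<in> borel_measurable (paths E n)"
  shows "(\<integral>\<^sup>+z. G z \<partial>limit_proposal) =
    (\<integral>\<^sup>+x. \<integral>\<^sup>+y. ennreal (prop_density (x(n := y)) / prev_Z) * G (x(n := y)) \<partial>ref n \<partial>Pi\<^sub>M {1..n - 1} ref)"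
proof (cases "n = 1")
  case True
  note [measurable] = G[unfolded True] q1_measurable
  have [measurable_cong]: "sets (ref 1) = sets E"
    using P_ge_1 sets_ref by simp
  have [measurable]: "(\<lambda>y. \<lambda>k\<in>{1}. y) \<in> E \<rightarrow>\<^sub>M paths E 1"
    unfolding paths_def atLeastAtMost_singleton by (intro measurable_restrict) auto
  \<comment> \<open>At the first level the outer integral runs over the empty product, a point mass
    at the everywhere undefined function.\<close>
  have upd: "(\<lambda>k\<in>{1}. y) = (\<lambda>_. undefined)(1 := y)" for y :: 'a
    by (auto simp: fun_eq_iff)
  have "(\<integral>\<^sup>+z. G z \<partial>limit_proposal) = (\<integral>\<^sup>+y. ennreal (q1 y) * G (\<lambda>k\<in>{1}. y) \<partial>ref 1)"
    unfolding limit_proposal_def using True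
    by (simp del: One_nat_def) (subst nn_integral_distr, measurable, subst nn_integral_density, measurable)
  also have "\<dots> = (\<integral>\<^sup>+x. \<integral>\<^sup>+y. ennreal (prop_density (x(n := y)) / prev_Z) * G (x(n := y)) \<partial>ref n \<partial>Pi\<^sub>M {1..n - 1} ref)"
    unfolding prop_density_def prev_Z_def upd using True
    by (simp add: PiM_empty nn_integral_count_space_finite fun_upd_def)
  finally show ?thesis .
next
  case False
  with n have n2: "n \<in> {2..P}" "n - 1 \<in> {1..P}" "n - 1 \<le> P" by auto
  have K: "append_kernel n \<in> target (n - 1) \<rightarrow>\<^sub>M subprob_algebra (paths E n)"
    unfolding measurable_cong_sets[OF sets_target[OF n2(2)] refl]
    by (rule measurable_prob_algebraD[OF append_kernel(1)[OF n2(1)]])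
  have KG: "(\<lambda>x. \<integral>\<^sup>+z. G z \<partial>append_kernel n x) \<in> borel_measurable (paths E (n - 1))"
    using measurable_compose[OF measurable_prob_algebraD[OF append_kernel(1)[OF n2(1)]]
        nn_integral_measurable_subprob_algebra[OF G]] .
  have "(\<integral>\<^sup>+z. G z \<partial>limit_proposal) = (\<integral>\<^sup>+x. \<integral>\<^sup>+z. G z \<partial>append_kernel n x \<partial>target (n - 1))"
    unfolding limit_proposal_def if_not_P[OF False] append_kernel(2)[OF n2(1) target_prob_algebra[OF n2(2)]]
    by (rule nn_integral_bind[OF G K])
  also have "\<dots> = (\<integral>\<^sup>+x. ennreal (\<gamma> (n - 1) x / Z (n - 1)) * (\<integral>\<^sup>+z. G z \<partial>append_kernel n x) \<partial>Pi\<^sub>M {1..n - 1} ref)"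
    by (rule nn_integral_target[OF n2(2) KG])
  also have "\<dots> = (\<integral>\<^sup>+x. \<integral>\<^sup>+y. ennreal (prop_density (x(n := y)) / prev_Z) * G (x(n := y)) \<partial>ref n \<partial>Pi\<^sub>M {1..n - 1} ref)"
  proof (rule nn_integral_cong)
    fix x assume "x \<in> space (Pi\<^sub>M {1..n - 1} ref)"
    then have x: "x \<in> space (paths E (n - 1))"
      using space_PiM_ref[OF n2(3)] by simp
    note [measurable] = G
    have [measurable_cong]: "sets (ref n) = sets E"
      using n sets_ref by simp
    have "(\<lambda>(x, y). x(n := y)) \<in> paths E (n - 1) \<Otimes>\<^sub>M E \<rightarrow>\<^sub>M paths E n"
      using n by (intro measurable_append) simp
    from measurable_compose[OF measurable_Pair1'[OF x] this]
    have [measurable]: "(\<lambda>y. x(n := y)) \<in> E \<rightarrow>\<^sub>M paths E n"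
      by simp
    from measurable_compose[OF measurable_Pair1'[OF x] q_measurable[OF n2(1)]]
    have [measurable]: "q n x \<in> borel_measurable E"
      by simp
    have restr: "restrict (x(n := y)) {1..n - 1} = x" for y
      using x n by (auto simp: paths_def space_PiM PiE_def extensional_def fun_eq_iff)
    have "ennreal (\<gamma> (n - 1) x / Z (n - 1)) * (\<integral>\<^sup>+z. G z \<partial>append_kernel n x) =
        (\<integral>\<^sup>+y. ennreal (\<gamma> (n - 1) x / Z (n - 1)) * (ennreal (q n x y) * G (x(n := y))) \<partial>ref n)"
      unfolding nn_integral_append_kernel[OF n2(1) x G] by (rule nn_integral_cmult[symmetric]) measurable
    also have "\<dots> = (\<integral>\<^sup>+y. ennreal (prop_density (x(n := y)) / prev_Z) * G (x(n := y)) \<partial>ref n)"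
    proof (rule nn_integral_cong)
      fix y assume "y \<in> space (ref n)"
      then have "0 \<le> q n x y"
        using sets_eq_imp_space_eq[OF \<open>sets (ref n) = sets E\<close>] by (intro q_nonneg n2 x) simp
      moreover have "0 \<le> \<gamma> (n - 1) x / Z (n - 1)"
        using gamma_nonneg[OF n2(2) x] Z_pos[OF n2(2)] by simp
      ultimately show "ennreal (\<gamma> (n - 1) x / Z (n - 1)) * (ennreal (q n x y) * G (x(n := y))) =
          ennreal (prop_density (x(n := y)) / prev_Z) * G (x(n := y))"
        using False restr by (simp add: prop_density_def prev_Z_def mult.assoc[symmetric] ennreal_mult[symmetric])
    qed
    finally show "ennreal (\<gamma> (n - 1) x / Z (n - 1)) * (\<integral>\<^sup>+z. G z \<partial>append_kernel n x) =
      (\<integral>\<^sup>+y. ennreal (prop_density (x(n := y)) / prev_Z) * G (x(n := y)) \<partial>ref n)" .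
  qed
  finally show ?thesis .
qed

text \<open>The mean of \<open>W\<close> under \<open>limit_proposal\<close>, as a ratio of
  normalizing constants.\<close>

definition limit_rate :: real
  where "limit_rate = Z n / (prev_Z * B)"

text \<open>The identity \<open>\<omega>(\<pi>\<^sub>n\<^sub>-\<^sub>1) = \<pi>\<^sub>n\<close> in
  unnormalized form. By \<open>prop_density_W\<close> the densities of both sides agree pointwise,
  up to the constants collected in \<open>limit_rate\<close>.\<close>

lemma density_limit_proposal:
  "density limit_proposal (\<lambda>x. ennreal (W x)) = density (target n) (\<lambda>_. ennreal limit_rate)"
proof (rule measure_eqI)
  have lp: "sets limit_proposal = sets (paths E n)"
    using limit_proposal_prob by (simp add: space_prob_algebra)
  show "sets (density limit_proposal (\<lambda>x. ennreal (W x))) = sets (density (target n) (\<lambda>_. ennreal limit_rate))"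
    using lp sets_target[OF n] by simp
  fix A assume "A \<in> sets (density limit_proposal (\<lambda>x. ennreal (W x)))"
  then have A [measurable]: "A \<in> sets (paths E n)"
    using lp by simp
  note [measurable] = mh.W_measurable gamma_measurable[OF n]
  have [measurable_cong]: "sets (Pi\<^sub>M {1..n} ref) = sets (paths E n)"
    using n by (intro sets_PiM_ref) auto
  have lr: "0 \<le> limit_rate"
    using Z_pos[OF n] prev_Z_pos B_pos by (simp add: limit_rate_def)
  have "emeasure (density limit_proposal (\<lambda>x. ennreal (W x))) A = (\<integral>\<^sup>+x. ennreal (W x) * indicator A x \<partial>limit_proposal)"
    using A lp by (intro emeasure_density) (simp_all add: measurable_cong_sets[OF lp refl])
  also have "\<dots> = (\<integral>\<^sup>+x. \<integral>\<^sup>+y. ennreal (prop_density (x(n := y)) / prev_Z) *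
      (ennreal (W (x(n := y))) * indicator A (x(n := y))) \<partial>ref n \<partial>Pi\<^sub>M {1..n - 1} ref)"
    by (rule nn_integral_limit_proposal) measurable
  also have "\<dots> = (\<integral>\<^sup>+x. \<integral>\<^sup>+y. ennreal limit_rate * (ennreal (\<gamma> n (x(n := y)) / Z n) * indicator A (x(n := y)))
      \<partial>ref n \<partial>Pi\<^sub>M {1..n - 1} ref)"
  proof (intro nn_integral_cong)
    fix x y assume "x \<in> space (Pi\<^sub>M {1..n - 1} ref)" "y \<in> space (ref n)"
    then have "x \<in> space (paths E (n - 1))" "y \<in> space E"
      using space_PiM_ref[of "n - 1"] n sets_eq_imp_space_eq[OF sets_ref[OF n]] by auto
    then have z: "x(n := y) \<in> space (paths E n)"
      using measurable_space[OF measurable_append[of n]] n by (auto simp: space_pair_measure)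
    have "prop_density (x(n := y)) / prev_Z * W (x(n := y)) = limit_rate * (\<gamma> n (x(n := y)) / Z n)"
      using prop_density_W(2)[OF z] Z_pos[OF n] prev_Z_pos B_pos by (simp add: limit_rate_def field_simps)
    moreover have "0 \<le> prop_density (x(n := y)) / prev_Z" "0 \<le> W (x(n := y))" "0 \<le> \<gamma> n (x(n := y)) / Z n"
      using prop_density_W(1)[OF z] prev_Z_pos W_bounds[OF z] gamma_nonneg[OF n z] Z_pos[OF n] by auto
    ultimately show "ennreal (prop_density (x(n := y)) / prev_Z) * (ennreal (W (x(n := y))) * indicator A (x(n := y))) =
        ennreal limit_rate * (ennreal (\<gamma> n (x(n := y)) / Z n) * indicator A (x(n := y)))"
      using lr by (simp add: mult.assoc[symmetric] ennreal_mult[symmetric] del: times_divide_eq_left times_divide_eq_right)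
  qed
  also have "\<dots> = (\<integral>\<^sup>+x. ennreal limit_rate * (ennreal (\<gamma> n x / Z n) * indicator A x) \<partial>Pi\<^sub>M {1..n} ref)"
    by (rule nn_integral_PiM_split[OF n, symmetric]) measurable
  also have "\<dots> = ennreal limit_rate * (\<integral>\<^sup>+x. ennreal (\<gamma> n x / Z n) * indicator A x \<partial>Pi\<^sub>M {1..n} ref)"
    by (rule nn_integral_cmult) measurable
  also have "\<dots> = ennreal limit_rate * (\<integral>\<^sup>+x. indicator A x \<partial>target n)"
    by (subst nn_integral_target[OF n]) auto
  also have "\<dots> = emeasure (density (target n) (\<lambda>_. ennreal limit_rate)) A"
    using A sets_target[OF n] by (simp add: emeasure_density_const)
  finally show "emeasure (density limit_proposal (\<lambda>x. ennreal (W x))) A =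
    emeasure (density (target n) (\<lambda>_. ennreal limit_rate)) A" .
qed

lemma integral_limit_proposal:
  assumes F: "F \<in> borel_measurable (paths E n)"
  shows "(LINT x|limit_proposal. W x * F x) = limit_rate * (LINT x|target n. F x)"
proof -
  have lp: "sets limit_proposal = sets (paths E n)"
    using limit_proposal_prob by (simp add: space_prob_algebra)
  have lr: "0 \<le> limit_rate"
    using Z_pos[OF n] prev_Z_pos B_pos by (simp add: limit_rate_def)
  have "(LINT x|limit_proposal. W x * F x) = (LINT x|density limit_proposal (\<lambda>x. ennreal (W x)). F x)"
    using F mh.W_measurable W_bounds(1) sets_eq_imp_space_eq[OF lp]
    by (subst integral_density) (auto simp: measurable_cong_sets[OF lp refl])
  also have "\<dots> = limit_rate * (LINT x|target n. F x)"
    unfolding density_limit_proposal using F lr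
    by (subst integral_density) (auto simp: measurable_cong_sets[OF sets_target[OF n] refl])
  finally show ?thesis .
qed

lemma limit_rate_bounds: "0 < limit_rate" "limit_rate \<le> 1"
proof -
  show "0 < limit_rate"
    using Z_pos[OF n] prev_Z_pos B_pos by (simp add: limit_rate_def)
  have "mh.rate limit_proposal = limit_rate"
    using integral_limit_proposal[of "\<lambda>_. 1"] prob_space.prob_space[OF prob_space_target[OF n]]
    by (simp add: mh.rate_def)
  then show "limit_rate \<le> 1"
    using mh.rate_bounds(2)[OF limit_proposal_prob] by simp
qed

text \<open>The first proposal equals its limit, so the error of the proposal is 0 and its
  exponential moment is 1.\<close>

lemma exp_moment_bound_1:
  assumes "n = 1"
  shows "exp_moment_bound n"
proof (rule exp_moment_bound_step[OF limit_rate_bounds])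
  fix l :: real assume "0 < l"
  show "\<exists>C::real. \<forall>x0 F m. (\<forall>k\<in>{1..P}. x0 k \<in> supp k) \<longrightarrow> F \<in> unit_bounded n \<longrightarrow> 1 \<le> m \<longrightarrow>
      (\<integral>\<^sup>+h. ennreal (exp (l * sqrt (real (m + 1)) *
        \<bar>(LINT x|proposal m n h. W x * F x) - limit_rate * (LINT x|target n. F x)\<bar>)) \<partial>run x0 m P) \<le> ennreal C"
  proof (intro exI[of _ 1] allI impI)
    fix x0 F and m :: nat assume x0: "\<forall>k\<in>{1..P}. x0 k \<in> supp k" and F: "F \<in> unit_bounded n"
    have "proposal m n h = limit_proposal" for h
      unfolding limit_proposal_def using assms by (simp add: proposal_def)
    moreover have "prob_space (run x0 m P)"
      using run_prob[of x0 m] x0 by (simp add: space_prob_algebra)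
    moreover have "F \<in> borel_measurable (paths E n)"
      using F by (simp add: unit_bounded_def)
    ultimately show "(\<integral>\<^sup>+h. ennreal (exp (l * sqrt (real (m + 1)) *
        \<bar>(LINT x|proposal m n h. W x * F x) - limit_rate * (LINT x|target n. F x)\<bar>)) \<partial>run x0 m P) \<le> ennreal 1"
      by (simp add: integral_limit_proposal prob_space.emeasure_space_1)
  qed
qed

text \<open>Averaging \<open>W * F\<close> over the appended coordinate gives a unit-bounded
  function \<open>g\<close> at level \<open>n - 1\<close>, and the proposal error for
  \<open>F\<close> is exactly the empirical error for \<open>g\<close>.\<close>

lemma exp_moment_bound_Suc:
  assumes n2: "n \<in> {2..P}" and prev: "exp_moment_bound (n - 1)"
  shows "exp_moment_bound n"
proof (rule exp_moment_bound_step[OF limit_rate_bounds])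
  fix l :: real assume "0 < l"
  with prev obtain C :: real where C: "\<And>x0 f i. (\<forall>k\<in>{1..P}. x0 k \<in> supp k) \<Longrightarrow> f \<in> unit_bounded (n - 1) \<Longrightarrow>
    (\<integral>\<^sup>+h. ennreal (exp (l * sqrt (real (i + 1)) *
      \<bar>(LINT x|empirical (n - 1) i h. f x) - (LINT x|target (n - 1). f x)\<bar>)) \<partial>run x0 i P) \<le> ennreal C"
    unfolding exp_moment_bound_def by blast
  have n1: "n - 1 \<in> {1..P}"
    using n2 by auto
  show "\<exists>C::real. \<forall>x0 F m. (\<forall>k\<in>{1..P}. x0 k \<in> supp k) \<longrightarrow> F \<in> unit_bounded n \<longrightarrow> 1 \<le> m \<longrightarrow>
      (\<integral>\<^sup>+h. ennreal (exp (l * sqrt (real (m + 1)) *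
        \<bar>(LINT x|proposal m n h. W x * F x) - limit_rate * (LINT x|target n. F x)\<bar>)) \<partial>run x0 m P) \<le> ennreal C"
  proof (intro exI[of _ C] allI impI)
    fix x0 F and m :: nat assume x0: "\<forall>k\<in>{1..P}. x0 k \<in> supp k" and F: "F \<in> unit_bounded n"
    have Fm: "F \<in> borel_measurable (paths E n)" and Fb: "\<And>x. x \<in> space (paths E n) \<Longrightarrow> \<bar>F x\<bar> \<le> 1"
      using F by (auto simp: unit_bounded_def)
    define g where "g = (\<lambda>x. LINT y|append_kernel n x. W y * F y)"
    have WFm: "(\<lambda>y. W y * F y) \<in> borel_measurable (paths E n)"
      using Fm mh.W_measurable by measurable
    have WFb: "\<bar>W x * F x\<bar> \<le> 1" if "x \<in> space (paths E n)" for x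
      using abs_mult_le[of "W x" 1 "F x" 1] W_bounds[OF that] Fb[OF that] by simp
    have g: "g \<in> unit_bounded (n - 1)"
      unfolding g_def unit_bounded_def using integral_append_kernel[OF n2 WFm WFb] by blast
    have "(LINT x|target (n - 1). g x) = (LINT x|extend n (target (n - 1)). W x * F x)"
      unfolding g_def by (rule integral_extend[OF n2 target_prob_algebra[OF n1] WFm WFb, symmetric])
    also have "\<dots> = limit_rate * (LINT x|target n. F x)"
      using integral_limit_proposal[OF Fm] n2 by (simp add: limit_proposal_def)
    finally have tg: "(LINT x|target (n - 1). g x) = limit_rate * (LINT x|target n. F x)" .
    have "sets (run x0 m P) = sets (histories m P)"
      using run_prob[of x0 m] x0 by (simp add: space_prob_algebra)
    then have sp: "space (run x0 m P) = space (histories m P)"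
      by (rule sets_eq_imp_space_eq)
    have "(\<integral>\<^sup>+h. ennreal (exp (l * sqrt (real (m + 1)) *
        \<bar>(LINT x|proposal m n h. W x * F x) - limit_rate * (LINT x|target n. F x)\<bar>)) \<partial>run x0 m P) =
      (\<integral>\<^sup>+h. ennreal (exp (l * sqrt (real (m + 1)) *
        \<bar>(LINT x|empirical (n - 1) m h. g x) - (LINT x|target (n - 1). g x)\<bar>)) \<partial>run x0 m P)"
    proof (rule nn_integral_cong)
      fix h assume "h \<in> space (run x0 m P)"
      then have h: "h \<in> space (histories m P)"
        by (simp add: sp)
      have "(LINT x|proposal m n h. W x * F x) = (LINT x|empirical (n - 1) m h. g x)"
        unfolding g_def using n2
        by (intro integral_proposal(2)[OF n2 _ WFm WFb] space_historiesD[OF h]) (auto simp: processed_def)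
      then show "ennreal (exp (l * sqrt (real (m + 1)) *
          \<bar>(LINT x|proposal m n h. W x * F x) - limit_rate * (LINT x|target n. F x)\<bar>)) =
        ennreal (exp (l * sqrt (real (m + 1)) *
          \<bar>(LINT x|empirical (n - 1) m h. g x) - (LINT x|target (n - 1). g x)\<bar>))"
        unfolding tg by simp
    qed
    also have "\<dots> \<le> ennreal C"
      by (rule C[OF x0 g])
    finally show "(\<integral>\<^sup>+h. ennreal (exp (l * sqrt (real (m + 1)) *
        \<bar>(LINT x|proposal m n h. W x * F x) - limit_rate * (LINT x|target n. F x)\<bar>)) \<partial>run x0 m P) \<le> ennreal C" .
  qed
qed

end

section \<open>From exponential moments at every level to the moments of order
  \<open>p\<close>\<close>

context simcmc
begin

lemma exp_moment_bound:
  assumes B: "\<And>n. n \<in> {1..P} \<Longrightarrow> \<exists>B::real. \<forall>x\<in>supp n. weight n x \<le> ennreal B"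
    and n: "n \<in> {1..P}"
  shows "exp_moment_bound n"
proof -
  have level: "\<exists>B. simcmc_level P E ref \<gamma> q1 q k B" if k: "k \<in> {1..P}" for k
  proof -
    obtain B :: real where "\<forall>x\<in>supp k. weight k x \<le> ennreal B"
      using B[OF k] by blast
    \<comment> \<open>The weights are divided by the bound at each level, so the given one is
      enlarged to be positive.\<close>
    moreover have "ennreal B \<le> ennreal (max B 1)"
      by (intro ennreal_leI) simp
    ultimately have "simcmc_level P E ref \<gamma> q1 q k (max B 1)"
      using k by unfold_locales (auto intro: order_trans)
    then show ?thesis ..
  qed
  have "1 \<le> n" "n \<le> P"
    using n by auto
  then show ?thesis
  proof (induction n rule: dec_induct)
    case base
    then obtain B where "simcmc_level P E ref \<gamma> q1 q 1 B"
      using level[of 1] by auto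
    then show ?case
      by (rule simcmc_level.exp_moment_bound_1) simp
  next
    case (step n)
    then obtain B where "simcmc_level P E ref \<gamma> q1 q (Suc n) B"
      using level[of "Suc n"] by auto
    then show ?case
      by (rule simcmc_level.exp_moment_bound_Suc) (use step in auto)
  qed
qed

text \<open>The exponential moment is used at the scale \<open>l = p\<close>, through
  \<open>powr_le_exp\<close> for \<open>sqrt (i + 1)\<close> times the error.\<close>

lemma Lp_error_le:
  fixes C p :: real
  assumes x0: "\<And>k. k \<in> {1..P} \<Longrightarrow> x0 k \<in> supp k" and n: "n \<in> {1..P}"
    and f: "f \<in> unit_bounded n" and p: "1 \<le> p" and C0: "0 \<le> C"
    and C: "(\<integral>\<^sup>+h. ennreal (exp (p * sqrt (real (i + 1)) *
      \<bar>(LINT x|empirical n i h. f x) - (LINT x|target n. f x)\<bar>)) \<partial>run x0 i P) \<le> ennreal C"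
  shows "(LINT h|run x0 i P. \<bar>(LINT x|empirical n i h. f x) - (LINT x|target n. f x)\<bar> powr p) powr (1 / p)
    \<le> C powr (1 / p) / sqrt (real (i + 1))"
proof -
  define s where "s = sqrt (real (i + 1))"
  have s: "0 < s"
    by (simp add: s_def)
  define err where "err = (\<lambda>h. \<bar>(LINT x|empirical n i h. f x) - (LINT x|target n. f x)\<bar>)"
  have int: "integrable (run x0 i P) (\<lambda>h. err h powr p)"
    unfolding err_def by (rule integrable_error[OF x0 n f p])
  have "ennreal (s powr p * (LINT h|run x0 i P. err h powr p)) = ennreal (LINT h|run x0 i P. s powr p * err h powr p)"
    by simp
  also have "\<dots> = (\<integral>\<^sup>+h. ennreal (s powr p * err h powr p) \<partial>run x0 i P)"
    using int by (intro nn_integral_eq_integral[symmetric]) auto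
  also have "\<dots> \<le> (\<integral>\<^sup>+h. ennreal (exp (p * s * err h)) \<partial>run x0 i P)"
  proof (intro nn_integral_mono ennreal_leI)
    fix h
    have "s powr p * err h powr p = (s * err h) powr p"
      using s by (simp add: powr_mult err_def)
    also have "\<dots> \<le> exp (p * (s * err h))"
      using s p by (intro powr_le_exp) (auto simp: err_def)
    finally show "s powr p * err h powr p \<le> exp (p * s * err h)"
      by (simp add: mult.assoc)
  qed
  also have "\<dots> \<le> ennreal C"
    using C by (simp add: s_def err_def)
  finally have "s powr p * (LINT h|run x0 i P. err h powr p) \<le> C"
    using C0 by (simp add: ennreal_le_iff)
  then have "(LINT h|run x0 i P. err h powr p) \<le> C / s powr p"
    using s by (simp add: field_simps)
  then have "(LINT h|run x0 i P. err h powr p) powr (1 / p) \<le> (C / s powr p) powr (1 / p)"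
    using p by (intro powr_mono2) auto
  also have "\<dots> = C powr (1 / p) / s"
    using s C0 p by (simp add: powr_divide powr_powr)
  finally show ?thesis
    by (simp add: err_def s_def)
qed

end

theorem theorem3p1:
  fixes P :: nat
    and E :: "'a measure"
    and ref :: "nat \<Rightarrow> 'a measure"
    and \<gamma> :: "nat \<Rightarrow> (nat \<Rightarrow> 'a) \<Rightarrow> real"
    and q1 :: "'a \<Rightarrow> real"
    and q :: "nat \<Rightarrow> (nat \<Rightarrow> 'a) \<Rightarrow> 'a \<Rightarrow> real"
  assumes model: "simcmc P E ref \<gamma> q1 q"
    and bounded_weights:
      "\<forall>n\<in>{1..P}. \<exists>B::real. \<forall>x\<in>simcmc.supp E ref \<gamma> n. simcmc.weight \<gamma> q1 q n x \<le> ennreal B"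
  shows "\<exists>(C1 :: nat \<Rightarrow> real) (C2 :: real \<Rightarrow> real).
    \<forall>n\<in>{1..P}. \<forall>p\<ge>1. \<forall>x0 :: nat \<Rightarrow> nat \<Rightarrow> 'a.
      (\<forall>k\<in>{1..P}. x0 k \<in> simcmc.supp E ref \<gamma> k) \<longrightarrow>
      (\<forall>f\<in>simcmc.unit_bounded E n. \<forall>i :: nat.
        (LINT h|simcmc.run P E ref \<gamma> q1 q x0 i P.
          \<bar>(LINT x|simcmc.empirical E n i h. f x) - (LINT x|simcmc.target ref \<gamma> n. f x)\<bar> powr p)
          powr (1 / p)
        \<le> C1 n * C2 p / sqrt (real (i + 1)))"
proof -
  interpret simcmc P E ref \<gamma> q1 q
    by (rule model)
  have "\<forall>n\<in>{1..P}. \<forall>p>0. \<exists>C::real. \<forall>x0 f i.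
    (\<forall>k\<in>{1..P}. x0 k \<in> supp k) \<longrightarrow> f \<in> unit_bounded n \<longrightarrow>
    (\<integral>\<^sup>+h. ennreal (exp (p * sqrt (real (i + 1)) *
      \<bar>(LINT x|empirical n i h. f x) - (LINT x|target n. f x)\<bar>)) \<partial>run x0 i P) \<le> ennreal C"
    using exp_moment_bound bounded_weights unfolding exp_moment_bound_def by blast
  then obtain C :: "nat \<Rightarrow> real \<Rightarrow> real" where C: "\<And>n p x0 f i. n \<in> {1..P} \<Longrightarrow> 0 < p \<Longrightarrow>
    (\<forall>k\<in>{1..P}. x0 k \<in> supp k) \<Longrightarrow> f \<in> unit_bounded n \<Longrightarrow>
    (\<integral>\<^sup>+h. ennreal (exp (p * sqrt (real (i + 1)) *
      \<bar>(LINT x|empirical n i h. f x) - (LINT x|target n. f x)\<bar>)) \<partial>run x0 i P) \<le> ennreal (C n p)"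
    by metis
  \<comment> \<open>The constants so far depend jointly on level and \<open>p\<close>. Summing over
    the finitely many levels makes them depend on \<open>p\<close> alone, so that the level constant
    can be 1.\<close>
  define C2 where "C2 = (\<lambda>p. (\<Sum>k=1..P. \<bar>C k p\<bar>) powr (1 / p))"
  show ?thesis
  proof (intro exI[of _ "\<lambda>_ :: nat. 1 :: real"] exI[of _ C2] ballI allI impI)
    fix n and p :: real and x0 :: "nat \<Rightarrow> nat \<Rightarrow> 'a" and f and i :: nat
    assume n: "n \<in> {1..P}" and p: "1 \<le> p" and x0: "\<forall>k\<in>{1..P}. x0 k \<in> supp k" and f: "f \<in> unit_bounded n"
    have "\<bar>C n p\<bar> \<le> (\<Sum>k=1..P. \<bar>C k p\<bar>)"
      using n by (intro member_le_sum) auto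
    then have "C n p \<le> (\<Sum>k=1..P. \<bar>C k p\<bar>)"
      by linarith
    then have le: "ennreal (C n p) \<le> ennreal (\<Sum>k=1..P. \<bar>C k p\<bar>)"
      by (rule ennreal_leI)
    have "0 < p"
      using p by simp
    from order_trans[OF C[OF n this x0 f] le]
    show "(LINT h|run x0 i P. \<bar>(LINT x|empirical n i h. f x) - (LINT x|target n. f x)\<bar> powr p) powr (1 / p)
        \<le> 1 * C2 p / sqrt (real (i + 1))"
      unfolding C2_def mult_1 using x0 by (intro Lp_error_le n f p sum_nonneg) auto
  qed
qed

end
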